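(* Let $\sigma$ be a partition of the set of all primes, let $G$ be a finite group and let $n$ be a positive integer. The set of all $\sigma$-subnormal subgroups $A$ of $G$ with $l_\sigma(A)\leq n$ forms a sublattice of the lattice of all subgroups of $G$.
   Context: All groups are finite. $\sigma=\{\sigma_i\mid i\in I\}$, $I\subseteq\mathbb{N}$, is a partition of the set $\mathbb{P}$ of all primes: $\mathbb{P}=\bigcup_{i\in I}\sigma_i$ and $\sigma_i\cap\sigma_j=\emptyset$ for $i\neq j$. A group is $\sigma$-primary if it is a $\sigma_i$-group for some $i$ (all primes dividing its order lie in a single $\sigma_i$); $\sigma$-nilpotent if it is a direct product of some $\sigma$-primary groups; $\sigma$-soluble if every chief factor of it is $\sigma$-primary. The $\sigma$-nilpotent length $l_\sigma(A)$ is defined for $\sigma$-soluble groups $A$ (so the condition $l_\sigma(A)\leq n$ includes that $A$ is $\sigma$-soluble) and is the length of the shortest normal chain of $A$ with $\sigma$-nilpotent factors. A subgroup $A$ of $G$ is $\sigma$-subnormal in $G$ if there is a subgroup chain $A=A_0\leq A_1\leq\cdots\leq A_t=G$ such that for each $i=1,\ldots,t$ either $A_{i-1}\trianglelefteq A_i$ or $A_i/(A_{i-1})_{A_i}$ is $\sigma$-primary, where $(A_{i-1})_{A_i}$ is the largest normal subgroup of $A_i$ contained in $A_{i-1}$. In the lattice of all subgroups of $G$, the meet of $A,B$ is $A\cap B$ and the join is $\langle A,B\rangle$. *)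

theory Defs
  imports
    "HOL-Algebra.Product_Groups"
    "HOL-Algebra.Generated_Groups"
    "HOL-Computational_Algebra.Primes"
begin

definition prime_partition :: "nat set \<Rightarrow> (nat \<Rightarrow> nat set) \<Rightarrow> bool" where
  "prime_partition I \<sigma> \<longleftrightarrow>
     (\<Union>i\<in>I. \<sigma> i) = {p. prime p} \<and> (\<forall>i\<in>I. \<forall>j\<in>I. i \<noteq> j \<longrightarrow> \<sigma> i \<inter> \<sigma> j = {})"

definition sigma_primary ::
    "nat set \<Rightarrow> (nat \<Rightarrow> nat set) \<Rightarrow> ('a, 'b) monoid_scheme \<Rightarrow> bool" where
  "sigma_primary I \<sigma> G \<longleftrightarrow> group G \<and> finite (carrier G) \<and>
     (\<exists>i\<in>I. \<forall>p. prime p \<and> p dvd order G \<longrightarrow> p \<in> \<sigma> i)"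

text \<open>
  The factors may be taken to live on the element type of \<open>G\<close>, because every factor of a
  direct product isomorphic to \<open>G\<close> is isomorphic to a subgroup of \<open>G\<close>. The empty
  product is allowed; it is the trivial group, which is also \<open>\<sigma>\<close>-primary.
\<close>
definition sigma_nilpotent ::
    "nat set \<Rightarrow> (nat \<Rightarrow> nat set) \<Rightarrow> ('a, 'b) monoid_scheme \<Rightarrow> bool" where
  "sigma_nilpotent I \<sigma> G \<longleftrightarrow> group G \<and>
     (\<exists>(J :: nat set) (H :: nat \<Rightarrow> 'a monoid).
        finite J \<and> (\<forall>j\<in>J. sigma_primary I \<sigma> (H j)) \<and> G \<cong> product_group J H)"

text \<open>\<open>H / K\<close> is a chief factor of \<open>G\<close>.\<close>
definition chief_factor :: "('a, 'b) monoid_scheme \<Rightarrow> 'a set \<Rightarrow> 'a set \<Rightarrow> bool" where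
  "chief_factor G H K \<longleftrightarrow> H \<lhd> G \<and> K \<lhd> G \<and> K \<subset> H \<and>
     (\<forall>N. N \<lhd> G \<and> K \<subseteq> N \<and> N \<subseteq> H \<longrightarrow> N = K \<or> N = H)"

definition sigma_soluble ::
    "nat set \<Rightarrow> (nat \<Rightarrow> nat set) \<Rightarrow> ('a, 'b) monoid_scheme \<Rightarrow> bool" where
  "sigma_soluble I \<sigma> G \<longleftrightarrow>
     (\<forall>H K. chief_factor G H K \<longrightarrow> sigma_primary I \<sigma> (G\<lparr>carrier := H\<rparr> Mod K))"

text \<open>The terms of a normal chain are normal in the whole group; its length \<open>k\<close> is the
  number of factors.\<close>
definition sigma_nilpotent_normal_chain ::
    "nat set \<Rightarrow> (nat \<Rightarrow> nat set) \<Rightarrow> ('a, 'b) monoid_scheme \<Rightarrow> nat \<Rightarrow> (nat \<Rightarrow> 'a set) \<Rightarrow> bool" where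
  "sigma_nilpotent_normal_chain I \<sigma> G k C \<longleftrightarrow>
     C 0 = {\<one>\<^bsub>G\<^esub>} \<and> C k = carrier G \<and> (\<forall>i\<le>k. C i \<lhd> G) \<and>
     (\<forall>i<k. C i \<subseteq> C (Suc i) \<and> sigma_nilpotent I \<sigma> (G\<lparr>carrier := C (Suc i)\<rparr> Mod C i))"

text \<open>Meaningful only for finite \<open>\<sigma>\<close>-soluble groups, where a chain exists (a chief series).\<close>
definition sigma_length ::
    "nat set \<Rightarrow> (nat \<Rightarrow> nat set) \<Rightarrow> ('a, 'b) monoid_scheme \<Rightarrow> nat" where
  "sigma_length I \<sigma> G = (LEAST k. \<exists>C. sigma_nilpotent_normal_chain I \<sigma> G k C)"

definition sigma_length_le ::
    "nat set \<Rightarrow> (nat \<Rightarrow> nat set) \<Rightarrow> ('a, 'b) monoid_scheme \<Rightarrow> nat \<Rightarrow> bool" where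
  "sigma_length_le I \<sigma> G n \<longleftrightarrow> sigma_soluble I \<sigma> G \<and> sigma_length I \<sigma> G \<le> n"

definition normal_core :: "('a, 'b) monoid_scheme \<Rightarrow> 'a set \<Rightarrow> 'a set" where
  "normal_core G H = (GREATEST N. N \<lhd> G \<and> N \<subseteq> H)"

definition sigma_subnormal ::
    "nat set \<Rightarrow> (nat \<Rightarrow> nat set) \<Rightarrow> ('a, 'b) monoid_scheme \<Rightarrow> 'a set \<Rightarrow> bool" where
  "sigma_subnormal I \<sigma> G A \<longleftrightarrow>
     (\<exists>t C. C 0 = A \<and> C t = carrier G \<and> (\<forall>i\<le>t. subgroup (C i) G) \<and>
        (\<forall>i<t. C i \<subseteq> C (Suc i) \<and>
           (C i \<lhd> G\<lparr>carrier := C (Suc i)\<rparr> \<or>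
            sigma_primary I \<sigma>
              (G\<lparr>carrier := C (Suc i)\<rparr> Mod normal_core (G\<lparr>carrier := C (Suc i)\<rparr>) (C i)))))"

definition subgroup_lattice :: "('a, 'b) monoid_scheme \<Rightarrow> 'a set gorder" where
  "subgroup_lattice G = \<lparr>carrier = {H. subgroup H G}, eq = (=), le = (\<subseteq>)\<rparr>"

definition sublattice :: "('a, 'b) gorder_scheme \<Rightarrow> 'a set \<Rightarrow> bool" where
  "sublattice L S \<longleftrightarrow> S \<subseteq> carrier L \<and> S \<noteq> {} \<and>
     (\<forall>x\<in>S. \<forall>y\<in>S. x \<sqinter>\<^bsub>L\<^esub> y \<in> S \<and> x \<squnion>\<^bsub>L\<^esub> y \<in> S)"

lemma (in group) meet_subgroup_lattice:
  assumes A: "subgroup A G" and B: "subgroup B G"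
  shows "A \<sqinter>\<^bsub>subgroup_lattice G\<^esub> B = A \<inter> B"
proof -
  have AB: "subgroup (A \<inter> B) G"
    by (rule subgroups_Inter_pair[OF A B])
  have Lower: "Lower (subgroup_lattice G) {A, B} = {X. subgroup X G \<and> X \<subseteq> A \<inter> B}"
    unfolding Lower_def subgroup_lattice_def using A B by auto
  have greatest: "greatest (subgroup_lattice G) X {X. subgroup X G \<and> X \<subseteq> A \<inter> B}
      \<longleftrightarrow> X = A \<inter> B" for X
    using AB by (auto simp: greatest_def subgroup_lattice_def)
  show ?thesis
    unfolding meet_def inf_def Lower greatest by simp
qed

lemma (in group) join_subgroup_lattice:
  assumes A: "subgroup A G" and B: "subgroup B G"
  shows "A \<squnion>\<^bsub>subgroup_lattice G\<^esub> B = generate G (A \<union> B)"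
proof -
  let ?L = "subgroup_lattice G"
  define D where "D = generate G (A \<union> B)"
  have D: "subgroup D G" "A \<subseteq> D" "B \<subseteq> D"
    using generate_is_subgroup[of "A \<union> B"] generate.incl[of _ "A \<union> B" G]
      subgroup.subset[OF A] subgroup.subset[OF B] unfolding D_def by blast+
  have min: "D \<subseteq> X" if "subgroup X G" "A \<subseteq> X" "B \<subseteq> X" for X
    unfolding D_def by (rule generate_subgroup_incl[OF Un_least[OF that(2,3)] that(1)])
  have Upper: "Upper ?L {A, B} = {X. subgroup X G \<and> A \<subseteq> X \<and> B \<subseteq> X}"
    unfolding Upper_def subgroup_lattice_def using A B by auto
  have least: "least ?L X (Upper ?L {A, B}) \<longleftrightarrow> X = D" for X
    unfolding Upper using D min by (auto simp: least_def subgroup_lattice_def)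
  show ?thesis
    unfolding join_def sup_def least D_def[symmetric] by simp
qed

lemma (in group) normal_core_greatest:
  assumes H: "subgroup H G"
  shows "normal_core G H \<lhd> G" "normal_core G H \<subseteq> H"
    "\<And>N. N \<lhd> G \<Longrightarrow> N \<subseteq> H \<Longrightarrow> N \<subseteq> normal_core G H"
proof -
  define U where "U = \<Union>{N. N \<lhd> G \<and> N \<subseteq> H}"
  have UH: "U \<subseteq> H" and Uc: "U \<subseteq> carrier G"
    using subgroup.subset[OF H] by (auto simp: U_def)
  have conj: "g \<otimes> h \<otimes> inv g \<in> U" if h: "h \<in> U" and g: "g \<in> carrier G" for h g
  proof -
    obtain N where N: "N \<lhd> G" "N \<subseteq> H" "h \<in> N"
      using h by (auto simp: U_def)
    have "g \<otimes> h \<otimes> inv g \<in> N"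
      by (rule normal.inv_op_closed2[OF N(1) g N(3)])
    then show ?thesis
      using N(1,2) by (auto simp: U_def)
  qed
  have P: "generate G U \<lhd> G \<and> generate G U \<subseteq> H"
    by (intro conjI normal_generateI[OF Uc conj] generate_subgroup_incl[OF UH H])
  have max: "N \<subseteq> generate G U" if "N \<lhd> G \<and> N \<subseteq> H" for N
  proof
    fix x assume "x \<in> N"
    then have "x \<in> U" using that by (auto simp: U_def)
    then show "x \<in> generate G U" by (rule generate.incl)
  qed
  have eq: "normal_core G H = generate G U"
    unfolding normal_core_def by (rule Greatest_equality) (use P max in auto)
  show "normal_core G H \<lhd> G" "normal_core G H \<subseteq> H"
    using P eq by auto
  show "\<And>N. N \<lhd> G \<Longrightarrow> N \<subseteq> H \<Longrightarrow> N \<subseteq> normal_core G H"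
    using max eq by auto
qed

end

theory Submission
  imports Defs "HOL-Algebra.Sylow" "HOL-Algebra.Multiplicative_Group"
begin

text \<open>
  Write \<open>O\<^sup>i(H)\<close> for the subgroup generated by the elements of \<open>H\<close> whose order has no prime divisor
  in \<open>\<sigma> i\<close>. A step \<open>A \<le> H\<close> of a \<open>\<sigma>\<close>-subnormal chain means that \<open>A\<close> is normal in \<open>H\<close> or contains
  some \<open>O\<^sup>i(H)\<close>. Two facts drive the argument. If \<open>A\<close> is \<open>\<sigma>\<close>-subnormal in \<open>H\<close> and of index a
  \<open>\<sigma> i\<close>-number, then \<open>A\<close> contains \<open>O\<^sup>i(H)\<close>. If \<open>V\<close> is normal in \<open>H\<close>, and \<open>A \<ge> V\<close> is
  \<open>\<sigma>\<close>-subnormal with \<open>A/V\<close> a \<open>\<sigma> i\<close>-group, then \<open>A/V\<close> lies in the largest normal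
  \<open>\<sigma> i\<close>-subgroup of \<open>H/V\<close>.

  The join \<open>J\<close> of \<open>\<sigma>\<close>-subnormal subgroups \<open>A\<close> and \<open>B\<close> of \<open>H\<close> is treated by induction on \<open>|H|\<close>. If
  \<open>A\<close> has proper normal closure, then the join \<open>A*\<close> of its \<open>J\<close>-conjugates is \<open>\<sigma>\<close>-subnormal, \<open>B\<close>
  normalizes \<open>A*\<close>, and a product of two \<open>\<sigma>\<close>-subnormal subgroups is \<open>\<sigma>\<close>-subnormal if one of them
  normalizes the other. Otherwise, modulo a subgroup that is normal in \<open>J\<close> and \<open>\<sigma>\<close>-subnormal in \<open>H\<close>,
  \<open>A\<close> and \<open>B\<close> are a \<open>\<sigma> j\<close>-group and a \<open>\<sigma> k\<close>-group, so they commute or generate a \<open>\<sigma> j\<close>-group.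

  A group has \<open>\<sigma>\<close>-nilpotent length at most \<open>n\<close> iff the \<open>n\<close>-th term of its upper \<open>\<sigma>\<close>-nilpotent
  series is the whole group. By the second fact the terms of this series for a \<open>\<sigma>\<close>-subnormal
  subgroup are contained in those for the whole group, which gives the length of the join.
\<close>

text \<open>Sections \<open>H/N\<close> with varying \<open>H\<close> and \<open>N\<close> occur
  throughout, and each quotient would change the element type. Hence nearly everything is said about
  subgroups of the one group \<open>G\<close>: that \<open>H/N\<close> is a \<pi>-group becomes the
  existence, for each element of \<open>H\<close>, of a power in \<open>N\<close> whose exponent is
  a \<pi>-number, and arguments modulo \<open>V\<close> become arguments about products
  \<open>V <#> X\<close>. Bezout then does the work of Hall subgroups: an element with powers of
  coprime exponents in a subgroup lies in that subgroup. The obstacle behind the second fact is a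
  step \<open>X \<le> H\<close> that only contains a residual: the radical of \<open>X\<close> is
  invariant under \<open>X\<close>, but invariance under \<open>H\<close> is wanted. Transfer
  supplies it, by producing a subgroup of \<sigma> j-elements inside a centralizer that
  \<open>H\<close> normalizes. The obstacle for products is that the terms of a chain from
  \<open>A\<close> to \<open>H\<close> are arbitrary, so \<open>B\<close> need not normalize them.
  They are replaced by the normal closure of \<open>A\<close> in \<open>H\<close>, or by the product
  of \<open>A\<close> with a residual of \<open>H\<close>, which depend on \<open>A\<close> and
  \<open>H\<close> alone.\<close>

section \<open>Numbers with prescribed prime divisors\<close>

lemma prod_coprime_dvd:
  fixes f :: "'i \<Rightarrow> nat"
  assumes "finite S" "\<And>i. i \<in> S \<Longrightarrow> f i dvd m" "\<And>i j. i \<in> S \<Longrightarrow> j \<in> S \<Longrightarrow> i \<noteq> j \<Longrightarrow> coprime (f i) (f j)"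
  shows "prod f S dvd m"
  using assms
proof (induction S rule: finite_induct)
  case (insert i S)
  have "coprime (f i) (prod f S)"
    by (rule prod_coprime_right) (use insert in auto)
  then show ?case using insert by (simp add: divides_mult)
qed simp

text \<open>Positivity matters when \<pi> contains all primes, as for a partition with one class: 0
  would qualify, and \<open>x [^] 0 = \<one>\<close> would make conditions on powers void.\<close>

definition pi_number :: "nat set \<Rightarrow> nat \<Rightarrow> bool" where
  "pi_number \<pi> m \<longleftrightarrow> m > 0 \<and> (\<forall>p. prime p \<and> p dvd m \<longrightarrow> p \<in> \<pi>)"

lemma pi_number_1 [simp]: "pi_number \<pi> 1" "pi_number \<pi> (Suc 0)"
  by (auto simp: pi_number_def)

lemma pi_number_mult: "pi_number \<pi> a \<Longrightarrow> pi_number \<pi> b \<Longrightarrow> pi_number \<pi> (a * b)"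
  by (auto simp: pi_number_def prime_dvd_mult_iff)

lemma pi_number_mono: "pi_number \<pi> a \<Longrightarrow> \<pi> \<subseteq> \<rho> \<Longrightarrow> pi_number \<rho> a"
  by (auto simp: pi_number_def)

lemma pi_number_prod: "finite S \<Longrightarrow> (\<And>s. s \<in> S \<Longrightarrow> pi_number \<pi> (f s)) \<Longrightarrow> pi_number \<pi> (prod f S)"
  by (induction S rule: finite_induct) (auto intro: pi_number_mult)

lemma pi_number_coprime:
  assumes "pi_number \<pi> a" "pi_number \<rho> b" "\<pi> \<inter> \<rho> = {}"
  shows "coprime a b"
proof (rule ccontr)
  assume "\<not> coprime a b"
  then have "gcd a b \<noteq> 1" by (simp add: coprime_iff_gcd_eq_1)
  then obtain p where "prime p" "p dvd gcd a b" using prime_factor_nat by blast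
  then show False using assms by (auto simp: pi_number_def)
qed

lemma pi_number_split:
  assumes "m > 0"
  obtains a b where "m = a * b" "pi_number \<pi> a" "pi_number (- \<pi>) b"
  using assms
proof (induction m arbitrary: thesis rule: less_induct)
  case (less m)
  show ?case
  proof (cases "m = 1")
    case True
    then show ?thesis using less.prems(1)[of 1 1] by simp
  next
    case False
    then obtain p where p: "prime p" "p dvd m" using prime_factor_nat by blast
    then obtain k where k: "m = p * k" by blast
    have "k < m" "k > 0" using k p less.prems(2) prime_gt_1_nat[OF p(1)] by auto
    then obtain a b where ab: "k = a * b" "pi_number \<pi> a" "pi_number (- \<pi>) b"
      using less.IH by blast
    have q: "pi_number (if p \<in> \<pi> then \<pi> else - \<pi>) p"
      using p(1) primes_dvd_imp_eq by (auto simp: pi_number_def prime_gt_0_nat)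
    show ?thesis
    proof (cases "p \<in> \<pi>")
      case True
      then show ?thesis
        using less.prems(1)[of "p * a" b] k ab q pi_number_mult by (simp add: mult.assoc)
    next
      case False
      then show ?thesis
        using less.prems(1)[of a "p * b"] k ab q pi_number_mult by (simp add: mult.left_commute)
    qed
  qed
qed

section \<open>Conjugation, normality and products inside one ambient group\<close>

context group
begin

lemma inv_mult_cancel [simp]:
  "x \<in> carrier G \<Longrightarrow> y \<in> carrier G \<Longrightarrow> inv x \<otimes> (x \<otimes> y) = y"
  "x \<in> carrier G \<Longrightarrow> y \<in> carrier G \<Longrightarrow> x \<otimes> (inv x \<otimes> y) = y"
  by (simp_all flip: m_assoc)

definition conj_by :: "'a \<Rightarrow> 'a \<Rightarrow> 'a" where
  "conj_by g x = g \<otimes> x \<otimes> inv g"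

lemma conj_by_closed [simp]: "g \<in> carrier G \<Longrightarrow> x \<in> carrier G \<Longrightarrow> conj_by g x \<in> carrier G"
  by (simp add: conj_by_def)

lemma conj_by_one [simp]: "g \<in> carrier G \<Longrightarrow> conj_by g \<one> = \<one>"
  "x \<in> carrier G \<Longrightarrow> conj_by \<one> x = x"
  by (simp_all add: conj_by_def)

lemma conj_by_mult:
  "g \<in> carrier G \<Longrightarrow> x \<in> carrier G \<Longrightarrow> y \<in> carrier G \<Longrightarrow>
    conj_by g (x \<otimes> y) = conj_by g x \<otimes> conj_by g y"
  by (simp add: conj_by_def m_assoc inv_solve_left)

lemma conj_by_conj_by:
  "g \<in> carrier G \<Longrightarrow> h \<in> carrier G \<Longrightarrow> x \<in> carrier G \<Longrightarrow>
    conj_by g (conj_by h x) = conj_by (g \<otimes> h) x"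
  by (simp add: conj_by_def m_assoc inv_mult_group)

lemma conj_by_inv_cancel [simp]:
  "g \<in> carrier G \<Longrightarrow> x \<in> carrier G \<Longrightarrow> conj_by (inv g) (conj_by g x) = x"
  "g \<in> carrier G \<Longrightarrow> x \<in> carrier G \<Longrightarrow> conj_by g (conj_by (inv g) x) = x"
  by (simp_all add: conj_by_conj_by)

lemma conj_by_inv:
  "g \<in> carrier G \<Longrightarrow> x \<in> carrier G \<Longrightarrow> conj_by g (inv x) = inv (conj_by g x)"
  by (simp add: conj_by_def m_assoc inv_mult_group)

lemma conj_by_pow:
  "g \<in> carrier G \<Longrightarrow> x \<in> carrier G \<Longrightarrow> conj_by g (x [^] (m::nat)) = conj_by g x [^] m"
  by (induction m) (simp_all add: conj_by_mult)

lemma conj_by_distrib: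
  "g \<in> carrier G \<Longrightarrow> h \<in> carrier G \<Longrightarrow> x \<in> carrier G \<Longrightarrow>
    conj_by g (conj_by h x) = conj_by (conj_by g h) (conj_by g x)"
  by (simp add: conj_by_def[of h] conj_by_def[of "conj_by g h"] conj_by_mult conj_by_inv)

lemma mult_conj_by:
  "g \<in> carrier G \<Longrightarrow> x \<in> carrier G \<Longrightarrow> g \<otimes> x = conj_by g x \<otimes> g"
  by (simp add: conj_by_def m_assoc)

lemma subgroup_conj_by:
  assumes g: "g \<in> carrier G" and H: "subgroup H G"
  shows "subgroup (conj_by g ` H) G"
proof (rule subgroupI)
  note c = subgroup.mem_carrier[OF H]
  show "conj_by g ` H \<subseteq> carrier G" using g c by auto
  show "conj_by g ` H \<noteq> {}" using subgroup.one_closed[OF H] by auto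
  fix a assume "a \<in> conj_by g ` H"
  then obtain x where x: "x \<in> H" "a = conj_by g x" by auto
  then show "inv a \<in> conj_by g ` H"
    using g c subgroup.m_inv_closed[OF H] by (auto simp flip: conj_by_inv)
  fix b assume "b \<in> conj_by g ` H"
  then obtain y where y: "y \<in> H" "b = conj_by g y" by auto
  then show "a \<otimes> b \<in> conj_by g ` H"
    using x g c subgroup.m_closed[OF H] by (auto simp flip: conj_by_mult)
qed

lemma subgroup_pow_mem:
  "subgroup H G \<Longrightarrow> x \<in> H \<Longrightarrow> x [^] (m::nat) \<in> H"
  by (induction m) (simp_all add: subgroup.one_closed subgroup.m_closed)

text \<open>Bezout in the form \<open>a * u = b * v + 1\<close> writes \<open>x\<close> as a
  quotient of two powers that lie in \<open>S\<close>. The case \<open>a = 0\<close> is separate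
  because \<open>bezout_nat\<close> wants \<open>a\<close> nonzero; there
  \<open>b = 1\<close>.\<close>

lemma coprime_powers_mem:
  assumes S: "subgroup S G" and x: "x \<in> carrier G" and "x [^] (a::nat) \<in> S" "x [^] (b::nat) \<in> S"
    and "coprime a b"
  shows "x \<in> S"
proof (cases "a = 0")
  case True
  then show ?thesis using assms by simp
next
  case False
  then obtain u v where uv: "a * u = b * v + 1"
    using bezout_nat[of a b] \<open>coprime a b\<close> by (auto simp: coprime_iff_gcd_eq_1)
  have A: "x [^] (a * u) \<in> S" and B: "x [^] (b * v) \<in> S"
    using assms(3,4) x subgroup_pow_mem[OF S] by (simp_all flip: nat_pow_pow)
  have "x [^] (a * u) = x [^] (b * v) \<otimes> x" unfolding uv using x by simp
  then have "x = inv (x [^] (b * v)) \<otimes> x [^] (a * u)"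
    using x by (simp add: inv_solve_left)
  then show ?thesis
    using subgroup.m_closed[OF S subgroup.m_inv_closed[OF S B] A] by simp
qed

text \<open>Local-to-global principle for the classes. The least positive exponent \<open>d\<close>
  with a power in \<open>S\<close> divides every such exponent. A prime divisor of \<open>d\<close>
  would lie in some \<open>\<sigma> i\<close>, yet \<open>d\<close> divides an exponent prime to
  \<open>\<sigma> i\<close>; so \<open>d = 1\<close>.\<close>

lemma mem_if_sigma_powers_mem:
  assumes part: "prime_partition I \<sigma>" and S: "subgroup S G" and x: "x \<in> carrier G"
    and powers: "\<And>i. i \<in> I \<Longrightarrow> \<exists>m. pi_number (- \<sigma> i) m \<and> x [^] m \<in> S"
  shows "x \<in> S"
proof -
  define P where "P m \<longleftrightarrow> m > 0 \<and> x [^] m \<in> S" for m :: nat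
  have "(2::nat) \<in> (\<Union>i\<in>I. \<sigma> i)" using part by (simp add: prime_partition_def)
  then obtain i0 where "i0 \<in> I" by blast
  then have ex: "\<exists>m. P m" using powers by (auto simp: P_def pi_number_def)
  define d where "d = (LEAST m. P m)"
  have d: "P d" unfolding d_def using ex by (rule LeastI_ex)
  have dvd: "d dvd m" if m: "P m" for m
  proof -
    define g where "g = gcd d m"
    have "coprime (d div g) (m div g)"
      unfolding g_def using d m by (intro div_gcd_coprime) (auto simp: P_def)
    moreover have "(x [^] g) [^] (d div g) \<in> S" "(x [^] g) [^] (m div g) \<in> S"
      using d m x by (simp_all add: nat_pow_pow g_def P_def)
    ultimately have "x [^] g \<in> S" using coprime_powers_mem[OF S] x by simp
    then have "P g" using d by (simp add: P_def g_def)
    then have "d \<le> g" unfolding d_def by (rule Least_le)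
    moreover have "g dvd d" by (simp add: g_def)
    ultimately have "g = d" using d by (simp add: P_def dvd_imp_le eq_iff)
    then show ?thesis using gcd_dvd2[of d m] by (simp add: g_def)
  qed
  have "d = 1"
  proof (rule ccontr)
    assume "d \<noteq> 1"
    then obtain p where p: "prime p" "p dvd d" using prime_factor_nat by blast
    have "p \<in> (\<Union>i\<in>I. \<sigma> i)" using part p(1) by (simp add: prime_partition_def)
    then obtain i where i: "i \<in> I" "p \<in> \<sigma> i" by blast
    obtain m where m: "pi_number (- \<sigma> i) m" "x [^] m \<in> S" using powers i(1) by blast
    then have "d dvd m" by (intro dvd) (simp add: P_def pi_number_def)
    then show False using m(1) p i(2) by (auto simp: pi_number_def dest: dvd_trans)
  qed
  then show ?thesis using d x by (simp add: P_def)
qed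

text \<open>Elementwise inclusion between arbitrary sets. When \<open>B\<close> is a subgroup,
  inverses turn the inclusion into an equality, see \<open>conj_image_eq\<close>.\<close>

definition normalizes :: "'a set \<Rightarrow> 'a set \<Rightarrow> bool" where
  "normalizes B A \<longleftrightarrow> (\<forall>b\<in>B. \<forall>a\<in>A. conj_by b a \<in> A)"

lemma normalizesD: "normalizes B A \<Longrightarrow> b \<in> B \<Longrightarrow> a \<in> A \<Longrightarrow> conj_by b a \<in> A"
  by (simp add: normalizes_def)

lemma normalizes_subset: "normalizes B A \<Longrightarrow> C \<subseteq> B \<Longrightarrow> normalizes C A"
  by (auto simp: normalizes_def)

lemma subgroup_conj_mem: "subgroup H G \<Longrightarrow> x \<in> H \<Longrightarrow> y \<in> H \<Longrightarrow> conj_by x y \<in> H"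
  by (simp add: conj_by_def subgroup.m_closed subgroup.m_inv_closed)

lemma normalizes_self: "subgroup H G \<Longrightarrow> normalizes H H"
  by (simp add: normalizes_def subgroup_conj_mem)

text \<open>Relative normality as a relation between subsets of \<open>G\<close>, so that no
  restricted group structures get nested; \<open>normal_in_iff_normal\<close> links it to the
  library notion.\<close>

definition normal_in :: "'a set \<Rightarrow> 'a set \<Rightarrow> bool" where
  "normal_in N H \<longleftrightarrow> subgroup N G \<and> subgroup H G \<and> N \<subseteq> H \<and> normalizes H N"

lemma normal_in_subgroup: "normal_in N H \<Longrightarrow> subgroup N G" "normal_in N H \<Longrightarrow> subgroup H G"
  "normal_in N H \<Longrightarrow> N \<subseteq> H" "normal_in N H \<Longrightarrow> normalizes H N"
  by (auto simp: normal_in_def)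

lemma normal_in_refl: "subgroup H G \<Longrightarrow> normal_in H H"
  by (simp add: normal_in_def normalizes_self)

lemma normal_in_iff_normal:
  assumes H: "subgroup H G"
  shows "normal_in N H \<longleftrightarrow> N \<lhd> G\<lparr>carrier := H\<rparr>"
proof -
  interpret H: group "G\<lparr>carrier := H\<rparr>" by (rule subgroup_imp_group[OF H])
  have inv: "inv\<^bsub>G\<lparr>carrier := H\<rparr>\<^esub> x = inv x" if "x \<in> H" for x
    using m_inv_consistent[OF H that] .
  show ?thesis
    unfolding H.normal_inv_iff normal_in_def normalizes_def conj_by_def
    using H inv subgroup_incl[of N H] incl_subgroup[OF H, of N] subgroup.subset[of N "G\<lparr>carrier := H\<rparr>"]
    by auto
qed

lemma normalizes_Int: "normalizes B A \<Longrightarrow> normalizes B C \<Longrightarrow> normalizes B (A \<inter> C)"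
  by (auto simp: normalizes_def)

lemma normal_in_Int:
  assumes "normal_in N H" "subgroup K G"
  shows "normal_in (N \<inter> K) (H \<inter> K)"
  using assms subgroup_conj_mem unfolding normal_in_def normalizes_def
  by (auto intro: subgroups_Inter_pair)

lemma normal_in_mono: "normal_in N H \<Longrightarrow> subgroup K G \<Longrightarrow> N \<subseteq> K \<Longrightarrow> K \<subseteq> H \<Longrightarrow> normal_in N K"
  by (auto simp: normal_in_def normalizes_def)

lemma subgroup_set_mult:
  assumes A: "subgroup A G" and B: "subgroup B G" and n: "normalizes B A"
  shows "subgroup (A <#> B) G"
proof (rule subgroupI)
  note cA = subgroup.mem_carrier[OF A] and cB = subgroup.mem_carrier[OF B]
  show "A <#> B \<subseteq> carrier G" using cA cB by (auto simp: set_mult_def)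
  show "A <#> B \<noteq> {}" using subgroup.one_closed[OF A] subgroup.one_closed[OF B]
    by (auto simp: set_mult_def)
  fix x assume "x \<in> A <#> B"
  then obtain a b where x: "x = a \<otimes> b" and ab: "a \<in> A" "b \<in> B" by (auto simp: set_mult_def)
  have "inv x = conj_by (inv b) (inv a) \<otimes> inv b"
    using x ab cA cB by (simp add: inv_mult_group mult_conj_by[symmetric])
  moreover have "conj_by (inv b) (inv a) \<in> A"
    using n ab A B by (simp add: normalizes_def subgroup.m_inv_closed)
  ultimately show "inv x \<in> A <#> B"
    using ab subgroup.m_inv_closed[OF B] by (auto simp: set_mult_def)
  fix y assume "y \<in> A <#> B"
  then obtain c d where y: "y = c \<otimes> d" and cd: "c \<in> A" "d \<in> B" by (auto simp: set_mult_def)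
  have "x \<otimes> y = (a \<otimes> conj_by b c) \<otimes> (b \<otimes> d)"
    using x y ab cd cA cB by (simp add: conj_by_def m_assoc inv_solve_left)
  moreover have "a \<otimes> conj_by b c \<in> A" "b \<otimes> d \<in> B"
    using n ab cd subgroup.m_closed[OF A] subgroup.m_closed[OF B] by (auto simp: normalizes_def)
  ultimately show "x \<otimes> y \<in> A <#> B" by (auto simp: set_mult_def)
qed

lemma set_mult_memI: "a \<in> A \<Longrightarrow> b \<in> B \<Longrightarrow> a \<otimes> b \<in> A <#> B"
  by (auto simp: set_mult_def)

lemma set_mult_memE: 
  assumes "x \<in> A <#> B" obtains a b where "a \<in> A" "b \<in> B" "x = a \<otimes> b"
  using assms by (auto simp: set_mult_def)

lemma set_mult_incl:
  assumes "subgroup A G" "subgroup B G"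
  shows "A \<subseteq> A <#> B" "B \<subseteq> A <#> B"
proof -
  show "A \<subseteq> A <#> B"
  proof
    fix a assume a: "a \<in> A"
    then have "a \<otimes> \<one> \<in> A <#> B" using assms(2) by (simp add: set_mult_memI subgroup.one_closed)
    then show "a \<in> A <#> B" using a assms(1) by (simp add: subgroup.mem_carrier)
  qed
  show "B \<subseteq> A <#> B"
  proof
    fix b assume b: "b \<in> B"
    then have "\<one> \<otimes> b \<in> A <#> B" using assms(1) by (simp add: set_mult_memI subgroup.one_closed)
    then show "b \<in> A <#> B" using b assms(2) by (simp add: subgroup.mem_carrier)
  qed
qed

lemma set_mult_least: "subgroup H G \<Longrightarrow> A \<subseteq> H \<Longrightarrow> B \<subseteq> H \<Longrightarrow> A <#> B \<subseteq> H"
  by (auto elim!: set_mult_memE intro!: subgroup.m_closed[of H G])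

lemma conj_by_mem_normalized:
  assumes "subgroup A G" "normalizes {g} A" "normalizes {g} B" "x \<in> A <#> B"
    "g \<in> carrier G" "subgroup B G"
  shows "conj_by g x \<in> A <#> B"
proof -
  obtain a b where ab: "a \<in> A" "b \<in> B" "x = a \<otimes> b" using assms(4) by (rule set_mult_memE)
  then have "conj_by g x = conj_by g a \<otimes> conj_by g b"
    using assms(1,5,6) by (simp add: conj_by_mult subgroup.mem_carrier)
  then show ?thesis using ab assms(2,3) by (auto simp: normalizes_def intro: set_mult_memI)
qed

lemma normalizes_set_mult:
  assumes "subgroup A G" "subgroup B G" "C \<subseteq> carrier G" "normalizes C A" "normalizes C B"
  shows "normalizes C (A <#> B)"
  using assms conj_by_mem_normalized[of A _ B] unfolding normalizes_def by blast

text \<open>Computation modulo \<open>Y\<close> without a quotient: moving a power of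
  \<open>w\<close> past an element of \<open>Y\<close> changes only that element.\<close>

lemma pow_mult_normalized:
  assumes Y: "subgroup Y G" and W: "subgroup W G" and n: "normalizes W Y" and y: "y \<in> Y" "w \<in> W"
  shows "\<exists>y'\<in>Y. (y \<otimes> w) [^] (m::nat) = y' \<otimes> w [^] m"
proof (induction m)
  case 0
  then show ?case using subgroup.one_closed[OF Y] by force
next
  case (Suc m)
  then obtain y' where y': "y' \<in> Y" "(y \<otimes> w) [^] m = y' \<otimes> w [^] m" by auto
  note c = subgroup.mem_carrier[OF Y] subgroup.mem_carrier[OF W]
  have wm: "w [^] m \<in> W" using subgroup_pow_mem[OF W y(2)] .
  have "(y \<otimes> w) [^] Suc m = y' \<otimes> w [^] m \<otimes> (y \<otimes> w)" using y' by simp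
  also have "\<dots> = (y' \<otimes> conj_by (w [^] m) y) \<otimes> (w [^] m \<otimes> w)"
    using y y'(1) wm c by (simp add: conj_by_def m_assoc inv_solve_left)
  finally show ?case
    using y y'(1) wm n subgroup.m_closed[OF Y] by (auto simp: normalizes_def)
qed

lemma conj_by_generate:
  assumes S: "S \<subseteq> carrier G" and g: "g \<in> carrier G"
    and c: "\<And>s. s \<in> S \<Longrightarrow> conj_by g s \<in> generate G S" and x: "x \<in> generate G S"
  shows "conj_by g x \<in> generate G S"
  using x
proof (induction rule: generate.induct)
  case one
  then show ?case using g by (simp add: generate.one)
next
  case (incl h)
  then show ?case using c by simp
next
  case (inv h)
  then show ?case using c g S
    by (metis conj_by_inv generate_m_inv_closed subsetD)
next
  case (eng h1 h2)
  then show ?case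
    using g generate_in_carrier[OF S] by (simp add: conj_by_mult generate.eng)
qed

lemma normalizes_generate:
  assumes "S \<subseteq> carrier G" "B \<subseteq> carrier G" "\<And>b s. b \<in> B \<Longrightarrow> s \<in> S \<Longrightarrow> conj_by b s \<in> generate G S"
  shows "normalizes B (generate G S)"
  using assms conj_by_generate[OF assms(1)] unfolding normalizes_def by blast

definition nclosure :: "'a set \<Rightarrow> 'a set \<Rightarrow> 'a set" where
  "nclosure A H = generate G (\<Union>h\<in>H. conj_by h ` A)"

lemma nclosure_normal_in:
  assumes H: "subgroup H G" and A: "A \<subseteq> H"
  shows "normal_in (nclosure A H) H" "A \<subseteq> nclosure A H"
proof -
  note c = subgroup.mem_carrier[OF H]
  let ?S = "\<Union>h\<in>H. conj_by h ` A"
  have S: "?S \<subseteq> H" using A subgroup_conj_mem[OF H] by blast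
  then have Sc: "?S \<subseteq> carrier G" using c by blast
  have "conj_by b s \<in> generate G ?S" if bs: "b \<in> H" "s \<in> ?S" for b s
  proof -
    obtain h a where ha: "h \<in> H" "a \<in> A" "s = conj_by h a" using bs(2) by blast
    then have "conj_by b s = conj_by (b \<otimes> h) a" using bs(1) ha c A by (simp add: conj_by_conj_by subset_iff)
    moreover have "b \<otimes> h \<in> H" using bs(1) ha subgroup.m_closed[OF H] by blast
    ultimately show ?thesis using ha by (intro generate.incl) auto
  qed
  then have "normalizes H (generate G ?S)"
    using Sc c by (intro normalizes_generate) auto
  then show "normal_in (nclosure A H) H"
    unfolding normal_in_def nclosure_def
    using H generate_subgroup_incl[OF S H] generate_is_subgroup[OF Sc] by auto
  show "A \<subseteq> nclosure A H"
  proof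
    fix a assume "a \<in> A"
    then have "a = conj_by \<one> a" using A c by auto
    then show "a \<in> nclosure A H" unfolding nclosure_def
      using \<open>a \<in> A\<close> subgroup.one_closed[OF H] by (intro generate.incl) auto
  qed
qed

lemma nclosure_least:
  assumes "subgroup N G" "normalizes H N" "A \<subseteq> N"
  shows "nclosure A H \<subseteq> N"
  unfolding nclosure_def using assms
  by (intro generate_subgroup_incl) (auto simp: normalizes_def)

lemma normalizes_nclosure:
  assumes H: "subgroup H G" and A: "A \<subseteq> H" and B: "B \<subseteq> carrier G"
    and "normalizes B A" "normalizes B H"
  shows "normalizes B (nclosure A H)"
proof -
  note c = subgroup.mem_carrier[OF H]
  let ?S = "\<Union>h\<in>H. conj_by h ` A"
  have Sc: "?S \<subseteq> carrier G" using A c by auto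
  have "conj_by b s \<in> ?S" if bs: "b \<in> B" "s \<in> ?S" for b s
  proof -
    obtain h a where ha: "h \<in> H" "a \<in> A" "s = conj_by h a" using bs(2) by blast
    have car: "b \<in> carrier G" "h \<in> carrier G" "a \<in> carrier G" using bs ha B c A by auto
    have "conj_by b s = conj_by (conj_by b h) (conj_by b a)"
      unfolding ha(3) using car by (rule conj_by_distrib)
    moreover have "conj_by b h \<in> H" "conj_by b a \<in> A"
      using ha bs(1) assms by (auto simp: normalizes_def)
    ultimately show ?thesis by blast
  qed
  then have "conj_by b s \<in> generate G ?S" if "b \<in> B" "s \<in> ?S" for b s
    using that by (simp only: generate.incl)
  then show ?thesis unfolding nclosure_def
    by (rule normalizes_generate[OF Sc B])
qed

section \<open>Sections that are \<pi>-groups, residuals and radicals\<close>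

text \<open>If \<open>N\<close> is normal in \<open>H\<close>, the next definition says that \<open>H/N\<close> is a \<open>\<pi>\<close>-group.\<close>

definition pi_over :: "nat set \<Rightarrow> 'a set \<Rightarrow> 'a set \<Rightarrow> bool" where
  "pi_over \<pi> H N \<longleftrightarrow> (\<forall>h\<in>H. \<exists>m. pi_number \<pi> m \<and> h [^] m \<in> N)"

lemma pi_overE: 
  assumes "pi_over \<pi> H N" "h \<in> H" obtains m where "pi_number \<pi> m" "h [^] m \<in> N"
  using assms by (auto simp: pi_over_def)

lemma pi_over_mono: "pi_over \<pi> H N \<Longrightarrow> K \<subseteq> H \<Longrightarrow> N \<subseteq> M \<Longrightarrow> \<pi> \<subseteq> \<rho> \<Longrightarrow> pi_over \<rho> K M"
  unfolding pi_over_def by (meson pi_number_mono subsetD)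

lemma pi_over_refl: "subgroup N G \<Longrightarrow> pi_over \<pi> N N"
  unfolding pi_over_def
  by (auto intro!: exI[of _ 1] simp: subgroup.mem_carrier)

lemma pi_over_trans:
  assumes "pi_over \<pi> H N" "pi_over \<pi> N M" "H \<subseteq> carrier G" shows "pi_over \<pi> H M"
  unfolding pi_over_def
proof
  fix h assume h: "h \<in> H"
  obtain m where m: "pi_number \<pi> m" "h [^] m \<in> N" using assms(1) h by (rule pi_overE)
  obtain k where k: "pi_number \<pi> k" "(h [^] m) [^] k \<in> M" using assms(2) m(2) by (rule pi_overE)
  then show "\<exists>m. pi_number \<pi> m \<and> h [^] m \<in> M"
    using m h assms(3) pi_number_mult by (metis nat_pow_pow subsetD)
qed

lemma pi_over_Int:
  assumes "pi_over \<pi> H N" "subgroup K G" shows "pi_over \<pi> (H \<inter> K) (N \<inter> K)"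
  using assms subgroup_pow_mem unfolding pi_over_def by blast

lemma pi_over_product:
  assumes Y: "subgroup Y G" and W: "subgroup W G" and n: "normalizes W Y" and o: "pi_over \<pi> W V"
  shows "pi_over \<pi> (Y <#> W) (Y <#> V)"
  unfolding pi_over_def
proof
  fix h assume "h \<in> Y <#> W"
  then obtain y w where yw: "y \<in> Y" "w \<in> W" "h = y \<otimes> w" by (rule set_mult_memE)
  obtain m where m: "pi_number \<pi> m" "w [^] m \<in> V" using o yw(2) by (rule pi_overE)
  obtain y' where "y' \<in> Y" "h [^] m = y' \<otimes> w [^] m"
    using pow_mult_normalized[OF Y W n yw(1,2)] yw(3) by blast
  then have "h [^] m \<in> Y <#> V" using m(2) by (simp add: set_mult_memI)
  then show "\<exists>m. pi_number \<pi> m \<and> h [^] m \<in> Y <#> V"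
    using m(1) by (intro exI[of _ m] conjI)
qed

lemma pi_over_set_mult:
  assumes Y: "subgroup Y G" and W: "subgroup W G" and n: "normalizes W Y" and o: "pi_over \<pi> W V"
    and V: "V \<subseteq> Y"
  shows "pi_over \<pi> (Y <#> W) Y"
  by (rule pi_over_mono[OF pi_over_product[OF Y W n o] order_refl set_mult_least[OF Y order_refl V] order_refl])

text \<open>This plays the part of "a \<pi>-group and a \<rho>-group intersect trivially"; the
  commutator arguments for joins rest on it.\<close>

lemma pi_over_coprime_mem:
  assumes S: "subgroup S G" and x: "x \<in> H" "H \<subseteq> carrier G"
    and "pi_over \<pi> H S" "pi_over \<rho> H S" "\<pi> \<inter> \<rho> = {}"
  shows "x \<in> S"
proof -
  obtain m where m: "pi_number \<pi> m" "x [^] m \<in> S" using assms(4) x(1) by (rule pi_overE)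
  obtain k where k: "pi_number \<rho> k" "x [^] k \<in> S" using assms(5) x(1) by (rule pi_overE)
  show ?thesis
    using coprime_powers_mem[OF S _ m(2) k(2)] pi_number_coprime[OF m(1) k(1)] assms(6) x by blast
qed

text \<open>In the usual notation \<open>residual \<pi> H\<close> is \<open>O\<^sup>\<pi>(H)\<close>, and \<open>rad \<pi> V H / V\<close>, for
  \<open>rad\<close> as defined below, is \<open>O\<^sub>\<pi>(H/V)\<close>.\<close>

definition residual :: "nat set \<Rightarrow> 'a set \<Rightarrow> 'a set" where
  "residual \<pi> H = generate G {h \<in> H. \<exists>m. pi_number (- \<pi>) m \<and> h [^] m = \<one>}"

lemma residual_subgroup: "H \<subseteq> carrier G \<Longrightarrow> subgroup (residual \<pi> H) G"
  unfolding residual_def by (intro generate_is_subgroup) auto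

lemma residual_subset: "subgroup H G \<Longrightarrow> residual \<pi> H \<subseteq> H"
  unfolding residual_def by (intro generate_subgroup_incl) auto

text \<open>A generator of the residual has a trivial power with exponent prime to \<pi> and a power
  in \<open>S\<close> with a \<pi>-number as exponent. \<open>S\<close> may be any subgroup, so the
  lemma applies to terms of a chain.\<close>

lemma residual_least:
  assumes S: "subgroup S G" and o: "pi_over \<pi> H S" and H: "H \<subseteq> carrier G"
  shows "residual \<pi> H \<subseteq> S"
  unfolding residual_def
proof (intro generate_subgroup_incl S subsetI)
  fix h assume "h \<in> {h \<in> H. \<exists>m. pi_number (- \<pi>) m \<and> h [^] m = \<one>}"
  then obtain b where h: "h \<in> H" and b: "pi_number (- \<pi>) b" "h [^] b = \<one>" by auto
  obtain a where a: "pi_number \<pi> a" "h [^] a \<in> S" using o h by (rule pi_overE)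
  show "h \<in> S"
    using coprime_powers_mem[OF S _ a(2), of b] pi_number_coprime[OF a(1) b(1)] b(2)
      subgroup.one_closed[OF S] H h by auto
qed

lemma residual_mono: "A \<subseteq> H \<Longrightarrow> H \<subseteq> carrier G \<Longrightarrow> residual \<pi> A \<subseteq> residual \<pi> H"
  unfolding residual_def by (intro mono_generate) auto

text \<open>The generators of the larger residual already lie in \<open>A\<close>, hence are
  generators of the smaller one.\<close>

lemma residual_eqI:
  assumes "subgroup A G" "subgroup H G" "residual \<pi> H \<subseteq> A" "A \<subseteq> H"
  shows "residual \<pi> A = residual \<pi> H"
proof
  show "residual \<pi> A \<subseteq> residual \<pi> H"
    using assms by (intro residual_mono) (auto dest: subgroup.subset)
  have "{h \<in> H. \<exists>m. pi_number (- \<pi>) m \<and> h [^] m = \<one>} \<subseteq> residual \<pi> H"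
    unfolding residual_def by (auto intro: generate.incl)
  then show "residual \<pi> H \<subseteq> residual \<pi> A"
    using assms(3) unfolding residual_def by (intro mono_generate) auto
qed

lemma normalizes_residual:
  assumes H: "H \<subseteq> carrier G" and B: "B \<subseteq> carrier G" and n: "normalizes B H"
  shows "normalizes B (residual \<pi> H)"
  unfolding residual_def
proof (rule normalizes_generate[OF _ B])
  show "{h \<in> H. \<exists>m. pi_number (- \<pi>) m \<and> h [^] m = \<one>} \<subseteq> carrier G" using H by auto
  fix b s assume bs: "b \<in> B" "s \<in> {h \<in> H. \<exists>m. pi_number (- \<pi>) m \<and> h [^] m = \<one>}"
  then obtain m where m: "pi_number (- \<pi>) m" "s [^] m = \<one>" "s \<in> H" by auto
  have "conj_by b s [^] m = \<one>" "conj_by b s \<in> H"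
    using bs(1) m H B n conj_by_pow[of b s m] by (simp_all add: normalizes_def subset_iff)
  then show "conj_by b s \<in> generate G {h \<in> H. \<exists>m. pi_number (- \<pi>) m \<and> h [^] m = \<one>}"
    using m by (auto intro: generate.incl)
qed

lemma residual_normal_in: "subgroup H G \<Longrightarrow> normal_in (residual \<pi> H) H"
  unfolding normal_in_def
  by (simp add: residual_subgroup residual_subset subgroup.subset normalizes_residual normalizes_self)

lemma residual_conj:
  assumes H: "H \<subseteq> carrier G" and g: "g \<in> carrier G"
  shows "residual \<pi> (conj_by g ` H) \<subseteq> conj_by g ` residual \<pi> H"
  unfolding residual_def[of _ "conj_by g ` H"]
proof (intro generate_subgroup_incl subgroup_conj_by residual_subgroup H g subsetI)
  fix x assume "x \<in> {h \<in> conj_by g ` H. \<exists>m. pi_number (- \<pi>) m \<and> h [^] m = \<one>}"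
  then obtain h m where h: "h \<in> H" "x = conj_by g h" and m: "pi_number (- \<pi>) m" "x [^] m = \<one>"
    by auto
  have "h [^] m = conj_by (inv g) (conj_by g (h [^] m))" using h H g by auto
  also have "\<dots> = \<one>" using m h H g by (simp add: conj_by_pow subset_iff)
  finally show "x \<in> conj_by g ` residual \<pi> H"
    unfolding residual_def using h m by (auto intro: generate.incl)
qed

lemma conj_image_eq:
  assumes "subgroup B G" "normalizes B H" "g \<in> B" "H \<subseteq> carrier G"
  shows "conj_by g ` H = H"
proof
  show "conj_by g ` H \<subseteq> H" using assms by (auto simp: normalizes_def)
  show "H \<subseteq> conj_by g ` H"
  proof
    fix h assume h: "h \<in> H"
    have "conj_by (inv g) h \<in> H"
      using assms h by (auto simp: normalizes_def subgroup.m_inv_closed)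
    moreover have "conj_by g (conj_by (inv g) h) = h"
      using assms h subgroup.mem_carrier[OF assms(1,3)] by (simp add: subset_iff)
    ultimately show "h \<in> conj_by g ` H" by (intro image_eqI[of h "conj_by g" "conj_by (inv g) h"]) simp_all
  qed
qed

lemma normal_in_conj:
  assumes "normal_in N H" and g: "g \<in> carrier G"
  shows "normal_in (conj_by g ` N) (conj_by g ` H)"
proof -
  have "conj_by (conj_by g h) (conj_by g n) = conj_by g (conj_by h n)" if "h \<in> H" "n \<in> N" for h n
    using that assms subgroup.mem_carrier[of H G h] subgroup.mem_carrier[of N G n]
    unfolding normal_in_def by (intro conj_by_distrib[symmetric]) auto
  then show ?thesis
    using assms unfolding normal_in_def normalizes_def by (auto simp: subgroup_conj_by)
qed

lemma pi_over_conj: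
  assumes "pi_over \<pi> H N" "g \<in> carrier G" "H \<subseteq> carrier G"
  shows "pi_over \<pi> (conj_by g ` H) (conj_by g ` N)"
  using assms by (force simp: pi_over_def subset_iff simp flip: conj_by_pow)

lemma normal_in_set_mult:
  assumes A: "normal_in A H" and B: "normal_in B H"
  shows "normal_in (A <#> B) H"
proof -
  note sA = normal_in_subgroup[OF A] and sB = normal_in_subgroup[OF B]
  have "subgroup (A <#> B) G"
    by (rule subgroup_set_mult[OF sA(1) sB(1) normalizes_subset[OF sA(4) sB(3)]])
  moreover have "A <#> B \<subseteq> H" by (rule set_mult_least[OF sA(2,3) sB(3)])
  moreover have "normalizes H (A <#> B)"
    by (rule normalizes_set_mult[OF sA(1) sB(1) subgroup.subset[OF sA(2)] sA(4) sB(4)])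
  ultimately show ?thesis using sA(2) by (simp add: normal_in_def)
qed

definition rad :: "nat set \<Rightarrow> 'a set \<Rightarrow> 'a set \<Rightarrow> 'a set" where
  "rad \<pi> V H = \<Union>{W. normal_in W H \<and> V \<subseteq> W \<and> pi_over \<pi> W V}"

lemma rad_greatest: "normal_in W H \<Longrightarrow> V \<subseteq> W \<Longrightarrow> pi_over \<pi> W V \<Longrightarrow> W \<subseteq> rad \<pi> V H"
  by (auto simp: rad_def)

lemma rad_pi_over: "pi_over \<pi> (rad \<pi> V H) V"
  by (auto simp: rad_def pi_over_def)

text \<open>Shows that the union defining \<open>rad\<close> is directed, which is why it is a
  subgroup.\<close>

lemma rad_directed:
  assumes "normal_in W1 H" "V \<subseteq> W1" "pi_over \<pi> W1 V" "normal_in W2 H" "V \<subseteq> W2" "pi_over \<pi> W2 V"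
  shows "W1 <#> W2 \<subseteq> rad \<pi> V H"
proof (rule rad_greatest)
  show "normal_in (W1 <#> W2) H" by (rule normal_in_set_mult) fact+
  note s = normal_in_subgroup[OF assms(1)] normal_in_subgroup[OF assms(4)]
  show "V \<subseteq> W1 <#> W2" using set_mult_incl(1)[of W1 W2] s assms by blast
  have "normalizes W2 W1" using assms by (auto simp: normal_in_def normalizes_def)
  then have "pi_over \<pi> (W1 <#> W2) W1"
    by (intro pi_over_set_mult[of W1 W2 \<pi> V]) (use s assms in auto)
  then show "pi_over \<pi> (W1 <#> W2) V"
    using assms(3) by (rule pi_over_trans) (rule set_mult_closed; use s subgroup.subset in blast)
qed

lemma rad_normal_in:
  assumes V: "normal_in V H"
  shows "normal_in (rad \<pi> V H) H" "V \<subseteq> rad \<pi> V H"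
proof -
  note s = normal_in_subgroup[OF V]
  show VR: "V \<subseteq> rad \<pi> V H"
    by (intro rad_greatest V order_refl pi_over_refl s)
  have RH: "rad \<pi> V H \<subseteq> H" by (auto simp: rad_def normal_in_def)
  have "subgroup (rad \<pi> V H) G"
  proof (rule subgroupI)
    show "rad \<pi> V H \<subseteq> carrier G" using RH subgroup.subset[OF s(2)] by simp
    show "rad \<pi> V H \<noteq> {}" using VR subgroup.one_closed[OF s(1)] by auto
    fix a assume "a \<in> rad \<pi> V H"
    then obtain W1 where 1: "normal_in W1 H" "V \<subseteq> W1" "pi_over \<pi> W1 V" "a \<in> W1"
      by (auto simp: rad_def)
    then show "inv a \<in> rad \<pi> V H"
      using subgroup.m_inv_closed[of W1 G a] by (auto simp: rad_def normal_in_def)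
    fix b assume "b \<in> rad \<pi> V H"
    then obtain W2 where 2: "normal_in W2 H" "V \<subseteq> W2" "pi_over \<pi> W2 V" "b \<in> W2"
      by (auto simp: rad_def)
    show "a \<otimes> b \<in> rad \<pi> V H"
      using rad_directed[OF 1(1-3) 2(1-3)] set_mult_memI[OF 1(4) 2(4)] by blast
  qed
  then show "normal_in (rad \<pi> V H) H"
    using RH s(2) unfolding normal_in_def rad_def normalizes_def by blast
qed

lemma normalizes_rad:
  assumes B: "subgroup B G" and "normalizes B H" "normalizes B V" and V: "V \<subseteq> carrier G"
    and H: "H \<subseteq> carrier G"
  shows "normalizes B (rad \<pi> V H)"
  unfolding normalizes_def
proof (intro ballI)
  fix b a assume b: "b \<in> B" and "a \<in> rad \<pi> V H"
  then obtain W where W: "normal_in W H" "V \<subseteq> W" "pi_over \<pi> W V" "a \<in> W" by (auto simp: rad_def)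
  have bc: "b \<in> carrier G" using B b by (rule subgroup.mem_carrier)
  have eq: "conj_by b ` H = H" "conj_by b ` V = V"
    using assms b by (simp_all add: conj_image_eq[OF B])
  have "W \<subseteq> carrier G" using W(1) H by (auto simp: normal_in_def)
  moreover have "V \<subseteq> conj_by b ` W" using image_mono[OF W(2), of "conj_by b"] eq by simp
  ultimately have "conj_by b ` W \<subseteq> rad \<pi> V H"
    using rad_greatest[of "conj_by b ` W" H V \<pi>] normal_in_conj[OF W(1) bc] pi_over_conj[OF W(3) bc] 
      eq by simp
  then show "conj_by b a \<in> rad \<pi> V H" using W(4) by auto
qed

text \<open>The radical is determined by \<open>V\<close> and \<open>N\<close>, so whatever
  normalizes both of these normalizes it.\<close>

lemma rad_mono_normal:
  assumes N: "normal_in N H" and V: "normal_in V N" "normalizes H V"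
  shows "rad \<pi> V N \<subseteq> rad \<pi> V H"
proof (rule rad_greatest)
  note sN = normal_in_subgroup[OF N] and sR = normal_in_subgroup[OF rad_normal_in(1)[OF V(1)]]
  have "normalizes H (rad \<pi> V N)"
    using normalizes_rad[OF sN(2,4) V(2)] normal_in_subgroup[OF V(1)] sN
    by (auto dest: subgroup.subset)
  then show "normal_in (rad \<pi> V N) H" using sN sR by (auto simp: normal_in_def)
qed (use V rad_normal_in rad_pi_over in auto)

section \<open>Factor groups and their orders\<close>

lemma factor_group:
  assumes N: "normal_in N H" and Q: "Q = G\<lparr>carrier := H\<rparr> Mod N"
  shows "group Q"
    and "\<And>x. x \<in> H \<Longrightarrow> N #> x \<in> carrier Q"
    and "\<And>x y. x \<in> H \<Longrightarrow> y \<in> H \<Longrightarrow> N #> (x \<otimes> y) = (N #> x) \<otimes>\<^bsub>Q\<^esub> (N #> y)"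
    and "\<And>x m. x \<in> H \<Longrightarrow> N #> (x [^] (m::nat)) = (N #> x) [^]\<^bsub>Q\<^esub> m"
    and "\<And>x. x \<in> H \<Longrightarrow> N #> x = \<one>\<^bsub>Q\<^esub> \<longleftrightarrow> x \<in> N"
    and "\<And>q. q \<in> carrier Q \<Longrightarrow> \<exists>x\<in>H. q = N #> x"
    and "carrier Q = (\<lambda>x. N #> x) ` H"
proof -
  note s = normal_in_subgroup[OF N]
  let ?H = "G\<lparr>carrier := H\<rparr>"
  interpret n: normal N ?H using N normal_in_iff_normal[OF s(2)] by simp
  have rc: "N #>\<^bsub>?H\<^esub> x = N #> x" for x by (simp add: r_coset_def)
  show g: "group Q" unfolding Q by (rule n.factorgroup_is_group)
  show car: "carrier Q = (\<lambda>x. N #> x) ` H"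
    unfolding Q FactGroup_def RCOSETS_def by (auto simp: rc)
  then show 1: "\<And>x. x \<in> H \<Longrightarrow> N #> x \<in> carrier Q"
    and "\<And>q. q \<in> carrier Q \<Longrightarrow> \<exists>x\<in>H. q = N #> x" by auto
  have hom: "(\<lambda>x. N #> x) \<in> hom ?H Q"
    using n.r_coset_hom_Mod unfolding Q rc .
  then show 2: "\<And>x y. x \<in> H \<Longrightarrow> y \<in> H \<Longrightarrow> N #> (x \<otimes> y) = (N #> x) \<otimes>\<^bsub>Q\<^esub> (N #> y)"
    by (simp add: hom_def)
  have one: "\<one>\<^bsub>Q\<^esub> = N" by (simp add: Q)
  show "N #> x = \<one>\<^bsub>Q\<^esub> \<longleftrightarrow> x \<in> N" if "x \<in> H" for x
    unfolding one using coset_join1 coset_join2 subgroup.mem_carrier[OF s(2) that] s(1)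
    by (metis subgroup.subset)
  show "N #> (x [^] (m::nat)) = (N #> x) [^]\<^bsub>Q\<^esub> m" if x: "x \<in> H" for x m
  proof (induction m)
    case 0
    then show ?case
      using subgroup.subset[OF s(1)] by (simp add: one)
  next
    case (Suc m)
    then show ?case using 2[OF subgroup_pow_mem[OF s(2) x] x] by simp
  qed
qed

text \<open>Cauchy's theorem: an element of prime order \<open>p\<close> with a trivial power of
  exponent \<open>m\<close> forces \<open>p dvd m\<close>. It comes from Sylow's theorem with
  exponent 1, where the cofactor \<open>k\<close> may still be divisible by
  \<open>p\<close>.\<close>

lemma pi_number_order:
  assumes fin: "finite (carrier G)" and o: "pi_over \<pi> (carrier G) {\<one>}"
  shows "pi_number \<pi> (order G)"
  unfolding pi_number_def
proof (intro conjI allI impI)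
  show "0 < order G" using fin order_gt_0_iff_finite by simp
  fix p :: nat assume p: "prime p \<and> p dvd order G"
  then obtain k where "order G = p ^ 1 * k" by auto
  then obtain P where P: "subgroup P G" "card P = p ^ 1"
    using sylow_thm[of p G 1 k] p fin is_group by blast
  have "1 < card P" using P p prime_gt_1_nat by simp
  then obtain x where x: "x \<in> P" "x \<noteq> \<one>"
    by (metis card_1_singleton_iff card.empty less_irrefl not_one_less_zero subset_singletonD subsetI singletonI One_nat_def)
  have xc: "x \<in> carrier G" using P x by (blast intro: subgroup.mem_carrier)
  interpret P: group "G\<lparr>carrier := P\<rparr>" using P(1) by (rule subgroup_imp_group)
  have "x [^] p = \<one>"
    using P.pow_order_eq_1[of x] x(1) P(2) nat_pow_consistent[of x p P] by (simp add: order_def)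
  moreover obtain m where m: "pi_number \<pi> m" "x [^] m \<in> {\<one>}" using o xc by (rule pi_overE)
  ultimately have "\<not> coprime p m"
    using coprime_powers_mem[OF triv_subgroup xc, of p m] x by auto
  then have "p dvd m" using p prime_imp_coprime_nat by blast
  then show "p \<in> \<pi>" using m p by (auto simp: pi_number_def)
qed

lemma pi_over_iff_order_factor:
  assumes N: "normal_in N H" and fin: "finite (carrier G)" and Q: "Q = G\<lparr>carrier := H\<rparr> Mod N"
  shows "pi_over \<pi> H N \<longleftrightarrow> pi_number \<pi> (order Q)"
proof
  note f = factor_group[OF N Q]
  interpret Q: group Q by (rule f)
  have "finite H" using fin normal_in_subgroup(2)[OF N] by (blast dest: subgroup.subset intro: finite_subset)
  then have finQ: "finite (carrier Q)" using f(7) by simp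
  show "pi_number \<pi> (order Q)" if o: "pi_over \<pi> H N"
  proof (rule Q.pi_number_order[OF finQ], unfold Q.pi_over_def, rule)
    fix q assume "q \<in> carrier Q"
    then obtain x where x: "x \<in> H" "q = N #> x" using f(6) by blast
    obtain m where m: "pi_number \<pi> m" "x [^] m \<in> N" using o x(1) by (rule pi_overE)
    then have "q [^]\<^bsub>Q\<^esub> m = \<one>\<^bsub>Q\<^esub>"
      using f(4,5) x subgroup_pow_mem[OF normal_in_subgroup(2)[OF N]] by metis
    then show "\<exists>m. pi_number \<pi> m \<and> q [^]\<^bsub>Q\<^esub> m \<in> {\<one>\<^bsub>Q\<^esub>}" using m by auto
  qed
  show "pi_over \<pi> H N" if "pi_number \<pi> (order Q)"
    unfolding pi_over_def
  proof
    fix x assume x: "x \<in> H"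
    then have "N #> (x [^] order Q) = \<one>\<^bsub>Q\<^esub>"
      using f(2,4) Q.pow_order_eq_1 by simp
    then show "\<exists>m. pi_number \<pi> m \<and> x [^] m \<in> N"
      using that x f(5) subgroup_pow_mem[OF normal_in_subgroup(2)[OF N]] by blast
  qed
qed

section \<open>Transfer into a central section\<close>

text \<open>\<open>Y/T\<close> is central in \<open>C/T\<close>, so there is a transfer homomorphism \<open>V\<close> from \<open>C\<close> to \<open>Y/T\<close>. It is
  trivial on elements whose image in \<open>C/T\<close> is a \<open>\<pi>\<close>-element, and on \<open>Y\<close> it is the power map with
  exponent \<open>|C:Y|\<close>, a \<open>\<pi>\<close>-number.\<close>

lemma pi_elements_mult_closed:
  assumes fin: "finite (carrier G)" and T: "normal_in T Y" and Y: "normal_in Y C"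
    and comm: "\<And>c y. c \<in> C \<Longrightarrow> y \<in> Y \<Longrightarrow> conj_by c y \<otimes> inv y \<in> T"
    and CY: "pi_over \<pi> C Y" and YT: "pi_over (- \<pi>) Y T"
    and c: "c \<in> C" "pi_number \<pi> m" "c [^] m \<in> T" and d: "d \<in> C" "pi_number \<pi> l" "d [^] l \<in> T"
  shows "\<exists>k. pi_number \<pi> k \<and> (c \<otimes> d) [^] k \<in> T"
proof -
  note sT = normal_in_subgroup[OF T] and sY = normal_in_subgroup[OF Y]
  note car = subgroup.mem_carrier[OF sY(2)] subgroup.mem_carrier[OF sY(1)] subgroup.mem_carrier[OF sT(1)]
  define Q where "Q = G\<lparr>carrier := Y\<rparr> Mod T"
  note f = factor_group[OF T Q_def]
  define cls where "cls x = T #> x" for x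
  have cls_eq: "cls u = cls v" if "u \<in> Y" "v \<in> Y" "u \<otimes> inv v \<in> T" for u v
  proof -
    have "cls u = cls (u \<otimes> inv v) \<otimes>\<^bsub>Q\<^esub> cls v"
      using f(3)[of "u \<otimes> inv v" v] that sT(3) car by (simp add: cls_def m_assoc subset_iff)
    moreover have "cls (u \<otimes> inv v) = \<one>\<^bsub>Q\<^esub>" using that sT(3) f(5) by (auto simp: cls_def)
    ultimately show ?thesis using that f(1,2) by (simp add: cls_def group.is_monoid monoid.l_one)
  qed
  have "comm_group Q"
  proof (rule group.group_comm_groupI[OF f(1)])
    fix a b assume "a \<in> carrier Q" "b \<in> carrier Q"
    then obtain x y where xy: "x \<in> Y" "y \<in> Y" "a = cls x" "b = cls y" using f(6) by (metis cls_def)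
    have "x \<otimes> y \<otimes> inv (y \<otimes> x) = conj_by x y \<otimes> inv y"
      using xy car by (simp add: conj_by_def inv_mult_group m_assoc)
    then have "cls (x \<otimes> y) = cls (y \<otimes> x)"
      using xy comm[of x y] sY(3) by (intro cls_eq subgroup.m_closed[OF sY(1)]) auto
    then show "a \<otimes>\<^bsub>Q\<^esub> b = b \<otimes>\<^bsub>Q\<^esub> a" using f(3) xy by (simp add: cls_def)
  qed
  then interpret Q: comm_group Q .
  have clsc: "cls y \<in> carrier Q" if "y \<in> Y" for y using f(2) that by (simp add: cls_def)
  define rep where "rep x = (SOME z. z \<in> Y #> x)" for x
  have rep_mem: "\<exists>y\<in>Y. rep x = y \<otimes> x" if "x \<in> C" for x
  proof -
    have "x \<in> Y #> x" using that car sY(1) by (simp add: rcos_self)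
    then have "rep x \<in> Y #> x" unfolding rep_def by (rule someI)
    then show ?thesis by (auto simp: r_coset_def)
  qed
  have rep_C: "rep x \<in> C" if "x \<in> C" for x
    using rep_mem[OF that] sY(3) that subgroup.m_closed[OF sY(2)] by auto
  have rep_eq: "rep (y \<otimes> x) = rep x" if "y \<in> Y" "x \<in> C" for x y
  proof -
    have "Y #> (y \<otimes> x) = Y #> y #> x"
      using that car subgroup.subset[OF sY(1)] by (simp add: coset_mult_assoc)
    also have "Y #> y = Y" using that sY(1) car by (simp add: coset_join2)
    finally show ?thesis by (simp add: rep_def)
  qed
  define s where "s x = x \<otimes> inv (rep x)" for x
  have s_Y: "s x \<in> Y" if x: "x \<in> C" for x
  proof -
    obtain y where y: "y \<in> Y" "rep x = y \<otimes> x" using rep_mem[OF x] by auto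
    then have "s x = inv y" using x car by (simp add: s_def inv_mult_group m_assoc[symmetric])
    then show ?thesis using y sY(1) by (simp add: subgroup.m_inv_closed)
  qed
  have s_rep: "s x \<otimes> rep x = x" if "x \<in> C" for x
    using that rep_C car by (simp add: s_def m_assoc)
  have rep_rep: "rep (rep x) = rep x" if "x \<in> C" for x
    using rep_eq rep_mem that by metis
  define R where "R = rep ` C"
  have RC: "R \<subseteq> C" using rep_C by (auto simp: R_def)
  have finC: "finite C" using fin sY(2) by (blast dest: subgroup.subset intro: finite_subset)
  then have finR: "finite R" by (simp add: R_def)
  have repR: "rep t = t" if "t \<in> R" for t using that rep_rep by (auto simp: R_def)
  \<comment> \<open>The transfer of \<open>g\<close>: split \<open>g \<otimes> t\<close> into its
    \<open>Y\<close>-part \<open>s (g \<otimes> t)\<close> and its representative, and multiply the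
    \<open>Y\<close>-parts in the abelian group \<open>Y/T\<close>.\<close>
  define V where "V g = (\<Otimes>\<^bsub>Q\<^esub>t\<in>R. cls (s (g \<otimes> t)))" for g
  note mC = subgroup.m_closed[OF sY(2)]
  have mRC: "g \<otimes> t \<in> C" if "g \<in> C" "t \<in> R" for g t using that mC RC by auto
  have VC: "V g \<in> carrier Q" if "g \<in> C" for g
    unfolding V_def using that s_Y mRC clsc by (intro Q.finprod_closed) auto
  have perm: "inj_on (\<lambda>t. rep (h \<otimes> t)) R" "(\<lambda>t. rep (h \<otimes> t)) ` R = R" if h: "h \<in> C" for h
  proof -
    show inj: "inj_on (\<lambda>t. rep (h \<otimes> t)) R"
    proof (rule inj_onI)
      fix t u assume tu: "t \<in> R" "u \<in> R" "rep (h \<otimes> t) = rep (h \<otimes> u)"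
      have sY1: "s (h \<otimes> t) \<in> Y" "s (h \<otimes> u) \<in> Y" using tu h by (auto intro: s_Y mRC)
      have c: "h \<in> carrier G" "t \<in> carrier G" "u \<in> carrier G" using h tu RC car by auto
      have eqs: "s (h \<otimes> t) \<otimes> rep (h \<otimes> u) = h \<otimes> t" "s (h \<otimes> u) \<otimes> rep (h \<otimes> u) = h \<otimes> u"
        using s_rep[OF mRC[OF h tu(1)]] s_rep[OF mRC[OF h tu(2)]] tu(3) by auto
      have rc: "rep (h \<otimes> u) \<in> carrier G" using rep_C mRC h tu car by auto
      define a where "a = s (h \<otimes> t) \<otimes> inv (s (h \<otimes> u))"
      have aY: "a \<in> Y" unfolding a_def
        using sY1 sY(1) by (simp add: subgroup.m_closed subgroup.m_inv_closed)
      have "h \<otimes> t = a \<otimes> (h \<otimes> u)"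
      proof -
        have "a \<otimes> (h \<otimes> u) = a \<otimes> (s (h \<otimes> u) \<otimes> rep (h \<otimes> u))" by (simp only: eqs(2))
        also have "\<dots> = s (h \<otimes> t) \<otimes> rep (h \<otimes> u)"
          unfolding a_def using sY1 car rc by (simp add: m_assoc)
        finally show ?thesis using eqs(1) by simp
      qed
      then have "inv h \<otimes> (h \<otimes> t) = inv h \<otimes> (a \<otimes> (h \<otimes> u))" by simp
      then have "t = conj_by (inv h) a \<otimes> u"
        using c aY car by (simp add: conj_by_def m_assoc)
      moreover have "conj_by (inv h) a \<in> Y"
        using sY(4) aY h sY(2) by (simp add: normalizes_def subgroup.m_inv_closed)
      ultimately have "rep t = rep u" using rep_eq RC tu by auto
      then show "t = u" using repR tu by simp
    qed
    show "(\<lambda>t. rep (h \<otimes> t)) ` R = R"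
      using mRC h by (intro endo_inj_surj finR inj) (auto simp: R_def)
  qed
  have V_mult: "V (g \<otimes> h) = V g \<otimes>\<^bsub>Q\<^esub> V h" if gh: "g \<in> C" "h \<in> C" for g h
  proof -
    have step: "cls (s (g \<otimes> h \<otimes> t)) = cls (s (h \<otimes> t)) \<otimes>\<^bsub>Q\<^esub> cls (s (g \<otimes> rep (h \<otimes> t)))"
      if t: "t \<in> R" for t
    proof -
      let ?u = "s (h \<otimes> t)" and ?r = "rep (h \<otimes> t)"
      have u: "?u \<in> Y" and r: "?r \<in> C" using mRC[OF gh(2) t] s_Y rep_C by auto
      have gr: "g \<otimes> ?r \<in> C" using mC gh r by auto
      have cu: "conj_by g ?u \<in> Y" using sY(4) gh u by (auto simp: normalizes_def)
      have "g \<otimes> h \<otimes> t = g \<otimes> (?u \<otimes> ?r)"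
        using s_rep[OF mRC[OF gh(2) t]] gh t RC car by (simp add: m_assoc subset_iff)
      also have "\<dots> = conj_by g ?u \<otimes> (g \<otimes> ?r)"
        using gh u r car by (simp add: conj_by_def m_assoc inv_solve_left)
      finally have e: "g \<otimes> h \<otimes> t = conj_by g ?u \<otimes> (g \<otimes> ?r)" .
      have "rep (g \<otimes> h \<otimes> t) = rep (g \<otimes> ?r)" unfolding e by (rule rep_eq[OF cu gr])
      then have "s (g \<otimes> h \<otimes> t) = g \<otimes> h \<otimes> t \<otimes> inv (rep (g \<otimes> ?r))" by (simp only: s_def)
      also have "\<dots> = conj_by g ?u \<otimes> s (g \<otimes> ?r)"
        unfolding e s_def[of "g \<otimes> ?r"] using car(1)[OF gr] car(2)[OF cu] car(1)[OF rep_C[OF gr]]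
        by (simp add: m_assoc)
      finally have "s (g \<otimes> h \<otimes> t) = conj_by g ?u \<otimes> s (g \<otimes> ?r)" .
      then have "cls (s (g \<otimes> h \<otimes> t)) = cls (conj_by g ?u) \<otimes>\<^bsub>Q\<^esub> cls (s (g \<otimes> ?r))"
        using f(3)[OF cu s_Y[OF gr]] by (simp add: cls_def)
      \<comment> \<open>Centrality of \<open>Y/T\<close> removes the conjugation by
        \<open>g\<close>; without this \<open>V\<close> would not be multiplicative.\<close>
      also have "cls (conj_by g ?u) = cls ?u" using cls_eq[OF cu u] comm[OF gh(1) u] .
      finally show ?thesis .
    qed
    have "V (g \<otimes> h) = (\<Otimes>\<^bsub>Q\<^esub>t\<in>R. cls (s (h \<otimes> t)) \<otimes>\<^bsub>Q\<^esub> cls (s (g \<otimes> rep (h \<otimes> t))))"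
      unfolding V_def using gh step mRC mC rep_C RC
      by (intro Q.finprod_cong refl) (auto simp: simp_implies_def intro!: Q.m_closed clsc s_Y)
    also have "\<dots> = V h \<otimes>\<^bsub>Q\<^esub> (\<Otimes>\<^bsub>Q\<^esub>t\<in>R. cls (s (g \<otimes> rep (h \<otimes> t))))"
      unfolding V_def using gh mRC mC rep_C
      by (intro Q.finprod_multf) (auto intro!: clsc s_Y)
    also have "(\<Otimes>\<^bsub>Q\<^esub>t\<in>R. cls (s (g \<otimes> rep (h \<otimes> t)))) = (\<Otimes>\<^bsub>Q\<^esub>t\<in>(\<lambda>t. rep (h \<otimes> t)) ` R. cls (s (g \<otimes> t)))"
      using gh mRC mC rep_C perm(1)[OF gh(2)]
      by (intro Q.finprod_reindex[symmetric]) (auto intro!: clsc s_Y)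
    also have "\<dots> = V g" unfolding V_def perm(2)[OF gh(2)] ..
    finally show ?thesis using Q.m_comm VC gh by simp
  qed
  have V_Y: "V y = cls y [^]\<^bsub>Q\<^esub> card R" if y: "y \<in> Y" for y
  proof -
    \<comment> \<open>\<open>rep (y \<otimes> t) = rep t = t\<close>, so each of the
      \<open>card R\<close> factors of \<open>V y\<close> is the class of \<open>y\<close>.\<close>
    have "s (y \<otimes> t) = y" if t: "t \<in> R" for t
      using t y rep_eq[of y t] repR[OF t] RC car by (auto simp: s_def m_assoc subset_iff)
    then have "V y = (\<Otimes>\<^bsub>Q\<^esub>t\<in>R. cls y)"
      unfolding V_def using y by (intro Q.finprod_cong refl) (auto simp: simp_implies_def clsc)
    then show ?thesis using y by (simp add: Q.finprod_const clsc)
  qed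
  \<comment> \<open>Exponents start at 1: \<pi>-numbers are positive, and the induction then uses
    multiplicativity alone.\<close>
  have V_pow: "V (g [^] Suc k) = V g [^]\<^bsub>Q\<^esub> Suc k" if g: "g \<in> C" for g and k :: nat
  proof (induction k)
    case 0
    then show ?case using g VC car by simp
  next
    case (Suc k)
    then show ?case using V_mult[OF subgroup_pow_mem[OF sY(2) g] g] by (metis nat_pow_Suc Q.nat_pow_Suc)
  qed
  have V_T: "V y = \<one>\<^bsub>Q\<^esub>" if "y \<in> T" for y
    using V_Y[of y] that sT(3) f(5)[of y] by (auto simp: cls_def)
  \<comment> \<open>\<open>V g\<close> is killed by the \<pi>-number \<open>m\<close>, since
    \<open>V\<close> is trivial on \<open>T\<close>, and by a number prime to \<pi>, since it is the
    class of an element of \<open>Y\<close>.\<close>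
  have V_one: "V g = \<one>\<^bsub>Q\<^esub>" if g: "g \<in> C" "pi_number \<pi> m" "g [^] m \<in> T" for g m
  proof -
    obtain k where "m = Suc k" using g(2) by (metis pi_number_def gr0_implies_Suc)
    then have 1: "V g [^]\<^bsub>Q\<^esub> m = \<one>\<^bsub>Q\<^esub>" using V_pow g V_T by metis
    obtain y where y: "y \<in> Y" "V g = cls y" using f(6) VC[OF g(1)] by (metis cls_def)
    obtain b where b: "pi_number (- \<pi>) b" "y [^] b \<in> T" using YT y(1) by (rule pi_overE)
    have 2: "V g [^]\<^bsub>Q\<^esub> b = \<one>\<^bsub>Q\<^esub>"
      using y b f(4,5) subgroup_pow_mem[OF sY(1) y(1)] by (metis cls_def)
    show ?thesis
      using Q.coprime_powers_mem[OF Q.triv_subgroup VC[OF g(1)], of m b] 1 2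
        pi_number_coprime[OF g(2) b(1)] by auto
  qed
  have cd: "c \<otimes> d \<in> C" using mC c d by simp
  have Vcd: "V (c \<otimes> d) = \<one>\<^bsub>Q\<^esub>" using V_mult V_one c d by simp
  obtain k where k: "pi_number \<pi> k" "(c \<otimes> d) [^] k \<in> Y" using CY cd by (rule pi_overE)
  then obtain k' where "k = Suc k'" by (metis pi_number_def gr0_implies_Suc)
  then have "V ((c \<otimes> d) [^] k) = \<one>\<^bsub>Q\<^esub>" using V_pow[OF cd] Vcd by simp
  then have "cls (((c \<otimes> d) [^] k) [^] card R) = \<one>\<^bsub>Q\<^esub>"
    using V_Y[OF k(2)] f(4)[OF k(2)] by (simp add: cls_def)
  then have in_T: "((c \<otimes> d) [^] k) [^] card R \<in> T"
    using f(5) subgroup_pow_mem[OF sY(1) k(2)] by (simp add: cls_def)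
  \<comment> \<open>\<open>R\<close> meets every coset of \<open>Y\<close> in \<open>C\<close>
    exactly once, so \<open>card R\<close> is the index of \<open>Y\<close> and therefore a
    \<pi>-number.\<close>
  have "bij_betw (\<lambda>x. Y #> x) R ((\<lambda>x. Y #> x) ` C)"
    unfolding bij_betw_def
  proof
    have e: "Y #> rep x = Y #> x" if "x \<in> C" for x
    proof -
      obtain y where y: "y \<in> Y" "rep x = y \<otimes> x" using rep_mem[OF \<open>x \<in> C\<close>] by auto
      have "Y #> (y \<otimes> x) = Y #> y #> x"
        using y that car subgroup.subset[OF sY(1)] by (simp add: coset_mult_assoc)
      then show ?thesis using y sY(1) car by (simp add: coset_join2)
    qed
    show "inj_on (\<lambda>x. Y #> x) R"
      by (rule inj_onI) (metis repR rep_def)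
    show "(\<lambda>x. Y #> x) ` R = (\<lambda>x. Y #> x) ` C" using e by (auto simp: R_def image_image)
  qed
  then have "card R = order (G\<lparr>carrier := C\<rparr> Mod Y)"
    using factor_group(7)[OF Y refl] by (simp add: order_def bij_betw_same_card)
  then have "pi_number \<pi> (card R)"
    using pi_over_iff_order_factor[OF Y fin refl] CY by simp
  then show ?thesis
    using in_T k(1) cd car pi_number_mult by (metis nat_pow_pow)
qed

lemma normalizes_by_set_mult:
  assumes "normalizes A Y" "normalizes B Y" "A \<subseteq> carrier G" "B \<subseteq> carrier G" "Y \<subseteq> carrier G"
  shows "normalizes (A <#> B) Y"
  unfolding normalizes_def
proof (intro ballI)
  fix x y assume "x \<in> A <#> B" and y: "y \<in> Y"
  then obtain a b where ab: "a \<in> A" "b \<in> B" "x = a \<otimes> b" by (auto elim: set_mult_memE)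
  then have "conj_by x y = conj_by a (conj_by b y)"
    using y assms by (simp add: conj_by_conj_by subset_iff)
  then show "conj_by x y \<in> Y" using ab y assms(1,2) by (simp add: normalizes_def)
qed

text \<open>If \<open>order G = a * b\<close> is the splitting into the \<pi>-part and the rest,
  then \<open>h [^] a\<close> is killed by \<open>b\<close> and is thus a generator of the
  residual.\<close>

lemma residual_pi_over:
  assumes fin: "finite (carrier G)" and H: "subgroup H G"
  shows "pi_over \<pi> H (residual \<pi> H)"
  unfolding pi_over_def
proof
  fix h assume h: "h \<in> H"
  then have hc: "h \<in> carrier G" by (rule subgroup.mem_carrier[OF H])
  have "order G > 0" using fin order_gt_0_iff_finite by simp
  then obtain a b where ab: "order G = a * b" "pi_number \<pi> a" "pi_number (- \<pi>) b"
    by (rule pi_number_split)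
  have "(h [^] a) [^] b = \<one>" using hc pow_order_eq_1[OF hc] ab(1) by (simp add: nat_pow_pow)
  then have "h [^] a \<in> residual \<pi> H"
    unfolding residual_def using ab(3) subgroup_pow_mem[OF H h] by (intro generate.incl) auto
  then show "\<exists>m. pi_number \<pi> m \<and> h [^] m \<in> residual \<pi> H" using ab(2) by blast
qed

lemma subgroup_nat_powers:
  assumes fin: "finite (carrier G)" and z: "z \<in> carrier G"
  shows "subgroup (range (\<lambda>i::nat. z [^] i)) G"
proof (rule subgroupI)
  show "range (\<lambda>i::nat. z [^] i) \<subseteq> carrier G" using z by auto
  show "range (\<lambda>i::nat. z [^] i) \<noteq> {}" by auto
  fix a assume "a \<in> range (\<lambda>i::nat. z [^] i)"
  then obtain i :: nat where i: "a = z [^] i" by auto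
  \<comment> \<open>Since \<open>z [^] order G = \<one>\<close>, the inverse of
    \<open>z [^] i\<close> is the natural power \<open>z [^] (i * n)\<close>.\<close>
  obtain n where n: "order G = Suc n" using fin order_gt_0_iff_finite gr0_implies_Suc by blast
  have "z [^] (i * n) \<otimes> a = z [^] (i * order G)"
    using z by (simp add: i n nat_pow_mult add.commute)
  also have "\<dots> = \<one>" using z pow_order_eq_1[of "z [^] i"] by (simp add: nat_pow_pow)
  finally have "inv a = z [^] (i * n)" using z i by (simp add: inv_equality)
  then show "inv a \<in> range (\<lambda>i::nat. z [^] i)" by auto
  fix b assume "b \<in> range (\<lambda>i::nat. z [^] i)"
  then show "a \<otimes> b \<in> range (\<lambda>i::nat. z [^] i)" using i z by (auto simp: nat_pow_mult)
qed

end

section \<open>Direct decomposition by power maps\<close>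

text \<open>The projection of a \<open>\<sigma>\<close>-nilpotent group onto its Hall \<open>\<sigma> i\<close>-subgroup is a power map.\<close>

lemma sigma_nilpotentI:
  fixes Q :: "'c monoid"
  assumes "group Q" and fin: "finite (carrier Q)" and part: "prime_partition I \<sigma>"
    and comp: "\<And>i x. i \<in> I \<Longrightarrow> x \<in> carrier Q \<Longrightarrow> \<exists>u\<in>U i. \<exists>v\<in>V i. x = u \<otimes>\<^bsub>Q\<^esub> v"
    and U: "\<And>i. i \<in> I \<Longrightarrow> U i \<subseteq> carrier Q"
      "\<And>i u v. i \<in> I \<Longrightarrow> u \<in> U i \<Longrightarrow> v \<in> U i \<Longrightarrow> u \<otimes>\<^bsub>Q\<^esub> v \<in> U i"
      "\<And>i u. i \<in> I \<Longrightarrow> u \<in> U i \<Longrightarrow> \<exists>m. pi_number (\<sigma> i) m \<and> u [^]\<^bsub>Q\<^esub> m = \<one>\<^bsub>Q\<^esub>"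
    and V: "\<And>i. i \<in> I \<Longrightarrow> V i \<subseteq> carrier Q"
      "\<And>i u v. i \<in> I \<Longrightarrow> u \<in> V i \<Longrightarrow> v \<in> V i \<Longrightarrow> u \<otimes>\<^bsub>Q\<^esub> v \<in> V i"
      "\<And>i u. i \<in> I \<Longrightarrow> u \<in> V i \<Longrightarrow> \<exists>m. pi_number (- \<sigma> i) m \<and> u [^]\<^bsub>Q\<^esub> m = \<one>\<^bsub>Q\<^esub>"
    and comm: "\<And>i u v. i \<in> I \<Longrightarrow> u \<in> U i \<Longrightarrow> v \<in> V i \<Longrightarrow> u \<otimes>\<^bsub>Q\<^esub> v = v \<otimes>\<^bsub>Q\<^esub> u"
  shows "sigma_nilpotent I \<sigma> Q"
proof -
  interpret Q: group Q by fact
  have pos: "order Q > 0" using fin Q.order_gt_0_iff_finite by simp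
  \<comment> \<open>\<open>e\<close> is 1 modulo the \<sigma> i-part \<open>a\<close> of the order
    and 0 modulo the remaining part \<open>b\<close>, so the \<open>e\<close>-th power fixes
    \<sigma> i-elements and kills elements of order prime to \<sigma> i.\<close>
  have "\<exists>e a b y. order Q = a * b \<and> pi_number (\<sigma> i) a \<and> pi_number (- \<sigma> i) b \<and> e = a * y + 1 \<and> b dvd e"
    for i
  proof -
    obtain a b where ab: "order Q = a * b" "pi_number (\<sigma> i) a" "pi_number (- \<sigma> i) b"
      using pos by (rule pi_number_split)
    have "coprime b a" using pi_number_coprime[OF ab(3,2)] by simp
    moreover have "b \<noteq> 0" using ab(3) by (simp add: pi_number_def)
    ultimately obtain x y where "b * x = a * y + 1"
      using bezout_nat[of b a] by (auto simp: coprime_iff_gcd_eq_1)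
    then show ?thesis using ab by (metis dvd_triv_left)
  qed
  then obtain e a b y where e: "order Q = a i * b i" "pi_number (\<sigma> i) (a i)"
      "pi_number (- \<sigma> i) (b i)" "e i = a i * y i + 1" "b i dvd e i" for i
    by metis
  have tors: "(q [^]\<^bsub>Q\<^esub> a i) [^]\<^bsub>Q\<^esub> b i = \<one>\<^bsub>Q\<^esub>" "(q [^]\<^bsub>Q\<^esub> b i) [^]\<^bsub>Q\<^esub> a i = \<one>\<^bsub>Q\<^esub>"
    if "q \<in> carrier Q" for q i
    using that Q.pow_order_eq_1[of q] e(1)[of i] by (simp_all add: Q.nat_pow_pow mult.commute)
  have U_e: "u [^]\<^bsub>Q\<^esub> e i = u" if i: "i \<in> I" "u \<in> U i" for u i
  proof -
    have uc: "u \<in> carrier Q" using U(1) i by blast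
    obtain m where m: "pi_number (\<sigma> i) m" "u [^]\<^bsub>Q\<^esub> m = \<one>\<^bsub>Q\<^esub>" using U(3) i by blast
    have "(u [^]\<^bsub>Q\<^esub> a i) [^]\<^bsub>Q\<^esub> m = (u [^]\<^bsub>Q\<^esub> m) [^]\<^bsub>Q\<^esub> a i"
      using uc by (simp add: Q.nat_pow_pow mult.commute)
    then have "(u [^]\<^bsub>Q\<^esub> a i) [^]\<^bsub>Q\<^esub> m = \<one>\<^bsub>Q\<^esub>" using m(2) by simp
    then have "u [^]\<^bsub>Q\<^esub> a i = \<one>\<^bsub>Q\<^esub>"
      using Q.coprime_powers_mem[OF Q.triv_subgroup, of "u [^]\<^bsub>Q\<^esub> a i" m "b i"] tors(1)[OF uc] uc
        pi_number_coprime[OF m(1) e(3)] by auto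
    then show ?thesis using uc e(4)[of i] by (simp flip: Q.nat_pow_pow)
  qed
  have V_e: "v [^]\<^bsub>Q\<^esub> e i = \<one>\<^bsub>Q\<^esub>" if i: "i \<in> I" "v \<in> V i" for v i
  proof -
    have vc: "v \<in> carrier Q" using V(1) i by blast
    obtain m where m: "pi_number (- \<sigma> i) m" "v [^]\<^bsub>Q\<^esub> m = \<one>\<^bsub>Q\<^esub>" using V(3) i by blast
    have "(v [^]\<^bsub>Q\<^esub> b i) [^]\<^bsub>Q\<^esub> m = (v [^]\<^bsub>Q\<^esub> m) [^]\<^bsub>Q\<^esub> b i"
      using vc by (simp add: Q.nat_pow_pow mult.commute)
    then have "(v [^]\<^bsub>Q\<^esub> b i) [^]\<^bsub>Q\<^esub> m = \<one>\<^bsub>Q\<^esub>" using m(2) by simp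
    then have b1: "v [^]\<^bsub>Q\<^esub> b i = \<one>\<^bsub>Q\<^esub>"
      using Q.coprime_powers_mem[OF Q.triv_subgroup, of "v [^]\<^bsub>Q\<^esub> b i" m "a i"] tors(2)[OF vc] vc
        pi_number_coprime[OF m(1) e(2)] by auto
    obtain c where "e i = b i * c" using e(5)[of i] by blast
    then show ?thesis using vc b1 by (simp flip: Q.nat_pow_pow)
  qed
  have pow_e: "(u \<otimes>\<^bsub>Q\<^esub> v) [^]\<^bsub>Q\<^esub> e i = u" if i: "i \<in> I" "u \<in> U i" "v \<in> V i" for u v i
  proof -
    have c: "u \<in> carrier Q" "v \<in> carrier Q" using U(1) V(1) i by blast+
    then show ?thesis using Q.pow_mult_distrib[OF comm[OF i] c] U_e V_e i by simp
  qed
  \<comment> \<open>The \<open>e i\<close>-th power extracts the \<open>U\<close>-factor of an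
    element, and since \<open>U i\<close> and \<open>V i\<close> commute, the
    \<open>U\<close>-factor of a product is the product of the \<open>U\<close>-factors.\<close>
  have hom_e: "(x \<otimes>\<^bsub>Q\<^esub> z) [^]\<^bsub>Q\<^esub> e i = x [^]\<^bsub>Q\<^esub> e i \<otimes>\<^bsub>Q\<^esub> z [^]\<^bsub>Q\<^esub> e i"
    if i: "i \<in> I" and x: "x \<in> carrier Q" and z: "z \<in> carrier Q" for x z i
  proof -
    obtain u v where uv: "u \<in> U i" "v \<in> V i" "x = u \<otimes>\<^bsub>Q\<^esub> v" using comp[OF i x] by blast
    obtain u' v' where uv': "u' \<in> U i" "v' \<in> V i" "z = u' \<otimes>\<^bsub>Q\<^esub> v'" using comp[OF i z] by blast
    have c: "u \<in> carrier Q" "v \<in> carrier Q" "u' \<in> carrier Q" "v' \<in> carrier Q"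
      using uv uv' U(1)[OF i] V(1)[OF i] by auto
    have "x \<otimes>\<^bsub>Q\<^esub> z = u \<otimes>\<^bsub>Q\<^esub> (v \<otimes>\<^bsub>Q\<^esub> u') \<otimes>\<^bsub>Q\<^esub> v'"
      using uv uv' c by (simp add: Q.m_assoc)
    also have "v \<otimes>\<^bsub>Q\<^esub> u' = u' \<otimes>\<^bsub>Q\<^esub> v" using comm[OF i uv'(1) uv(2)] by simp
    finally have "x \<otimes>\<^bsub>Q\<^esub> z = (u \<otimes>\<^bsub>Q\<^esub> u') \<otimes>\<^bsub>Q\<^esub> (v \<otimes>\<^bsub>Q\<^esub> v')" using c by (simp add: Q.m_assoc)
    then show ?thesis
      using pow_e[OF i U(2)[OF i uv(1) uv'(1)] V(2)[OF i uv(2) uv'(2)]]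
        pow_e[OF i uv(1,2)] pow_e[OF i uv'(1,2)] uv uv' by simp
  qed
  \<comment> \<open>\<open>I\<close> may be infinite; only the classes containing a prime divisor of
    the order contribute a factor.\<close>
  define J where "J = {i \<in> I. \<exists>p. prime p \<and> p dvd order Q \<and> p \<in> \<sigma> i}"
  define H where "H i = Q\<lparr>carrier := (\<lambda>q. q [^]\<^bsub>Q\<^esub> e i) ` carrier Q\<rparr>" for i
  have H_sub: "subgroup (carrier (H i)) Q" if i: "i \<in> I" for i
  proof -
    have "group_hom Q Q (\<lambda>q. q [^]\<^bsub>Q\<^esub> e i)"
      using hom_e[OF i] by unfold_locales (auto simp: hom_def)
    then show ?thesis by (simp add: H_def group_hom.img_is_subgroup)
  qed
  have H_group: "group (H i)" if "i \<in> I" for i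
    using Q.subgroup_imp_group[OF H_sub[OF that]] by (simp add: H_def)
  have H_fin: "finite (carrier (H i))" for i using fin by (simp add: H_def)
  have H_pi: "pi_number (\<sigma> i) (order (H i))" if i: "i \<in> I" for i
  proof -
    interpret H: group "H i" by (rule H_group[OF i])
    show ?thesis
    proof (rule H.pi_number_order[OF H_fin])
      show "H.pi_over (\<sigma> i) (carrier (H i)) {\<one>\<^bsub>H i\<^esub>}"
        unfolding H.pi_over_def
      proof
        fix h assume "h \<in> carrier (H i)"
        then obtain q where q: "q \<in> carrier Q" "h = q [^]\<^bsub>Q\<^esub> e i" by (auto simp: H_def)
        obtain c where "e i = b i * c" using e(5)[of i] by blast
        then have "e i * a i = order Q * c" using e(1)[of i] by simp
        then have "h [^]\<^bsub>Q\<^esub> a i = (q [^]\<^bsub>Q\<^esub> order Q) [^]\<^bsub>Q\<^esub> c"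
          using q by (simp add: Q.nat_pow_pow)
        then have "h [^]\<^bsub>Q\<^esub> a i = \<one>\<^bsub>Q\<^esub>" using q Q.pow_order_eq_1 by simp
        then have "h [^]\<^bsub>H i\<^esub> a i = \<one>\<^bsub>H i\<^esub>"
          using Q.nat_pow_consistent[of h "a i"] by (simp add: H_def)
        then show "\<exists>m. pi_number (\<sigma> i) m \<and> h [^]\<^bsub>H i\<^esub> m \<in> {\<one>\<^bsub>H i\<^esub>}" using e(2) by auto
      qed
    qed
  qed
  have disj: "\<sigma> i \<inter> \<sigma> j = {}" if "i \<in> I" "j \<in> I" "i \<noteq> j" for i j
    using part that by (auto simp: prime_partition_def)
  have JI: "J \<subseteq> I" by (auto simp: J_def)
  have "finite J"
  proof -
    define P where "P = {p. prime p \<and> p dvd order Q}"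
    have "finite P" using pos by (auto simp: P_def intro: finite_subset[OF _ finite_atMost[of "order Q"]] dvd_imp_le)
    define c where "c i = (SOME p. p \<in> P \<and> p \<in> \<sigma> i)" for i
    have c: "c i \<in> P \<and> c i \<in> \<sigma> i" if "i \<in> J" for i
      unfolding c_def by (rule someI_ex) (use that in \<open>auto simp: J_def P_def\<close>)
    have "inj_on c J"
    proof (rule inj_onI)
      fix i j assume "i \<in> J" "j \<in> J" "c i = c j"
      then show "i = j" using c[of i] c[of j] disj[of i j] JI by auto
    qed
    moreover have "c ` J \<subseteq> P" using c by auto
    ultimately show ?thesis using \<open>finite P\<close> by (metis finite_imageD finite_subset)
  qed
  define \<Phi> where "\<Phi> q = (\<lambda>i\<in>J. q [^]\<^bsub>Q\<^esub> e i)" for q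
  have \<Phi>_hom: "\<Phi> \<in> hom Q (product_group J H)"
    using JI hom_e unfolding hom_def \<Phi>_def
    by (auto simp: H_def fun_eq_iff restrict_def subset_iff)
  interpret P: group "product_group J H" using H_group JI by (intro product_group) auto
  interpret \<Phi>: group_hom Q "product_group J H" \<Phi>
    using \<Phi>_hom by unfold_locales
  have inj: "inj_on \<Phi> (carrier Q)"
  proof (rule \<Phi>.inj_iff_trivial_ker[THEN iffD2], intro equalityI subsetI)
    fix q assume "q \<in> kernel Q (product_group J H) \<Phi>"
    then have q: "q \<in> carrier Q" and "\<Phi> q = \<one>\<^bsub>product_group J H\<^esub>" by (auto simp: kernel_def)
    then have qe: "q [^]\<^bsub>Q\<^esub> e i = \<one>\<^bsub>Q\<^esub>" if "i \<in> J" for i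
      using that by (simp add: \<Phi>_def H_def fun_eq_iff restrict_def) (metis)
    have "q \<in> {\<one>\<^bsub>Q\<^esub>}"
    proof (rule Q.mem_if_sigma_powers_mem[OF part Q.triv_subgroup q])
      fix i assume i: "i \<in> I"
      show "\<exists>m. pi_number (- \<sigma> i) m \<and> q [^]\<^bsub>Q\<^esub> m \<in> {\<one>\<^bsub>Q\<^esub>}"
      proof (cases "i \<in> J")
        case True
        \<comment> \<open>\<open>?q\<close> is killed by \<open>a i\<close>, so its
          \<open>e i\<close>-th power is \<open>?q\<close> itself; but that power is trivial because
          \<open>q [^] e i\<close> is.\<close>
        let ?q = "q [^]\<^bsub>Q\<^esub> b i"
        have "?q [^]\<^bsub>Q\<^esub> e i = (q [^]\<^bsub>Q\<^esub> e i) [^]\<^bsub>Q\<^esub> b i"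
          using q by (simp add: Q.nat_pow_pow mult.commute)
        then have "?q [^]\<^bsub>Q\<^esub> e i = \<one>\<^bsub>Q\<^esub>" using qe[OF True] by simp
        moreover have "?q [^]\<^bsub>Q\<^esub> e i = (?q [^]\<^bsub>Q\<^esub> a i) [^]\<^bsub>Q\<^esub> y i \<otimes>\<^bsub>Q\<^esub> ?q"
          unfolding e(4)[of i] using q by (simp flip: Q.nat_pow_pow)
        ultimately have "?q = \<one>\<^bsub>Q\<^esub>" using tors(2)[OF q] q by simp
        then show ?thesis using e(3) by auto
      next
        case False
        then have "pi_number (- \<sigma> i) (order Q)" using i pos by (auto simp: J_def pi_number_def)
        then show ?thesis using Q.pow_order_eq_1[OF q] by auto
      qed
    qed
    then show "q \<in> {\<one>\<^bsub>Q\<^esub>}" .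
  next
    fix q assume "q \<in> {\<one>\<^bsub>Q\<^esub>}"
    then show "q \<in> kernel Q (product_group J H) \<Phi>" by (simp add: kernel_def)
  qed
  have card_H: "card (carrier (product_group J H)) = (\<Prod>i\<in>J. order (H i))"
    using \<open>finite J\<close> by (simp add: card_PiE order_def)
  \<comment> \<open>Surjectivity by counting: the factors have pairwise coprime orders dividing
    \<open>order Q\<close>, so the product is no larger than \<open>Q\<close>, which embeds into
    it.\<close>
  have "(\<Prod>i\<in>J. order (H i)) dvd order Q"
  proof (rule prod_coprime_dvd[OF \<open>finite J\<close>])
    fix i assume i: "i \<in> J"
    then show "order (H i) dvd order Q"
      using Q.lagrange[OF H_sub[of i]] JI by (metis dvd_triv_right order_def subsetD)
    fix j assume "j \<in> J" "i \<noteq> j"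
    then show "coprime (order (H i)) (order (H j))"
      using i JI by (intro pi_number_coprime[OF H_pi H_pi] disj) auto
  qed
  then have le: "card (carrier (product_group J H)) \<le> card (carrier Q)"
    using card_H pos by (simp add: order_def dvd_imp_le)
  have fP: "finite (carrier (product_group J H))"
    using \<open>finite J\<close> H_fin by (simp add: finite_PiE)
  have "\<Phi> ` carrier Q = carrier (product_group J H)"
  proof (rule card_seteq[OF fP])
    show "\<Phi> ` carrier Q \<subseteq> carrier (product_group J H)" using \<Phi>.hom_closed by blast
    show "card (carrier (product_group J H)) \<le> card (\<Phi> ` carrier Q)"
      using le card_image[OF inj] by simp
  qed
  then have "\<Phi> \<in> iso Q (product_group J H)" using \<Phi>_hom inj by (simp add: iso_iff)
  then have "Q \<cong> product_group J H" by (rule is_isoI)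
  moreover have "\<forall>j\<in>J. sigma_primary I \<sigma> (H j)"
  proof
    fix j assume "j \<in> J"
    then have j: "j \<in> I" using JI by blast
    then show "sigma_primary I \<sigma> (H j)"
      using H_group[OF j] H_fin[of j] H_pi[OF j] unfolding sigma_primary_def pi_number_def by blast
  qed
  ultimately show ?thesis
    unfolding sigma_nilpotent_def using \<open>group Q\<close> \<open>finite J\<close> by blast
qed

section \<open>Chains of \<sigma>-subnormal steps\<close>

locale sigma_group = group G for G (structure) +
  fixes I :: "nat set" and \<sigma> :: "nat \<Rightarrow> nat set"
  assumes fin: "finite (carrier G)" and partition: "prime_partition I \<sigma>"
begin

lemma sigma_disjoint: "i \<in> I \<Longrightarrow> j \<in> I \<Longrightarrow> i \<noteq> j \<Longrightarrow> \<sigma> i \<inter> \<sigma> j = {}"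
  using partition by (auto simp: prime_partition_def)

definition sn_step :: "'a set \<Rightarrow> 'a set \<Rightarrow> bool" where
  "sn_step A H \<longleftrightarrow> subgroup A G \<and> subgroup H G \<and> A \<subseteq> H \<and>
     (normal_in A H \<or> (\<exists>i\<in>I. residual (\<sigma> i) H \<subseteq> A))"

text \<open>The first conjunct serves the chain of length 0, about which \<open>sn_step\<close> says
  nothing.\<close>

definition sn :: "'a set \<Rightarrow> 'a set \<Rightarrow> bool" where
  "sn A H \<longleftrightarrow> subgroup A G \<and> sn_step\<^sup>*\<^sup>* A H"

lemma sn_refl: "subgroup H G \<Longrightarrow> sn H H"
  by (simp add: sn_def)

lemma sn_stepI: "sn_step A H \<Longrightarrow> sn A H"
  by (simp add: sn_def sn_step_def r_into_rtranclp)

lemma sn_trans: "sn A B \<Longrightarrow> sn B C \<Longrightarrow> sn A C"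
  by (auto simp: sn_def)

lemma sn_step_subgroup: "sn_step A H \<Longrightarrow> subgroup A G" "sn_step A H \<Longrightarrow> subgroup H G"
  "sn_step A H \<Longrightarrow> A \<subseteq> H"
  by (auto simp: sn_step_def)

lemma sn_subgroup:
  assumes "sn A H" shows "subgroup A G" "subgroup H G" "A \<subseteq> H"
proof -
  have "sn_step\<^sup>*\<^sup>* A H" and A: "subgroup A G" using assms by (auto simp: sn_def)
  then have "subgroup H G \<and> A \<subseteq> H"
    by (induction rule: rtranclp_induct) (auto simp: sn_step_def)
  then show "subgroup A G" "subgroup H G" "A \<subseteq> H" using A by auto
qed

lemma sn_induct_top [consumes 1, case_names refl step]:
  assumes "sn A H" and "P A" and step: "\<And>X H. sn A X \<Longrightarrow> sn_step X H \<Longrightarrow> P X \<Longrightarrow> P H"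
  shows "P H"
proof -
  have "sn_step\<^sup>*\<^sup>* A H" and A: "subgroup A G" using assms by (auto simp: sn_def)
  then show ?thesis
    by (induction rule: rtranclp_induct) (use assms(2) step in \<open>auto simp: sn_def\<close>)
qed

text \<open>Carries a chain termwise along a map of sets; the maps used are intersection with a
  subgroup, multiplication by a normal subgroup and conjugation.\<close>

lemma sn_image:
  assumes "sn A H" and f: "\<And>X Y. Y \<subseteq> H \<Longrightarrow> sn_step X Y \<Longrightarrow> sn_step (f X) (f Y)"
    and "subgroup (f A) G"
  shows "sn (f A) (f H)"
proof -
  \<comment> \<open>The bound \<open>K\<close> stays fixed while the induction varies the top of the
    chain.\<close>
  have "H \<subseteq> K \<Longrightarrow> (\<And>X Y. Y \<subseteq> K \<Longrightarrow> sn_step X Y \<Longrightarrow> sn_step (f X) (f Y)) \<Longrightarrow> sn (f A) (f H)" for K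
    using assms(1)
  proof (induction rule: sn_induct_top)
    case refl
    then show ?case using assms(3) by (simp add: sn_refl)
  next
    case (step X H)
    then have "sn (f A) (f X)" using sn_step_subgroup(3) by blast
    moreover have "sn (f X) (f H)" using step by (blast intro: sn_stepI)
    ultimately show ?case by (rule sn_trans)
  qed
  then show ?thesis using f by blast
qed

lemma normal_in_sn: "normal_in N H \<Longrightarrow> sn N H"
  by (rule sn_stepI) (simp add: sn_step_def normal_in_def)

lemma residual_sn:
  "i \<in> I \<Longrightarrow> subgroup A G \<Longrightarrow> subgroup H G \<Longrightarrow> A \<subseteq> H \<Longrightarrow> residual (\<sigma> i) H \<subseteq> A \<Longrightarrow> sn A H"
  by (rule sn_stepI) (auto simp: sn_step_def)

lemma sn_Int:
  assumes "sn A H" and K: "subgroup K G"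
  shows "sn (A \<inter> K) (H \<inter> K)"
proof (rule sn_image[OF assms(1)])
  fix X Y assume s: "sn_step X Y"
  show "sn_step (X \<inter> K) (Y \<inter> K)"
  proof (cases "normal_in X Y")
    case True
    then show ?thesis using s normal_in_Int[OF True K] by (auto simp: sn_step_def normal_in_def)
  next
    case False
    then obtain i where i: "i \<in> I" "residual (\<sigma> i) Y \<subseteq> X" using s by (auto simp: sn_step_def)
    have YK: "subgroup (Y \<inter> K) G" "subgroup (X \<inter> K) G"
      using s K by (auto simp: sn_step_def intro: subgroups_Inter_pair)
    have "residual (\<sigma> i) (Y \<inter> K) \<subseteq> residual (\<sigma> i) Y"
      using s by (intro residual_mono) (auto simp: sn_step_def dest: subgroup.subset)
    then have "residual (\<sigma> i) (Y \<inter> K) \<subseteq> X \<inter> K"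
      using residual_subset[OF YK(1)] i by blast
    then show ?thesis using s i YK by (auto simp: sn_step_def)
  qed
qed (use sn_subgroup[OF assms(1)] K in \<open>auto intro: subgroups_Inter_pair\<close>)

lemma sn_Int_sub:
  assumes "sn A H" "subgroup K G" "A \<subseteq> K" "K \<subseteq> H" shows "sn A K"
  using sn_Int[OF assms(1,2)] assms(3,4) by (simp add: Int_absorb1 Int_absorb2)

text \<open>Takes the place of passing to \<open>H/V\<close>: the chain is multiplied termwise by
  \<open>V\<close> and ends in \<open>V <#> H = H\<close>.\<close>

lemma sn_set_mult_normal:
  assumes sn: "sn A H" and V: "normal_in V H"
  shows "sn (V <#> A) H"
proof -
  note sV = normal_in_subgroup[OF V]
  have nV: "normalizes X V" if "X \<subseteq> H" for X using sV(4) that by (rule normalizes_subset)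
  have "sn (V <#> A) (V <#> H)"
  proof (rule sn_image[OF sn])
    fix X Y assume Y: "Y \<subseteq> H" and s: "sn_step X Y"
    note ss = sn_step_subgroup[OF s]
    have sub: "subgroup (V <#> X) G" "subgroup (V <#> Y) G"
      using nV Y ss by (auto intro!: subgroup_set_mult sV(1))
    have le: "V <#> X \<subseteq> V <#> Y" using ss(3) by (auto simp: set_mult_def)
    show "sn_step (V <#> X) (V <#> Y)"
    proof (cases "normal_in X Y")
      case True
      note c = subgroup.subset[OF sV(1)] subgroup.subset[OF ss(2)] subgroup.subset[OF sub(1)]
      have "normalizes Y (V <#> X)"
        by (rule normalizes_set_mult[OF sV(1) ss(1) c(2) nV[OF Y] normal_in_subgroup(4)[OF True]])
      moreover have "normalizes V (V <#> X)"
        by (rule normalizes_subset[OF normalizes_self[OF sub(1)] set_mult_incl(1)[OF sV(1) ss(1)]])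
      ultimately have "normalizes (V <#> Y) (V <#> X)"
        by (intro normalizes_by_set_mult c)
      then show ?thesis using sub le by (simp add: sn_step_def normal_in_def)
    next
      case False
      then obtain i where i: "i \<in> I" "residual (\<sigma> i) Y \<subseteq> X" using s by (auto simp: sn_step_def)
      have "pi_over (\<sigma> i) (V <#> Y) (V <#> residual (\<sigma> i) Y)"
        by (rule pi_over_product[OF sV(1) ss(2) nV[OF Y] residual_pi_over[OF fin ss(2)]])
      then have "pi_over (\<sigma> i) (V <#> Y) (V <#> X)"
        by (rule pi_over_mono) (use i(2) in \<open>auto simp: set_mult_def\<close>)
      then have "residual (\<sigma> i) (V <#> Y) \<subseteq> V <#> X"
        by (rule residual_least[OF sub(1) _ subgroup.subset[OF sub(2)]])
      then show ?thesis using sub le i(1) by (auto simp: sn_step_def)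
    qed
  qed (use nV sn_subgroup[OF sn] sV in \<open>auto intro!: subgroup_set_mult\<close>)
  moreover have "V <#> H = H"
    using set_mult_least[OF sV(2,3) order_refl] set_mult_incl(2)[OF sV(1,2)] by blast
  ultimately show ?thesis by simp
qed

lemma sn_conj:
  assumes sn: "sn A H" and g: "g \<in> carrier G"
  shows "sn (conj_by g ` A) (conj_by g ` H)"
proof (rule sn_image[OF sn])
  fix X Y assume s: "sn_step X Y"
  note ss = sn_step_subgroup[OF s]
  show "sn_step (conj_by g ` X) (conj_by g ` Y)"
  proof (cases "normal_in X Y")
    case True
    then show ?thesis using normal_in_conj[OF True g] by (auto simp: sn_step_def normal_in_def)
  next
    case False
    then obtain i where i: "i \<in> I" "residual (\<sigma> i) Y \<subseteq> X" using s by (auto simp: sn_step_def)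
    have "residual (\<sigma> i) (conj_by g ` Y) \<subseteq> conj_by g ` X"
      using residual_conj[OF subgroup.subset[OF ss(2)] g, of "\<sigma> i"] image_mono[OF i(2), of "conj_by g"]
      by (rule order_trans)
    then show ?thesis
      using i(1) subgroup_conj_by[OF g ss(1)] subgroup_conj_by[OF g ss(2)] image_mono[OF ss(3), of "conj_by g"]
      unfolding sn_step_def by blast
  qed
qed (use subgroup_conj_by[OF g] sn_subgroup[OF sn] in auto)

text \<open>Let \<open>X\<close> be the last proper term of a chain. If \<open>X\<close> is normal
  it contains the normal closure of \<open>A\<close>; otherwise it contains a residual of
  \<open>H\<close>, hence its product with \<open>A\<close>. Both replacements for \<open>X\<close>
  are determined by \<open>A\<close> and \<open>H\<close>, up to the index \<open>i\<close>, and so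
  inherit their symmetries.\<close>

lemma sn_proper_cases [consumes 2, case_names nclosure residual]:
  assumes sn: "sn A H" and "A \<noteq> H"
  obtains "nclosure A H \<noteq> H" | i where "i \<in> I" "residual (\<sigma> i) H <#> A \<noteq> H"
proof -
  have "A = H \<or> (\<exists>X. sn A X \<and> sn_step X H \<and> X \<noteq> H)"
    using sn
  proof (induction rule: sn_induct_top)
    case (step X H)
    then show ?case by (cases "X = H") auto
  qed simp
  then obtain X where X: "sn A X" "sn_step X H" "X \<noteq> H" using assms(2) by auto
  note ss = sn_step_subgroup[OF X(2)] and AX = sn_subgroup(3)[OF X(1)]
  show ?thesis
  proof (cases "normal_in X H")
    case True
    then have "nclosure A H \<subseteq> X"
      using AX by (intro nclosure_least) (auto simp: normal_in_def)
    then show ?thesis using X(3) ss(3) that(1) by blast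
  next
    case False
    then obtain i where i: "i \<in> I" "residual (\<sigma> i) H \<subseteq> X" using X(2) by (auto simp: sn_step_def)
    then have "residual (\<sigma> i) H <#> A \<subseteq> X" using set_mult_least[OF ss(1) i(2) AX] by simp
    then show ?thesis using that(2)[OF i(1)] X(3) ss(3) by blast
  qed
qed

section \<open>The two facts on residuals and radicals of \<sigma>-subnormal subgroups\<close>

text \<open>The first fact, with the index condition in the form \<open>H = P <#> B\<close>. Going
  up the chain, the hypothesis passes down to the last term \<open>X\<close>, whose residual lies in
  \<open>B\<close> by induction; once the residual of \<open>H\<close> lies in \<open>X\<close>,
  \<open>residual_eqI\<close> identifies the two.\<close>

lemma residual_subset_sn:
  assumes "sn B H" and j: "j \<in> I" and "normal_in P H" "V \<subseteq> B" "pi_over (\<sigma> j) P V" "H = P <#> B"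
  shows "residual (\<sigma> j) H \<subseteq> B"
  using assms(1,3,5,6)
proof (induction arbitrary: P rule: sn_induct_top)
  case refl
  then show ?case using residual_subset normal_in_subgroup(2) by blast
next
  case (step X H)
  note ss = sn_step_subgroup[OF step.hyps(2)] and sB = sn_subgroup[OF step.hyps(1)]
  note sP = normal_in_subgroup[OF step.prems(1)]
  have B_H: "B \<subseteq> H" using sB ss by blast
  have XH: "H \<inter> X = X" using ss(3) by blast
  have nP: "normal_in (P \<inter> X) X" using normal_in_Int[OF step.prems(1) ss(1)] XH by simp
  \<comment> \<open>Dedekind's modular law, which gives the product hypothesis for
    \<open>X\<close>.\<close>
  have "X \<subseteq> (P \<inter> X) <#> B"
  proof
    fix x assume x: "x \<in> X"
    then have "x \<in> P <#> B" using ss(3) step.prems(3) by blast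
    then obtain p b where pb: "p \<in> P" "b \<in> B" "x = p \<otimes> b" by (rule set_mult_memE)
    then have "x \<otimes> inv b = p"
      using subgroup.mem_carrier[OF sP(1)] subgroup.mem_carrier[OF sB(1)] by (simp add: m_assoc)
    moreover have "x \<otimes> inv b \<in> X"
      using x pb sB(3) ss(1) by (auto intro!: subgroup.m_closed subgroup.m_inv_closed)
    ultimately show "x \<in> (P \<inter> X) <#> B" using pb by (auto intro: set_mult_memI)
  qed
  then have X: "X = (P \<inter> X) <#> B"
    using set_mult_least[OF ss(1), of "P \<inter> X" B] sB(3) by blast
  have IH: "residual (\<sigma> j) X \<subseteq> B"
    by (rule step.IH[OF nP _ X]) (use step.prems(2) in \<open>rule pi_over_mono; blast\<close>)
  have "residual (\<sigma> j) H \<subseteq> X"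
  proof (cases "normal_in X H")
    case True
    have "normalizes P X" using normal_in_subgroup(4)[OF True] sP(3) by (rule normalizes_subset)
    then have o: "pi_over (\<sigma> j) (X <#> P) X"
      using sB(3) assms(4) by (intro pi_over_set_mult[OF ss(1) sP(1) _ step.prems(2)]) auto
    have "H \<subseteq> X <#> P"
    proof
      fix h assume "h \<in> H"
      then have "h \<in> P <#> B" using step.prems(3) by blast
      then obtain p b where pb: "p \<in> P" "b \<in> B" "h = p \<otimes> b" by (rule set_mult_memE)
      then have c: "p \<in> carrier G" "b \<in> carrier G" using subgroup.mem_carrier[OF sP(1)] subgroup.mem_carrier[OF sB(1)] by auto
      have "h = b \<otimes> conj_by (inv b) p" using c pb by (simp add: conj_by_def m_assoc)
      moreover have "conj_by (inv b) p \<in> P"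
        using sP(4) pb B_H subgroup.m_inv_closed[OF sP(2)] by (auto simp: normalizes_def)
      ultimately show "h \<in> X <#> P" using pb sB(3) by (auto intro: set_mult_memI)
    qed
    then have "pi_over (\<sigma> j) H X" using o by (auto intro: pi_over_mono)
    then show ?thesis using residual_least[OF ss(1)] subgroup.subset[OF ss(2)] by blast
  next
    case False
    then obtain k where k: "k \<in> I" "residual (\<sigma> k) H \<subseteq> X"
      using step.hyps(2) by (auto simp: sn_step_def)
    show ?thesis
    proof (cases "k = j")
      case False
      \<comment> \<open>For distinct classes, the elements of \<open>P\<close> have powers in
        \<open>X\<close> with coprime exponents. Then \<open>H = P <#> B\<close> lies in
        \<open>X\<close>, and the step is trivial.\<close>
      have "P \<subseteq> X"
      proof
        fix p assume p: "p \<in> P"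
        have "pi_over (\<sigma> k) P X"
          using residual_pi_over[OF fin ss(2)] by (rule pi_over_mono) (use sP k in auto)
        moreover have "pi_over (\<sigma> j) P X"
          using step.prems(2) by (rule pi_over_mono) (use assms(4) sB in auto)
        ultimately show "p \<in> X"
          using pi_over_coprime_mem[OF ss(1) p subgroup.subset[OF sP(1)]] sigma_disjoint[OF k(1) j False]
          by blast
      qed
      then have "H = X" using step.prems(3) sB(3) set_mult_least[OF ss(1)] ss(3) by blast
      then show ?thesis using residual_subset[OF ss(2)] by simp
    qed (use k in simp)
  qed
  then have "residual (\<sigma> j) X = residual (\<sigma> j) H"
    using ss by (intro residual_eqI)
  then show ?case using IH by simp
qed

lemma set_mult_absorb:
  assumes V: "subgroup V G" and Z: "subgroup Z G" and X: "subgroup X G" and "Z \<subseteq> V"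
  shows "V <#> (Z <#> X) = V <#> X"
proof -
  have "V <#> Z = V"
    using set_mult_least[OF V order_refl \<open>Z \<subseteq> V\<close>] set_mult_incl(1)[OF V Z] by blast
  then show ?thesis
    using set_mult_assoc[OF V[THEN subgroup.subset] Z[THEN subgroup.subset] X[THEN subgroup.subset]] by simp
qed

text \<open>The critical case is that \<open>X\<close> contains a normal subgroup \<open>N\<close> of \<open>H\<close> with \<open>H/N\<close> a
  \<open>\<sigma> j\<close>-group. For \<open>T = rad (\<sigma> j) V N\<close> the radical of \<open>X\<close> centralizes \<open>N/T\<close>, and in the
  centralizer \<open>C\<close> of \<open>N/T\<close> the \<open>\<sigma> j\<close>-elements modulo \<open>T\<close> form a subgroup by the transfer argument.\<close>

lemma rad_sn_step:
  assumes s: "sn_step X H" and V: "normal_in V H" and VX: "V \<subseteq> X" and j: "j \<in> I"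
  shows "rad (\<sigma> j) V X \<subseteq> rad (\<sigma> j) V H"
proof -
  note ss = sn_step_subgroup[OF s] and sV = normal_in_subgroup[OF V]
  note carH = subgroup.mem_carrier[OF ss(2)] and Hc = subgroup.subset[OF ss(2)]
  have V_X: "normal_in V X" by (rule normal_in_mono[OF V ss(1) VX ss(3)])
  define W where "W = rad (\<sigma> j) V X"
  have W: "normal_in W X" "V \<subseteq> W" "pi_over (\<sigma> j) W V"
    unfolding W_def using rad_normal_in[OF V_X] rad_pi_over by auto
  note sW = normal_in_subgroup[OF W(1)]
  show ?thesis
  proof (cases "normal_in X H")
    case True
    then show ?thesis by (rule rad_mono_normal[OF _ V_X sV(4)])
  next
    case False
    then obtain k where k: "k \<in> I" "residual (\<sigma> k) H \<subseteq> X" using s by (auto simp: sn_step_def)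
    \<comment> \<open>A subgroup of \<open>X\<close> that is normal in \<open>H\<close>, contains
      \<open>V\<close> and has a \<sigma> k-group as quotient \<open>H/N\<close>; it mediates
      between \<open>X\<close> and \<open>H\<close>.\<close>
    define N where "N = V <#> residual (\<sigma> k) H"
    have N: "normal_in N H" unfolding N_def
      by (rule normal_in_set_mult[OF V residual_normal_in[OF ss(2)]])
    note sN = normal_in_subgroup[OF N]
    have VN: "V \<subseteq> N" and RN: "residual (\<sigma> k) H \<subseteq> N"
      unfolding N_def by (rule set_mult_incl[OF sV(1) residual_subgroup[OF Hc]])+
    have NX: "N \<subseteq> X" unfolding N_def by (rule set_mult_least[OF ss(1) VX k(2)])
    have V_N: "normal_in V N" by (rule normal_in_mono[OF V sN(1) VN sN(3)])
    have oN: "pi_over (\<sigma> k) H N"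
      by (rule pi_over_mono[OF residual_pi_over[OF fin ss(2)] order_refl RN order_refl])
    have radN: "rad (\<sigma> j) V N \<subseteq> rad (\<sigma> j) V H" by (rule rad_mono_normal[OF N V_N sV(4)])
    show ?thesis
    proof (cases "k = j")
      case False
      \<comment> \<open>\<open>W\<close> is a \<sigma> j-group modulo \<open>N\<close> and
        \<open>H/N\<close> is a \<sigma> k-group. So \<open>W\<close> belongs to the radical of
        \<open>N\<close>, and \<open>N\<close> is normal in \<open>H\<close>.\<close>
      have "W \<subseteq> N"
      proof
        fix w assume w: "w \<in> W"
        show "w \<in> N"
        proof (rule pi_over_coprime_mem[OF sN(1) w subgroup.subset[OF sW(1)]])
          show "pi_over (\<sigma> j) W N" by (rule pi_over_mono[OF W(3) order_refl VN order_refl])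
          show "pi_over (\<sigma> k) W N"
            by (rule pi_over_mono[OF oN _ order_refl order_refl]) (use sW(3) ss(3) in blast)
          show "\<sigma> j \<inter> \<sigma> k = {}" using sigma_disjoint[OF j k(1)] False by blast
        qed
      qed
      then have "W \<subseteq> rad (\<sigma> j) V N"
        by (intro rad_greatest W normal_in_mono[OF W(1) sN(1) _ NX])
      then show ?thesis using radN by (simp add: W_def)
    next
      case True
      define T where "T = rad (\<sigma> j) V N"
      have T: "normal_in T N" "V \<subseteq> T" "pi_over (\<sigma> j) T V"
        unfolding T_def using rad_normal_in[OF V_N] rad_pi_over by auto
      note sT = normal_in_subgroup[OF T(1)]
      have HT: "normalizes H T" unfolding T_def
        by (rule normalizes_rad[OF ss(2) sN(4) sV(4)]) (use sV sN Hc in auto)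
      have T_max: "D \<subseteq> T" if "normal_in D N" "T \<subseteq> D" "pi_over (\<sigma> j) D T" for D
        unfolding T_def
      proof (rule rad_greatest[OF that(1)])
        show "V \<subseteq> D" using that(2) T(2) by simp
        show "pi_over (\<sigma> j) D V"
          by (rule pi_over_trans[OF that(3) T(3) subgroup.subset[OF normal_in_subgroup(1)[OF that(1)]]])
      qed
      \<comment> \<open>The centralizer of \<open>N/T\<close> in \<open>H\<close>, written with
        commutators. Unlike \<open>W\<close>, it is visibly normalized by all of
        \<open>H\<close>.\<close>
      define C where "C = {c \<in> H. \<forall>n\<in>N. conj_by c n \<otimes> inv n \<in> T}"
      have CH: "C \<subseteq> H" by (auto simp: C_def)
      have NH: "n \<in> H" if "n \<in> N" for n using that sN(3) by blast
      have TN: "n \<in> N" if "n \<in> T" for n using that sT(3) by blast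
      have cN: "conj_by h n \<in> N" if "h \<in> H" "n \<in> N" for h n
        using normalizesD[OF sN(4) that] .
      have cT: "conj_by h n \<in> T" if "h \<in> H" "n \<in> T" for h n
        using normalizesD[OF HT that] .
      note mT = subgroup.m_closed[OF sT(1)] and iT = subgroup.m_inv_closed[OF sT(1)]
      note mH = subgroup.m_closed[OF ss(2)] and iH = subgroup.m_inv_closed[OF ss(2)]
      have C: "subgroup C G"
      proof (rule subgroupI)
        show "C \<subseteq> carrier G" using CH Hc by simp
        have "\<one> \<in> C"
          using subgroup.one_closed[OF ss(2)] subgroup.one_closed[OF sT(1)] carH[OF NH]
          by (simp add: C_def)
        then show "C \<noteq> {}" by blast
        fix c assume c: "c \<in> C"
        then have cH: "c \<in> H" using CH by blast
        have "conj_by (inv c) n \<otimes> inv n \<in> T" if n: "n \<in> N" for n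
        proof -
          let ?n = "conj_by (inv c) n"
          have n': "?n \<in> N" using cN iH[OF cH] n by blast
          then have "conj_by c ?n \<otimes> inv ?n \<in> T" using c by (simp add: C_def)
          then have "inv (n \<otimes> inv ?n) \<in> T" using carH cH NH[OF n] by (simp add: iT)
          then show ?thesis using carH[OF NH[OF n]] carH[OF NH[OF n']] by (simp add: inv_mult_group)
        qed
        then show "inv c \<in> C" using iH[OF cH] by (simp add: C_def)
        fix d assume d: "d \<in> C"
        then have dH: "d \<in> H" using CH by blast
        have "conj_by (c \<otimes> d) n \<otimes> inv n \<in> T" if n: "n \<in> N" for n
        proof -
          let ?n = "conj_by d n"
          have n': "?n \<in> N" by (rule cN[OF dH n])
          have "conj_by c ?n \<otimes> inv ?n \<otimes> (?n \<otimes> inv n) \<in> T"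
            using c d n n' by (intro mT[of "conj_by c ?n \<otimes> inv ?n"]) (simp_all add: C_def)
          then show ?thesis
            using carH[OF cH] carH[OF dH] carH[OF NH[OF n]] carH[OF NH[OF n']]
            by (simp add: m_assoc conj_by_conj_by)
        qed
        then show "c \<otimes> d \<in> C" using mH[OF cH dH] by (simp add: C_def)
      qed
      have HC: "normalizes H C"
        unfolding normalizes_def
      proof (intro ballI)
        fix h c assume h: "h \<in> H" and c: "c \<in> C"
        then have cH: "c \<in> H" using CH by blast
        have "conj_by (conj_by h c) n \<otimes> inv n \<in> T" if n: "n \<in> N" for n
        proof -
          define m where "m = conj_by (inv h) n"
          have m: "m \<in> N" unfolding m_def using cN iH[OF h] n by blast
          have nm: "n = conj_by h m" unfolding m_def using carH[OF h] carH[OF NH[OF n]] by simp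
          have mm: "m \<in> carrier G" using m NH carH by blast
          have "conj_by h (conj_by c m \<otimes> inv m) \<in> T"
            using c m by (intro cT h) (simp add: C_def)
          moreover have "conj_by h (conj_by c m \<otimes> inv m) = conj_by (conj_by h c) n \<otimes> inv n"
            unfolding nm using carH[OF h] carH[OF cH] mm
            by (subst conj_by_distrib[symmetric]) (simp_all add: conj_by_mult conj_by_inv)
          ultimately show ?thesis by simp
        qed
        then show "conj_by h c \<in> C" using subgroup_conj_mem[OF ss(2) h cH] by (simp add: C_def)
      qed
      have comm_mem: "conj_by w n \<otimes> inv n = w \<otimes> conj_by n (inv w)" if "w \<in> H" "n \<in> H" for w n
        using carH[OF that(1)] carH[OF that(2)] by (simp add: conj_by_def m_assoc)
      have WN: "W \<inter> N \<subseteq> T"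
        unfolding T_def
      proof (rule rad_greatest)
        show "normal_in (W \<inter> N) N"
          using normal_in_Int[OF W(1) sN(1)] NX by (simp add: Int_absorb1)
        show "V \<subseteq> W \<inter> N" using W(2) VN by blast
        show "pi_over (\<sigma> j) (W \<inter> N) V" by (rule pi_over_mono[OF W(3)]) auto
      qed
      have WC: "W \<subseteq> C"
      proof
        fix w assume w: "w \<in> W"
        then have wH: "w \<in> H" using sW(3) ss(3) by blast
        have "conj_by w n \<otimes> inv n \<in> T" if n: "n \<in> N" for n
        proof -
          \<comment> \<open>The commutator lies in \<open>N\<close>, which is normal in
            \<open>H\<close>, and in \<open>W\<close>, which \<open>X\<close> and hence
            \<open>N\<close> normalizes; \<open>W \<inter> N\<close> is absorbed by
            \<open>T\<close>.\<close>
          have "conj_by w n \<otimes> inv n \<in> N"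
            using cN[OF wH n] subgroup.m_inv_closed[OF sN(1) n] subgroup.m_closed[OF sN(1)] by blast
          moreover have "w \<otimes> conj_by n (inv w) \<in> W"
            using w n NX normalizesD[OF sW(4)] subgroup.m_inv_closed[OF sW(1)]
            by (intro subgroup.m_closed[OF sW(1)]) auto
          ultimately show ?thesis using WN comm_mem[OF wH NH[OF n]] by auto
        qed
        then show "w \<in> C" using wH by (simp add: C_def)
      qed
      have TC: "T \<subseteq> C"
      proof
        fix t assume t: "t \<in> T"
        have "conj_by t n \<otimes> inv n \<in> T" if n: "n \<in> N" for n
          using comm_mem[OF NH[OF TN[OF t]] NH[OF n]] mT[OF t cT[OF NH[OF n] iT[OF t]]] by simp
        then show "t \<in> C" using NH[OF TN[OF t]] by (simp add: C_def)
      qed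
      define Y where "Y = C \<inter> N"
      have Y: "normal_in Y C"
        using normal_in_Int[OF N C] CH by (simp add: Y_def Int_commute Int_absorb1 Int_absorb2)
      note sY = normal_in_subgroup[OF Y]
      have "T \<subseteq> Y" using TC sT(3) by (simp add: Y_def)
      then have T_Y: "normal_in T Y"
        by (intro normal_in_mono[OF T(1) sY(1)]) (simp_all add: Y_def)
      have CY: "pi_over (\<sigma> j) C Y"
        using pi_over_Int[OF oN C] CH True by (simp add: Y_def Int_commute Int_absorb1 Int_absorb2)
      \<comment> \<open>As \<open>z\<close> centralizes \<open>N/T\<close>, the product of
        \<open>T\<close> with the powers of \<open>z\<close> is normal in \<open>N\<close> and a
        \<sigma> j-group modulo \<open>V\<close>, so the maximality of \<open>T\<close> absorbs
        it.\<close>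
      have z_T: "z \<in> T" if z: "z \<in> Y" and a: "pi_number (\<sigma> j) a" "z [^] a \<in> T" for z a
      proof -
        define Z where "Z = range (\<lambda>i::nat. z [^] i)"
        have zN: "z \<in> N" and zC: "z \<in> C" using z by (auto simp: Y_def)
        have zc: "z \<in> carrier G" using carH[OF NH[OF zN]] .
        have Z: "subgroup Z G" unfolding Z_def by (rule subgroup_nat_powers[OF fin zc])
        have ZN: "Z \<subseteq> N" unfolding Z_def using subgroup_pow_mem[OF sN(1) zN] by auto
        have ZC: "Z \<subseteq> C" unfolding Z_def using subgroup_pow_mem[OF C zC] by auto
        have nZ: "normalizes Z T" using HT ZN sN(3) by (meson normalizes_subset order_trans)
        have "normalizes N (T <#> Z)"
          unfolding normalizes_def
        proof (intro ballI)
          fix n x assume n: "n \<in> N" and "x \<in> T <#> Z"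
          then obtain t y where ty: "t \<in> T" "y \<in> Z" "x = t \<otimes> y" by (auto elim: set_mult_memE)
          have yc: "y \<in> C" "y \<in> H" using ty(2) ZC CH by auto
          note cc = carH[OF NH[OF n]] carH[OF yc(2)] carH[OF NH[OF TN[OF ty(1)]]]
          have "inv (conj_by y n \<otimes> inv n) \<in> T" using yc(1) n by (simp add: C_def iT)
          then have 1: "conj_by n t \<otimes> inv (conj_by y n \<otimes> inv n) \<in> T"
            using cT[OF NH[OF n] ty(1)] by (rule mT[rotated])
          have "conj_by n x = conj_by n t \<otimes> inv (conj_by y n \<otimes> inv n) \<otimes> y"
            using ty(3) cc by (simp add: conj_by_def inv_mult_group m_assoc)
          then show "conj_by n x \<in> T <#> Z" using set_mult_memI[OF 1 ty(2)] by simp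
        qed
        then have "normal_in (T <#> Z) N"
          using subgroup_set_mult[OF sT(1) Z nZ] sN(1) set_mult_least[OF sN(1) sT(3) ZN]
          by (simp add: normal_in_def)
        moreover have "pi_over (\<sigma> j) Z T"
          unfolding pi_over_def
        proof
          fix y assume "y \<in> Z"
          then obtain i :: nat where "y = z [^] i" by (auto simp: Z_def)
          then have "y [^] a = (z [^] a) [^] i" using zc by (simp add: nat_pow_pow mult.commute)
          then show "\<exists>m. pi_number (\<sigma> j) m \<and> y [^] m \<in> T"
            using subgroup_pow_mem[OF sT(1) a(2)] a(1) by auto
        qed
        then have "pi_over (\<sigma> j) (T <#> Z) T"
          by (rule pi_over_set_mult[OF sT(1) Z nZ _ order_refl])
        ultimately have "T <#> Z \<subseteq> T"
          by (intro T_max set_mult_incl(1)[OF sT(1) Z])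
        moreover have "z \<in> Z" unfolding Z_def using zc by (auto intro!: image_eqI[of _ _ 1])
        ultimately show ?thesis using set_mult_incl(2)[OF sT(1) Z] by blast
      qed
      \<comment> \<open>With \<open>b\<close> the part of the order prime to
        \<open>\<sigma> j\<close>, the power \<open>y [^] b\<close> is a \<sigma> j-element and so
        lies in \<open>T\<close> by \<open>z_T\<close>.\<close>
      have YT: "pi_over (- \<sigma> j) Y T"
        unfolding pi_over_def
      proof
        fix y assume y: "y \<in> Y"
        then have yc: "y \<in> carrier G" by (rule subgroup.mem_carrier[OF sY(1)])
        have "order G > 0" using fin order_gt_0_iff_finite by simp
        then obtain a b where ab: "order G = a * b" "pi_number (\<sigma> j) a" "pi_number (- \<sigma> j) b"
          by (rule pi_number_split)
        have "(y [^] b) [^] a = \<one>"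
          using yc pow_order_eq_1[OF yc] ab(1) by (simp add: nat_pow_pow mult.commute)
        then have "y [^] b \<in> T"
          using z_T[OF subgroup_pow_mem[OF sY(1) y] ab(2)] subgroup.one_closed[OF sT(1)] by simp
        then show "\<exists>m. pi_number (- \<sigma> j) m \<and> y [^] m \<in> T" using ab(3) by blast
      qed
      \<comment> \<open>\<open>H\<close> normalizes \<open>C\<close> and \<open>T\<close>, hence
        also \<open>E\<close>. Once \<open>E\<close> is a subgroup, it is a normal subgroup of
        \<open>H\<close> above \<open>W\<close> that the radical of \<open>H\<close> must
        contain.\<close>
      define E where "E = {c \<in> C. \<exists>m. pi_number (\<sigma> j) m \<and> c [^] m \<in> T}"
      have TE: "T \<subseteq> E" using TC pi_over_refl[OF sT(1), of "\<sigma> j"] by (auto simp: E_def pi_over_def)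
      have WE: "W \<subseteq> E"
        using WC pi_over_mono[OF W(3) order_refl T(2) order_refl] by (auto simp: E_def pi_over_def)
      have E: "subgroup E G"
      proof (rule subgroupI)
        show "E \<subseteq> carrier G" using subgroup.subset[OF C] by (auto simp: E_def)
        show "E \<noteq> {}" using TE subgroup.one_closed[OF sT(1)] by auto
        fix c assume "c \<in> E"
        then obtain m where c: "c \<in> C" "pi_number (\<sigma> j) m" "c [^] m \<in> T" by (auto simp: E_def)
        have "inv c [^] m \<in> T"
          using iT[OF c(3)] subgroup.mem_carrier[OF C c(1)] by (simp add: nat_pow_inv)
        then show "inv c \<in> E" using c subgroup.m_inv_closed[OF C] by (auto simp: E_def)
        fix d assume "d \<in> E"
        then obtain l where d: "d \<in> C" "pi_number (\<sigma> j) l" "d [^] l \<in> T" by (auto simp: E_def)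
        have "\<exists>k. pi_number (\<sigma> j) k \<and> (c \<otimes> d) [^] k \<in> T"
          by (rule pi_elements_mult_closed[OF fin T_Y Y _ CY YT c d]) (simp add: C_def Y_def)
        then show "c \<otimes> d \<in> E" using subgroup.m_closed[OF C c(1) d(1)] by (simp add: E_def)
      qed
      have "normalizes H E"
        unfolding normalizes_def
      proof (intro ballI)
        fix h c assume h: "h \<in> H" and "c \<in> E"
        then obtain m where c: "c \<in> C" "pi_number (\<sigma> j) m" "c [^] m \<in> T" by (auto simp: E_def)
        have "conj_by h c [^] m = conj_by h (c [^] m)"
          using carH[OF h] subgroup.mem_carrier[OF C c(1)] by (simp add: conj_by_pow)
        then have "conj_by h c [^] m \<in> T" using cT[OF h c(3)] by simp
        then show "conj_by h c \<in> E" using c(2) normalizesD[OF HC h c(1)] by (auto simp: E_def)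
      qed
      then have "normal_in E H" using E ss(2) CH by (auto simp: normal_in_def E_def)
      moreover have "pi_over (\<sigma> j) E T" by (auto simp: pi_over_def E_def)
      then have "pi_over (\<sigma> j) E V" by (rule pi_over_trans[OF _ T(3) subgroup.subset[OF E]])
      ultimately have "E \<subseteq> rad (\<sigma> j) V H" using TE T(2) by (intro rad_greatest) auto
      then show ?thesis using WE by (simp add: W_def)
    qed
  qed
qed

text \<open>The second fact: \<open>A\<close> is its own radical over \<open>V\<close>, and
  \<open>rad_sn_step\<close> carries the inclusion up one step at a time.\<close>

lemma sn_subset_rad:
  assumes "sn A H" and j: "j \<in> I" and "normal_in V H" and VA: "V \<subseteq> A" and o: "pi_over (\<sigma> j) A V"
  shows "A \<subseteq> rad (\<sigma> j) V H"
  using assms(1,3)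
proof (induction rule: sn_induct_top)
  case refl
  then show ?case
    by (intro rad_greatest[OF normal_in_refl VA o]) (simp add: normal_in_def)
next
  case (step X H)
  note ss = sn_step_subgroup[OF step.hyps(2)] and sA = sn_subgroup[OF step.hyps(1)]
  have VX: "V \<subseteq> X" using VA sA(3) by simp
  have "A \<subseteq> rad (\<sigma> j) V X" using step.IH normal_in_mono[OF step.prems ss(1) VX ss(3)] by blast
  also have "\<dots> \<subseteq> rad (\<sigma> j) V H" by (rule rad_sn_step[OF step.hyps(2) step.prems VX j])
  finally show ?case .
qed

section \<open>Products with one factor normalizing the other\<close>

text \<open>Induction on the order of \<open>M\<close>. The subgroup \<open>?M1\<close> delivered by
  \<open>sn_proper_cases\<close> is normalized by \<open>B\<close>, because \<open>M\<close> and
  \<open>A\<close> are; the chain then goes from \<open>A <#> B\<close> to \<open>?M1 <#> B\<close>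
  by recursion, and on to \<open>M <#> B\<close> by a direct argument.\<close>

lemma sn_set_mult_in_product:
  assumes "sn A M" "subgroup B G" "normalizes B M" "normalizes B A" "sn B (M <#> B)"
  shows "sn (A <#> B) (M <#> B)"
  using assms
proof (induction "card M" arbitrary: M rule: less_induct)
  case less
  note B = less.prems(2) and nM = less.prems(3) and nA = less.prems(4)
  note sA = sn_subgroup[OF less.prems(1)]
  have MB: "subgroup (M <#> B) G" by (rule subgroup_set_mult[OF sA(2) B nM])
  note Mc = subgroup.subset[OF sA(2)] and Bc = subgroup.subset[OF B]
  have finM: "finite M" by (rule finite_subset[OF Mc fin])
  have recurse: "sn (A <#> B) (M1 <#> B)"
    if M1: "subgroup M1 G" "normalizes B M1" "A \<subseteq> M1" "M1 \<subseteq> M" "M1 \<noteq> M" for M1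
  proof (rule less.hyps)
    show "card M1 < card M" using M1(4,5) finM by (simp add: psubset_card_mono psubset_eq)
    show "sn A M1" by (rule sn_Int_sub[OF less.prems(1) M1(1,3,4)])
    have "M1 <#> B \<subseteq> M <#> B" using M1(4) by (auto simp: set_mult_def)
    then show "sn B (M1 <#> B)"
      by (intro sn_Int_sub[OF less.prems(5)] subgroup_set_mult M1 B set_mult_incl(2)[OF M1(1) B])
  qed (use B nA M1 in auto)
  show ?case
  proof (cases "A = M")
    case True
    then show ?thesis using MB by (simp add: sn_refl)
  next
    case False
    with less.prems(1) show ?thesis
    proof (cases rule: sn_proper_cases)
      case nclosure
      let ?M1 = "nclosure A M"
      note n1 = nclosure_normal_in[OF sA(2,3)]
      note s1 = normal_in_subgroup[OF n1(1)]
      have nB: "normalizes B ?M1" by (rule normalizes_nclosure[OF sA(2,3) Bc nA nM])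
      have "normalizes (M <#> B) ?M1"
        by (rule normalizes_by_set_mult[OF s1(4) nB Mc Bc subgroup.subset[OF s1(1)]])
      then have "normal_in ?M1 (M <#> B)"
        using MB s1(1,3) set_mult_incl(1)[OF sA(2) B] by (simp add: normal_in_def)
      then have "sn (?M1 <#> B) (M <#> B)" by (rule sn_set_mult_normal[OF less.prems(5)])
      with recurse[OF s1(1) nB n1(2) s1(3) nclosure] show ?thesis by (rule sn_trans)
    next
      case (residual j)
      let ?O = "residual (\<sigma> j) M"
      note nO = residual_normal_in[OF sA(2), of "\<sigma> j"]
      note sO = normal_in_subgroup[OF nO]
      let ?M1 = "?O <#> A"
      have M1: "subgroup ?M1 G"
        by (rule subgroup_set_mult[OF sO(1) sA(1) normalizes_subset[OF sO(4) sA(3)]])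
      have nBO: "normalizes B ?O" by (rule normalizes_residual[OF Mc Bc nM])
      have nB: "normalizes B ?M1" by (rule normalizes_set_mult[OF sO(1) sA(1) Bc nBO nA])
      have M1M: "?M1 \<subseteq> M" by (rule set_mult_least[OF sA(2) sO(3) sA(3)])
      have "normalizes (M <#> B) ?O"
        by (rule normalizes_by_set_mult[OF sO(4) nBO Mc Bc subgroup.subset[OF sO(1)]])
      then have O: "normal_in ?O (M <#> B)"
        using MB sO(1,3) set_mult_incl(1)[OF sA(2) B] by (simp add: normal_in_def)
      have OB: "subgroup (?O <#> B) G" by (rule subgroup_set_mult[OF sO(1) B nBO])
      have M: "normal_in M (M <#> B)"
        using MB sA(2) set_mult_incl(1)[OF sA(2) B]
          normalizes_by_set_mult[OF normalizes_self[OF sA(2)] nM Mc Bc Mc]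
        by (simp add: normal_in_def)
      have eq: "M <#> B = M <#> (?O <#> B)"
        by (rule set_mult_absorb[OF sA(2) sO(1) B sO(3), symmetric])
      \<comment> \<open>The first fact with \<open>P = M\<close> and \<open>V = ?O\<close>: modulo
        \<open>?O\<close>, the normal factor \<open>M\<close> is a \<sigma> j-group.\<close>
      have "residual (\<sigma> j) (M <#> B) \<subseteq> ?O <#> B"
        by (rule residual_subset_sn[OF sn_set_mult_normal[OF less.prems(5) O] residual(1) M
              set_mult_incl(1)[OF sO(1) B] residual_pi_over[OF fin sA(2)] eq])
      also have "\<dots> \<subseteq> ?M1 <#> B"
        by (rule mono_set_mult[OF set_mult_incl(1)[OF sO(1) sA(1)] order_refl])
      finally have "sn (?M1 <#> B) (M <#> B)"
        by (intro residual_sn[OF residual(1)] subgroup_set_mult[OF M1 B nB] MB)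
          (rule mono_set_mult[OF M1M order_refl])
      with recurse[OF M1 nB set_mult_incl(2)[OF sO(1) sA(1)] M1M residual(2)]
      show ?thesis by (rule sn_trans)
    qed
  qed
qed

lemma sn_set_mult:
  assumes A: "sn A H" and B: "sn B H" and n: "normalizes B A"
  shows "sn (A <#> B) H"
proof -
  note sA = sn_subgroup[OF A] and sB = sn_subgroup[OF B]
  have "H <#> B = H"
    using set_mult_least[OF sA(2) order_refl sB(3)] set_mult_incl(1)[OF sA(2) sB(1)] by blast
  moreover have "normalizes B H" by (rule normalizes_subset[OF normalizes_self[OF sA(2)] sB(3)])
  ultimately show ?thesis using sn_set_mult_in_product[OF A sB(1) _ n] B by simp
qed

section \<open>Joins of \<sigma>-subnormal subgroups\<close>

definition join_closed :: "'a set \<Rightarrow> bool" where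
  "join_closed H \<longleftrightarrow> (\<forall>A B. sn A H \<longrightarrow> sn B H \<longrightarrow> sn (generate G (A \<union> B)) H)"

lemma generate_join:
  assumes "subgroup A G" "subgroup B G"
  shows "subgroup (generate G (A \<union> B)) G" "A \<subseteq> generate G (A \<union> B)" "B \<subseteq> generate G (A \<union> B)"
  using assms[THEN subgroup.subset] by (auto intro: generate_is_subgroup generate.incl)

lemma sn_generate_Union:
  assumes "join_closed H" "subgroup H G" "finite S" "\<And>X. X \<in> S \<Longrightarrow> sn X H"
  shows "sn (generate G (\<Union>S)) H"
  using assms(3,4)
proof (induction S rule: finite_induct)
  case empty
  have "normal_in {\<one>} H"
    using assms(2) subgroup.one_closed[OF assms(2)] subgroup.mem_carrier[OF assms(2)]
    by (simp add: normal_in_def triv_subgroup normalizes_def)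
  then show ?case using normal_in_sn generate_empty by simp
next
  case (insert X S)
  then have X: "sn X H" and S: "sn (generate G (\<Union>S)) H" by auto
  let ?D = "generate G (X \<union> generate G (\<Union>S))"
  have D: "sn ?D H" using assms(1) X S by (simp add: join_closed_def)
  note gj = generate_join[OF sn_subgroup(1)[OF X] sn_subgroup(1)[OF S]]
  have SS: "\<Union>S \<subseteq> generate G (\<Union>S)" by (blast intro: generate.incl)
  have cS: "\<Union>(insert X S) \<subseteq> carrier G"
    using insert.prems sn_subgroup(1) subgroup.subset by blast
  have "generate G (\<Union>(insert X S)) = ?D"
  proof
    show "generate G (\<Union>(insert X S)) \<subseteq> ?D"
      using gj SS by (intro generate_subgroup_incl) auto
    have "generate G (\<Union>S) \<subseteq> generate G (\<Union>(insert X S))" by (rule mono_generate) auto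
    then show "?D \<subseteq> generate G (\<Union>(insert X S))"
      by (intro generate_subgroup_incl generate_is_subgroup[OF cS]) (auto intro: generate.incl)
  qed
  then show ?case using D by simp
qed

text \<open>\<open>J\<close> normalizes \<open>L\<close>, so all \<open>J\<close>-conjugates of
  \<open>X\<close> are again \<sigma>-subnormal in \<open>L\<close>, and there are finitely many of
  them to join.\<close>

lemma sn_nclosure:
  assumes jc: "join_closed L" and L: "normal_in L H" and J: "subgroup J G" "J \<subseteq> H" and X: "sn X L"
  shows "sn (nclosure X J) L"
  unfolding nclosure_def
proof (rule sn_generate_Union[OF jc normal_in_subgroup(1)[OF L]])
  show "finite ((\<lambda>h. conj_by h ` X) ` J)"
    using finite_subset[OF subgroup.subset[OF J(1)] fin] by simp
  fix Y assume "Y \<in> (\<lambda>h. conj_by h ` X) ` J"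
  then obtain h where h: "h \<in> J" "Y = conj_by h ` X" by auto
  have "conj_by h ` L = L"
    by (rule conj_image_eq[OF J(1) normalizes_subset[OF normal_in_subgroup(4)[OF L] J(2)] h(1)
          subgroup.subset[OF normal_in_subgroup(1)[OF L]]])
  then show "sn Y L" using sn_conj[OF X subgroup.mem_carrier[OF J(1) h(1)]] h(2) by simp
qed

lemma sn_join_in_proper:
  assumes jc: "join_closed M" and M: "sn M H" and A: "sn A H" and B: "sn B H"
    and J: "generate G (A \<union> B) \<subseteq> M"
  shows "sn (generate G (A \<union> B)) H"
proof -
  note sM = sn_subgroup[OF M]
  note gj = generate_join[OF sn_subgroup(1)[OF A] sn_subgroup(1)[OF B]]
  have "sn A M" "sn B M"
    using gj J by (auto intro!: sn_Int_sub[OF A sM(1)] sn_Int_sub[OF B sM(1)] sM(3)[THEN subsetD])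
  then have "sn (generate G (A \<union> B)) M" using jc by (simp add: join_closed_def)
  then show ?thesis using M by (rule sn_trans)
qed

lemma sn_join_nclosure:
  assumes IH: "\<And>L. subgroup L G \<Longrightarrow> L \<subset> H \<Longrightarrow> join_closed L"
    and A: "sn A H" and B: "sn B H" and ne: "nclosure A H \<noteq> H"
  shows "sn (generate G (A \<union> B)) H"
proof -
  note sA = sn_subgroup[OF A] and sB = sn_subgroup[OF B]
  define J where "J = generate G (A \<union> B)"
  note gj = generate_join[OF sA(1) sB(1), folded J_def]
  have JH: "J \<subseteq> H" unfolding J_def using sA sB by (intro generate_subgroup_incl) auto
  note M = nclosure_normal_in[OF sA(2,3)]
  note sM = normal_in_subgroup[OF M(1)]
  have "sn A (nclosure A H)" by (rule sn_Int_sub[OF A sM(1) M(2) sM(3)])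
  then have "sn (nclosure A J) (nclosure A H)"
    using IH[OF sM(1)] sM(3) ne by (intro sn_nclosure[OF _ M(1) gj(1) JH]) auto
  then have 1: "sn (nclosure A J) H" using normal_in_sn[OF M(1)] by (rule sn_trans)
  note N = nclosure_normal_in[OF gj(1,2)]
  note sN = normal_in_subgroup[OF N(1)]
  have nB: "normalizes B (nclosure A J)" by (rule normalizes_subset[OF sN(4) gj(3)])
  have sub: "subgroup (nclosure A J <#> B) G" by (rule subgroup_set_mult[OF sN(1) sB(1) nB])
  have "J = nclosure A J <#> B"
  proof
    show "nclosure A J <#> B \<subseteq> J" by (rule set_mult_least[OF gj(1) sN(3) gj(3)])
    show "J \<subseteq> nclosure A J <#> B" unfolding J_def
      using set_mult_incl[OF sN(1) sB(1)] N(2)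
      by (intro generate_subgroup_incl[OF _ sub[unfolded J_def]]) (auto simp: J_def)
  qed
  then show ?thesis using sn_set_mult[OF 1 B nB] by (simp add: J_def)
qed

text \<open>Here \<open>J\<close> is an extension of \<open>R = residual (\<sigma> j) J\<close> by a \<open>\<sigma> j\<close>-group. Either \<open>J\<close> lies in a proper
  \<open>\<sigma>\<close>-subnormal subgroup, or the normal closure \<open>V\<close> of \<open>R\<close> satisfies \<open>H = VJ\<close>. In the second case
  \<open>R\<close> lies in a proper subgroup \<open>RZ\<close> of \<open>V\<close> with \<open>V/Z\<close> a \<open>\<sigma> i\<close>-group and \<open>i \<noteq> j\<close>, and \<open>ZJ\<close> is the
  product of \<open>R\<close> and a normal subgroup of \<open>H\<close>.\<close>

lemma sn_join_pi_extension:
  assumes IH: "\<And>L. subgroup L G \<Longrightarrow> L \<subset> H \<Longrightarrow> join_closed L"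
    and A: "sn A H" and B: "sn B H" and j: "j \<in> I" and J_def: "J = generate G (A \<union> B)"
    and OA: "residual (\<sigma> j) J \<subseteq> A" and OB: "residual (\<sigma> j) J \<subseteq> B"
    and nA: "nclosure A H = H" and LH: "residual (\<sigma> j) H \<noteq> H"
  shows "sn J H"
proof -
  note sA = sn_subgroup[OF A] and sB = sn_subgroup[OF B]
  have H: "subgroup H G" by (rule sA)
  note Hc = subgroup.subset[OF H]
  note gj = generate_join[OF sA(1) sB(1), folded J_def]
  have JH: "J \<subseteq> H" unfolding J_def using sA sB by (intro generate_subgroup_incl) auto
  have J_least: "J \<subseteq> S" if "subgroup S G" "A \<subseteq> S" "B \<subseteq> S" for S
    unfolding J_def using that by (intro generate_subgroup_incl) auto
  \<comment> \<open>A proper \<sigma>-subnormal subgroup above \<open>J\<close> settles the claim by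
    induction; the rest of the proof finds one or shows \<open>J = H\<close>.\<close>
  have red: "sn J H" if "sn M H" "J \<subseteq> M" "M \<noteq> H" for M
    using sn_join_in_proper[OF IH[OF sn_subgroup(1)[OF that(1)]] that(1) A B] that sn_subgroup(3)[OF that(1)]
    by (auto simp: J_def)
  define R where "R = residual (\<sigma> j) J"
  have R: "normal_in R J" unfolding R_def by (rule residual_normal_in[OF gj(1)])
  note sR = normal_in_subgroup[OF R]
  have JR: "pi_over (\<sigma> j) J R" unfolding R_def by (rule residual_pi_over[OF fin gj(1)])
  have "normal_in R A" by (rule normal_in_mono[OF R sA(1) OA[folded R_def] gj(2)])
  then have R_sn: "sn R H" using A normal_in_sn sn_trans by blast
  define L where "L = residual (\<sigma> j) H"
  have L: "normal_in L H" unfolding L_def by (rule residual_normal_in[OF H])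
  note sL = normal_in_subgroup[OF L]
  have RH: "R \<subseteq> H" using sR(3) JH by blast
  have RL: "R \<subseteq> L" unfolding R_def L_def by (rule residual_mono[OF JH Hc])
  define V where "V = nclosure R H"
  have V: "normal_in V H" and RV: "R \<subseteq> V"
    unfolding V_def by (rule nclosure_normal_in[OF H RH])+
  note sV = normal_in_subgroup[OF V]
  note Vc = subgroup.subset[OF sV(1)] and Jc = subgroup.subset[OF gj(1)]
  have nXV: "normalizes X V" if "X \<subseteq> H" for X by (rule normalizes_subset[OF sV(4) that])
  have nJV: "normalizes J V" by (rule nXV[OF JH])
  have VL: "V \<subseteq> L" unfolding V_def by (rule nclosure_least[OF sL(1,4) RL])
  \<comment> \<open>\<open>A\<close> is a \<sigma> j-group modulo \<open>V\<close>, so the second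
    fact puts it into the radical over \<open>V\<close>. That is normal in \<open>H\<close>, hence
    contains the normal closure of \<open>A\<close>, which is \<open>H\<close>.\<close>
  have HV: "pi_over (\<sigma> j) H V"
  proof -
    have "pi_over (\<sigma> j) A V" by (rule pi_over_mono[OF JR gj(2) RV order_refl])
    then have "pi_over (\<sigma> j) (V <#> A) V"
      by (rule pi_over_set_mult[OF sV(1) sA(1) nXV[OF sA(3)] _ order_refl])
    then have "V <#> A \<subseteq> rad (\<sigma> j) V H"
      by (rule sn_subset_rad[OF sn_set_mult_normal[OF A V] j V set_mult_incl(1)[OF sV(1) sA(1)]])
    then have "A \<subseteq> rad (\<sigma> j) V H" using set_mult_incl(2)[OF sV(1) sA(1)] by blast
    then have "H \<subseteq> rad (\<sigma> j) V H"
      using nclosure_least[of "rad (\<sigma> j) V H" H A] normal_in_subgroup[OF rad_normal_in(1)[OF V]] nA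
      by blast
    then show ?thesis by (rule pi_over_mono[OF rad_pi_over _ order_refl order_refl])
  qed
  have "L \<subseteq> V" unfolding L_def by (rule residual_least[OF sV(1) HV Hc])
  then have V_eq: "V = residual (\<sigma> j) H" using VL by (simp add: L_def)
  \<comment> \<open>\<open>V\<close> has no proper \<sigma> j-quotient; this forces
    \<open>i \<noteq> j\<close> below.\<close>
  have resV: "residual (\<sigma> j) V = V"
    using residual_eqI[OF sV(1) H _ sV(3), of "\<sigma> j"] V_eq by simp
  have VJ: "subgroup (V <#> J) G" by (rule subgroup_set_mult[OF sV(1) gj(1) nJV])
  have "residual (\<sigma> j) H \<subseteq> V <#> J" using set_mult_incl(1)[OF sV(1) gj(1)] V_eq by simp
  then have "sn (V <#> J) H"
    by (rule residual_sn[OF j VJ H set_mult_least[OF H sV(3) JH]])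
  then have "V <#> J \<noteq> H \<Longrightarrow> sn J H" using set_mult_incl(2)[OF sV(1) gj(1)] by (rule red)
  moreover have "sn J H" if VJH: "V <#> J = H"
  proof (cases "R = V")
    case True
    then have "H \<subseteq> J" using VJH set_mult_least[OF gj(1) _ order_refl, of V] sR(3) by simp
    then show ?thesis using JH sn_refl[OF H] by simp
  next
    case False
    \<comment> \<open>Excludes the first alternative of \<open>sn_proper_cases\<close> for
      \<open>R\<close> in \<open>V\<close>: since \<open>H = V <#> J\<close> and \<open>J\<close>
      normalizes \<open>R\<close>, conjugates under \<open>V\<close> already generate the normal
      closure in \<open>H\<close>.\<close>
    have "V \<subseteq> nclosure R V"
    proof -
      note n = nclosure_normal_in[OF sV(1) RV]
      note s = normal_in_subgroup[OF n(1)]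
      have "normalizes J (nclosure R V)"
        by (rule normalizes_nclosure[OF sV(1) RV Jc sR(4) nJV])
      then have "normalizes H (nclosure R V)"
        using normalizes_by_set_mult[OF s(4) _ Vc Jc subgroup.subset[OF s(1)]] VJH by simp
      then show ?thesis using nclosure_least[OF s(1) _ n(2), of H, folded V_def] by blast
    qed
    then have nc: "nclosure R V = V"
      using normal_in_subgroup(3)[OF nclosure_normal_in(1)[OF sV(1) RV]] by blast
    have R_V: "sn R V" by (rule sn_Int_sub[OF R_sn sV(1) RV sV(3)])
    obtain i where i: "i \<in> I" "residual (\<sigma> i) V <#> R \<noteq> V"
      using R_V False by (cases rule: sn_proper_cases) (use nc in auto)
    define Z where "Z = residual (\<sigma> i) V"
    note Z_V = residual_normal_in[OF sV(1), of "\<sigma> i", folded Z_def]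
    note sZ = normal_in_subgroup[OF Z_V]
    have VZ: "pi_over (\<sigma> i) V Z" unfolding Z_def by (rule residual_pi_over[OF fin sV(1)])
    have "normalizes H Z" unfolding Z_def by (rule normalizes_residual[OF Vc Hc sV(4)])
    then have Z: "normal_in Z H" using sZ sV H by (auto simp: normal_in_def)
    have nJZ: "normalizes J Z" by (rule normalizes_subset[OF normal_in_subgroup(4)[OF Z] JH])
    have ij: "\<sigma> i \<inter> \<sigma> j = {}"
    proof (rule sigma_disjoint[OF i(1) j])
      show "i \<noteq> j"
      proof
        assume "i = j"
        then have "residual (\<sigma> i) V <#> R = V"
          using resV set_mult_least[OF sV(1) order_refl RV] set_mult_incl(1)[OF sV(1) sR(1)] by auto
        then show False using i(2) by simp
      qed
    qed
    define ZJ where "ZJ = Z <#> J"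
    have ZJ: "subgroup ZJ G" unfolding ZJ_def by (rule subgroup_set_mult[OF sZ(1) gj(1) nJZ])
    have inc: "Z \<subseteq> ZJ" "J \<subseteq> ZJ" unfolding ZJ_def by (rule set_mult_incl[OF sZ(1) gj(1)])+
    \<comment> \<open>A part of \<open>Z <#> X\<close>, by the first fact, that \<open>V\<close>
      normalizes although \<open>V\<close> need not normalize \<open>Z <#> X\<close>;
      \<open>X\<close> is a \<sigma> i-group over it.\<close>
    define res where "res X = residual (\<sigma> i) (V <#> X)" for X
    have res: "res X \<subseteq> Z <#> X" "normalizes V (res X)" "res X \<subseteq> H" "pi_over (\<sigma> i) X (res X)"
      if X: "sn X H" for X
    proof -
      note sX = sn_subgroup[OF X]
      have nXZ: "normalizes X Z" by (rule normalizes_subset[OF normal_in_subgroup(4)[OF Z] sX(3)])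
      have VX: "subgroup (V <#> X) G" by (rule subgroup_set_mult[OF sV(1) sX(1) nXV[OF sX(3)]])
      have VXH: "V <#> X \<subseteq> H" by (rule set_mult_least[OF H sV(3) sX(3)])
      have V_VX: "normal_in V (V <#> X)"
        by (rule normal_in_mono[OF V VX set_mult_incl(1)[OF sV(1) sX(1)] VXH])
      have "sn (Z <#> X) (V <#> X)"
        by (rule sn_Int_sub[OF sn_set_mult_normal[OF X Z] VX mono_set_mult[OF sZ(3) order_refl] VXH])
      then show "res X \<subseteq> Z <#> X" unfolding res_def
        by (rule residual_subset_sn[OF _ i(1) V_VX set_mult_incl(1)[OF sZ(1) sX(1)] VZ
              set_mult_absorb[OF sV(1) sZ(1) sX(1) sZ(3), symmetric]])
      have n: "normal_in (res X) (V <#> X)" unfolding res_def by (rule residual_normal_in[OF VX])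
      show "normalizes V (res X)"
        by (rule normalizes_subset[OF normal_in_subgroup(4)[OF n] set_mult_incl(1)[OF sV(1) sX(1)]])
      show "res X \<subseteq> H" using normal_in_subgroup(3)[OF n] VXH by simp
      show "pi_over (\<sigma> i) X (res X)" unfolding res_def
        by (rule pi_over_mono[OF residual_pi_over[OF fin VX] set_mult_incl(2)[OF sV(1) sX(1)]
              order_refl order_refl])
    qed
    define E where "E = nclosure (res A \<union> res B) H"
    have E: "normal_in E H" and resE: "res A \<union> res B \<subseteq> E"
      unfolding E_def using nclosure_normal_in[OF H, of "res A \<union> res B"] res(3)[OF A] res(3)[OF B] by auto
    note sE = normal_in_subgroup[OF E]
    have resZJ: "e \<in> ZJ" if "e \<in> res A \<union> res B" for e
      using that res(1)[OF A] res(1)[OF B] mono_set_mult[OF order_refl[of Z] gj(2), of G]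
        mono_set_mult[OF order_refl[of Z] gj(3), of G] by (auto simp: ZJ_def)
    \<comment> \<open>Write \<open>h\<close> as an element of \<open>J\<close> times an element of
      \<open>V\<close>: the latter keeps \<open>res A\<close> and \<open>res B\<close> in place, and
      the former acts inside \<open>ZJ\<close>.\<close>
    have "E \<subseteq> ZJ" unfolding E_def nclosure_def
    proof (intro generate_subgroup_incl[OF _ ZJ] UN_least image_subsetI)
      fix h e assume "h \<in> H" and e: "e \<in> res A \<union> res B"
      then have "h \<in> V <#> J" using VJH by simp
      then obtain v x where vx: "v \<in> V" "x \<in> J" "h = v \<otimes> x" by (rule set_mult_memE)
      note c = subgroup.mem_carrier[OF sV(1) vx(1)] subgroup.mem_carrier[OF gj(1) vx(2)]
      have ec: "e \<in> carrier G" using e res(3)[OF A] res(3)[OF B] Hc by blast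
      define v' where "v' = conj_by (inv x) v"
      have v': "v' \<in> V" unfolding v'_def
        by (rule normalizesD[OF nJV subgroup.m_inv_closed[OF gj(1) vx(2)] vx(1)])
      note c' = subgroup.mem_carrier[OF sV(1) v']
      have "h = x \<otimes> v'" using c vx(3) by (simp add: v'_def conj_by_def m_assoc)
      then have "conj_by h e = conj_by x (conj_by v' e)" using c c' ec by (simp add: conj_by_conj_by)
      moreover have "conj_by v' e \<in> res A \<union> res B"
        using normalizesD[OF res(2)[OF A] v'] normalizesD[OF res(2)[OF B] v'] e by blast
      ultimately show "conj_by h e \<in> ZJ"
        using subgroup_conj_mem[OF ZJ] resZJ inc(2) vx(2) by auto
    qed
    have nRE: "normalizes R E" by (rule normalizes_subset[OF sE(4) RH])
    have ER: "subgroup (E <#> R) G" by (rule subgroup_set_mult[OF sE(1) sR(1) nRE])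
    \<comment> \<open>Elements of \<open>X\<close> have powers in \<open>E\<close> with \<sigma>
      i-number exponents and powers in \<open>R\<close> with \<sigma> j-number exponents.\<close>
    have X_ER: "X \<subseteq> E <#> R" if X: "sn X H" "X \<subseteq> J" "res X \<subseteq> E" for X
    proof
      fix x assume x: "x \<in> X"
      show "x \<in> E <#> R"
      proof (rule pi_over_coprime_mem[OF ER x subgroup.subset[OF sn_subgroup(1)[OF X(1)]] _ _ ij])
        show "pi_over (\<sigma> i) X (E <#> R)"
          by (rule pi_over_mono[OF res(4)[OF X(1)] order_refl _ order_refl])
            (use X(3) set_mult_incl(1)[OF sE(1) sR(1)] in blast)
        show "pi_over (\<sigma> j) X (E <#> R)"
          by (rule pi_over_mono[OF JR X(2) set_mult_incl(2)[OF sE(1) sR(1)] order_refl])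
      qed
    qed
    have J_ER: "J \<subseteq> E <#> R"
      using resE by (intro J_least[OF ER] X_ER A B gj(2,3)) auto
    have ZE: "normal_in (Z <#> E) H" by (rule normal_in_set_mult[OF Z E])
    note sZE = normal_in_subgroup[OF ZE]
    have nR: "normalizes R (Z <#> E)" by (rule normalizes_subset[OF sZE(4) RH])
    have ZER: "subgroup (Z <#> E <#> R) G" by (rule subgroup_set_mult[OF sZE(1) sR(1) nR])
    have "ZJ = Z <#> E <#> R"
    proof
      have "Z \<subseteq> Z <#> E <#> R"
        using set_mult_incl(1)[OF sZ(1) sE(1)] set_mult_incl(1)[OF sZE(1) sR(1)] by blast
      moreover have "E <#> R \<subseteq> Z <#> E <#> R"
        by (rule mono_set_mult[OF set_mult_incl(2)[OF sZ(1) sE(1)] order_refl])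
      ultimately show "ZJ \<subseteq> Z <#> E <#> R"
        unfolding ZJ_def using J_ER by (intro set_mult_least[OF ZER]) auto
      show "Z <#> E <#> R \<subseteq> ZJ"
        using inc \<open>E \<subseteq> ZJ\<close> sR(3) by (intro set_mult_least[OF ZJ]) auto
    qed
    then have "sn ZJ H" using sn_set_mult_normal[OF R_sn ZE] by simp
    \<comment> \<open>Otherwise \<open>V\<close> would be both a \<sigma> i-group and a \<sigma>
      j-group over \<open>Z <#> R\<close>, so \<open>V = Z <#> R\<close> against the choice of
      \<open>i\<close>.\<close>
    moreover have "ZJ \<noteq> H"
    proof
      assume eq: "ZJ = H"
      have nRZ: "normalizes R Z" by (rule normalizes_subset[OF nJZ sR(3)])
      have ZR: "subgroup (Z <#> R) G" by (rule subgroup_set_mult[OF sZ(1) sR(1) nRZ])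
      have "V \<subseteq> Z <#> R"
      proof
        fix v assume v: "v \<in> V"
        show "v \<in> Z <#> R"
        proof (rule pi_over_coprime_mem[OF ZR v Vc _ _ ij])
          show "pi_over (\<sigma> i) V (Z <#> R)"
            by (rule pi_over_mono[OF VZ order_refl set_mult_incl(1)[OF sZ(1) sR(1)] order_refl])
          have "V \<subseteq> Z <#> J" using eq sV(3) by (simp add: ZJ_def)
          then show "pi_over (\<sigma> j) V (Z <#> R)"
            by (rule pi_over_mono[OF pi_over_product[OF sZ(1) gj(1) nJZ JR] _ order_refl order_refl])
        qed
      qed
      then show False
        using i(2) set_mult_least[OF sV(1) sZ(3) RV] by (simp add: Z_def)
    qed
    ultimately show ?thesis using inc(2) by (intro red[of ZJ])
  qed
  ultimately show ?thesis by blast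
qed

lemma join_closed:
  assumes "subgroup H G" shows "join_closed H"
  using assms
proof (induction "card H" arbitrary: H rule: less_induct)
  case less
  have finH: "finite H" by (rule finite_subset[OF subgroup.subset[OF less.prems] fin])
  have IH: "join_closed L" if "subgroup L G" "L \<subset> H" for L
    using less.hyps[OF psubset_card_mono[OF finH that(2)] that(1)] .
  note H = less.prems
  note Hc = subgroup.subset[OF H]
  show ?case unfolding join_closed_def
  proof (intro allI impI)
    fix A B assume A: "sn A H" and B: "sn B H"
    note sA = sn_subgroup[OF A] and sB = sn_subgroup[OF B]
    define J where "J = generate G (A \<union> B)"
    note gj = generate_join[OF sA(1) sB(1), folded J_def]
    have JH: "J \<subseteq> H" unfolding J_def using sA sB by (intro generate_subgroup_incl) auto
    have J_least: "J \<subseteq> S" if "subgroup S G" "A \<subseteq> S" "B \<subseteq> S" for S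
      unfolding J_def using that by (intro generate_subgroup_incl) auto
    \<comment> \<open>Only the last case is hard: both subgroups are proper with normal closure
      \<open>H\<close>, so \<open>sn_proper_cases\<close> leaves its residual alternative for
      each.\<close>
    consider "nclosure A H \<noteq> H" | "nclosure B H \<noteq> H" | "A = H \<or> B = H"
      | j k where "A \<noteq> H" "B \<noteq> H" "nclosure A H = H" "nclosure B H = H"
        "j \<in> I" "residual (\<sigma> j) H <#> A \<noteq> H" "k \<in> I" "residual (\<sigma> k) H <#> B \<noteq> H"
      by (metis A B sn_proper_cases)
    then show "sn (generate G (A \<union> B)) H"
    proof cases
      case 1
      then show ?thesis by (intro sn_join_nclosure IH A B)
    next
      case 2
      then have "sn (generate G (B \<union> A)) H" by (intro sn_join_nclosure IH A B)
      then show ?thesis by (simp add: Un_commute)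
    next
      case 3
      then have "J = H" using gj JH by auto
      then show ?thesis using sn_refl[OF H] by (simp add: J_def)
    next
      case (4 j k)
      \<comment> \<open>The residual of \<open>H\<close> is a proper normal subgroup containing that
        of \<open>X\<close>, so the induction hypothesis covers the closure under \<open>J\<close>
        formed inside it.\<close>
      have res_closure: "sn (nclosure (residual (\<sigma> l) X) J) H"
          "normal_in (nclosure (residual (\<sigma> l) X) J) J"
          "residual (\<sigma> l) X \<subseteq> nclosure (residual (\<sigma> l) X) J" "residual (\<sigma> l) H \<noteq> H"
        if X: "sn X H" "X \<subseteq> J" and l: "l \<in> I" "residual (\<sigma> l) H <#> X \<noteq> H" for X l
      proof -
        note sX = sn_subgroup[OF X(1)]
        let ?L = "residual (\<sigma> l) H" and ?R = "residual (\<sigma> l) X"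
        have L: "normal_in ?L H" by (rule residual_normal_in[OF H])
        show ne: "?L \<noteq> H"
          using l(2) set_mult_least[OF H order_refl sX(3)] set_mult_incl(1)[OF H sX(1)] by auto
        have R: "normal_in ?R X" by (rule residual_normal_in[OF sX(1)])
        have "sn ?R ?L"
          by (rule sn_Int_sub[OF sn_trans[OF normal_in_sn[OF R] X(1)] normal_in_subgroup(1)[OF L]
                residual_mono[OF sX(3) Hc] normal_in_subgroup(3)[OF L]])
        then have "sn (nclosure ?R J) ?L"
          using ne normal_in_subgroup[OF L] by (intro sn_nclosure[OF IH L gj(1) JH]) auto
        then show "sn (nclosure ?R J) H" using normal_in_sn[OF L] by (rule sn_trans)
        have "?R \<subseteq> J" using normal_in_subgroup(3)[OF R] X(2) by simp
        then show "normal_in (nclosure ?R J) J" "?R \<subseteq> nclosure ?R J"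
          by (rule nclosure_normal_in[OF gj(1)])+
      qed
      define P where "P = nclosure (residual (\<sigma> j) A) J"
      define Q where "Q = nclosure (residual (\<sigma> k) B) J"
      note P = res_closure[OF A gj(2) 4(5,6), folded P_def]
      note Q = res_closure[OF B gj(3) 4(7,8), folded Q_def]
      note sP = normal_in_subgroup[OF P(2)] and sQ = normal_in_subgroup[OF Q(2)]
      \<comment> \<open>\<open>P\<close> and \<open>Q\<close> are normal in \<open>J\<close> and so
        normalize each other; their join is therefore a product of the kind already known to be
        \<sigma>-subnormal in \<open>H\<close>.\<close>
      define K where "K = P <#> Q"
      have K: "normal_in K J" unfolding K_def by (rule normal_in_set_mult[OF P(2) Q(2)])
      note sK = normal_in_subgroup[OF K]
      have "sn K H" unfolding K_def
        by (rule sn_set_mult[OF P(1) Q(1) normalizes_subset[OF sP(4) sQ(3)]])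
      have ext: "sn (K <#> X) H" "sn (K <#> X) J" "K <#> X \<subseteq> rad (\<sigma> l) K J" "X \<subseteq> K <#> X"
          "K \<subseteq> K <#> X"
        if X: "sn X H" "X \<subseteq> J" and l: "l \<in> I" "residual (\<sigma> l) X \<subseteq> K" for X l
      proof -
        note sX = sn_subgroup[OF X(1)]
        have nX: "normalizes X K" by (rule normalizes_subset[OF sK(4) X(2)])
        show 1: "sn (K <#> X) H" by (rule sn_set_mult[OF \<open>sn K H\<close> X(1) nX])
        show 2: "sn (K <#> X) J"
          by (rule sn_Int_sub[OF 1 gj(1) set_mult_least[OF gj(1) sK(3) X(2)] JH])
        show "X \<subseteq> K <#> X" "K \<subseteq> K <#> X" by (rule set_mult_incl[OF sK(1) sX(1)])+
        have "pi_over (\<sigma> l) X K"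
          by (rule pi_over_mono[OF residual_pi_over[OF fin sX(1)] order_refl l(2) order_refl])
        then have "pi_over (\<sigma> l) (K <#> X) K"
          by (rule pi_over_set_mult[OF sK(1) sX(1) nX _ order_refl])
        then show "K <#> X \<subseteq> rad (\<sigma> l) K J"
          by (rule sn_subset_rad[OF 2 l(1) K set_mult_incl(1)[OF sK(1) sX(1)]])
      qed
      have inK: "residual (\<sigma> j) A \<subseteq> K" "residual (\<sigma> k) B \<subseteq> K"
        using P(3) Q(3) set_mult_incl[OF sP(1) sQ(1)] by (auto simp: K_def)
      define A' where "A' = K <#> A"
      define B' where "B' = K <#> B"
      note A' = ext[OF A gj(2) 4(5) inK(1), folded A'_def]
      note B' = ext[OF B gj(3) 4(7) inK(2), folded B'_def]
      note sA' = sn_subgroup[OF A'(2)] and sB' = sn_subgroup[OF B'(2)]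
      have J_eq: "J = generate G (A' \<union> B')"
      proof
        show "J \<subseteq> generate G (A' \<union> B')"
          using generate_join[OF sA'(1) sB'(1)] A'(4) B'(4) by (intro J_least) auto
        show "generate G (A' \<union> B') \<subseteq> J"
          using sA'(3) sB'(3) by (intro generate_subgroup_incl[OF _ gj(1)]) auto
      qed
      have "sn J H"
      proof (cases "j = k")
        case False
        \<comment> \<open>For distinct classes, commutators of \<open>B'\<close> with
          \<open>A'\<close> lie in both radicals of \<open>J\<close> over \<open>K\<close>, hence in
          \<open>K\<close>, which \<open>A'\<close> contains.\<close>
        have "normalizes B' A'"
          unfolding normalizes_def
        proof (intro ballI)
          fix b a assume b: "b \<in> B'" and a: "a \<in> A'"
          note R1 = rad_normal_in[OF K, of "\<sigma> j"] and R2 = rad_normal_in[OF K, of "\<sigma> k"]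
          note s1 = normal_in_subgroup[OF R1(1)] and s2 = normal_in_subgroup[OF R2(1)]
          have aJ: "a \<in> J" and bJ: "b \<in> J" using a b sA'(3) sB'(3) by auto
          have a1: "a \<in> rad (\<sigma> j) K J" and b2: "b \<in> rad (\<sigma> k) K J" using a b A'(3) B'(3) by auto
          note c = subgroup.mem_carrier[OF gj(1) aJ] subgroup.mem_carrier[OF gj(1) bJ]
          define x where "x = conj_by b a \<otimes> inv a"
          have x1: "x \<in> rad (\<sigma> j) K J" unfolding x_def
            by (rule subgroup.m_closed[OF s1(1) normalizesD[OF s1(4) bJ a1] subgroup.m_inv_closed[OF s1(1) a1]])
          have "x = b \<otimes> conj_by a (inv b)" unfolding x_def using c by (simp add: conj_by_def m_assoc)
          then have x2: "x \<in> rad (\<sigma> k) K J"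
            using subgroup.m_closed[OF s2(1) b2 normalizesD[OF s2(4) aJ subgroup.m_inv_closed[OF s2(1) b2]]]
            by simp
          have "x \<in> K"
            using pi_over_coprime_mem[OF sK(1), of x "{x}" "\<sigma> j" "\<sigma> k"] x1 x2 c rad_pi_over
              sigma_disjoint[OF 4(5,7) False] by (auto simp: pi_over_def x_def)
          then have "x \<otimes> a \<in> A'" using A'(5) a by (intro subgroup.m_closed[OF sA'(1)]) auto
          then show "conj_by b a \<in> A'" unfolding x_def using c by (simp add: m_assoc)
        qed
        then have 1: "sn (A' <#> B') H" and 2: "subgroup (A' <#> B') G"
          by (auto intro: sn_set_mult A'(1) B'(1) subgroup_set_mult sA'(1) sB'(1))
        have "A' <#> B' = J"
          using set_mult_least[OF gj(1) sA'(3) sB'(3)] set_mult_incl[OF sA'(1) sB'(1)] A'(4) B'(4)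
          by (intro subset_antisym J_least[OF 2]) auto
        then show ?thesis using 1 by simp
      next
        case True
        have "J \<subseteq> rad (\<sigma> j) K J"
          using A'(3,4) B'(3,4) True
          by (intro J_least normal_in_subgroup(1)[OF rad_normal_in(1)[OF K]]) auto
        then have JK: "pi_over (\<sigma> j) J K" by (rule pi_over_mono[OF rad_pi_over _ order_refl order_refl])
        \<comment> \<open>The first fact inside \<open>J\<close> with \<open>P = J\<close>, as
          \<open>J/K\<close> is a \<sigma> j-group.\<close>
        have resJ: "residual (\<sigma> j) J \<subseteq> X" if "sn X J" "K \<subseteq> X" for X
        proof (rule residual_subset_sn[OF that(1) 4(5) normal_in_refl[OF gj(1)] that(2) JK])
          show "J = J <#> X"
            using set_mult_least[OF gj(1) order_refl sn_subgroup(3)[OF that(1)]]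
              set_mult_incl(1)[OF gj(1) sn_subgroup(1)[OF that(1)]] by blast
        qed
        have nc: "nclosure A' H = H"
        proof
          note n = nclosure_normal_in[OF H sn_subgroup(3)[OF A'(1)]]
          note s = normal_in_subgroup[OF n(1)]
          show "nclosure A' H \<subseteq> H" by (rule s)
          have "A \<subseteq> nclosure A' H" using A'(4) n(2) by simp
          then show "H \<subseteq> nclosure A' H" using nclosure_least[OF s(1,4)] 4(3) by metis
        qed
        show ?thesis
          by (rule sn_join_pi_extension[OF IH A'(1) B'(1) 4(5) J_eq resJ[OF A'(2,5)] resJ[OF B'(2,5)]
                nc P(4)])
      qed
      then show ?thesis by (simp add: J_def)
    qed
  qed
qed

lemma sn_join: "sn A H \<Longrightarrow> sn B H \<Longrightarrow> sn (generate G (A \<union> B)) H"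
  using join_closed sn_subgroup(2) unfolding join_closed_def by blast

section \<open>The upper \<sigma>-nilpotent series\<close>

lemma I_nonempty: "I \<noteq> {}"
proof -
  have "(2::nat) \<in> (\<Union>i\<in>I. \<sigma> i)" using partition by (simp add: prime_partition_def)
  then show ?thesis by blast
qed

text \<open>For \<open>X\<close> normal in \<open>H\<close>, the quotient
  \<open>sigma_rad X H / X\<close> is the \<sigma>-analogue of the Fitting subgroup of
  \<open>H/X\<close>.\<close>

definition sigma_rad :: "'a set \<Rightarrow> 'a set \<Rightarrow> 'a set" where
  "sigma_rad X H = generate G (\<Union>i\<in>I. rad (\<sigma> i) X H)"

lemma rad_subset_sigma_rad: "i \<in> I \<Longrightarrow> rad (\<sigma> i) X H \<subseteq> sigma_rad X H"
  unfolding sigma_rad_def by (blast intro: generate.incl)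

lemma rad_subset: "rad \<pi> X H \<subseteq> H"
  by (auto simp: rad_def normal_in_def)

lemma sigma_rad_least:
  "subgroup S G \<Longrightarrow> (\<And>i. i \<in> I \<Longrightarrow> rad (\<sigma> i) X H \<subseteq> S) \<Longrightarrow> sigma_rad X H \<subseteq> S"
  unfolding sigma_rad_def by (intro generate_subgroup_incl) auto

lemma sigma_rad_normal_in:
  assumes X: "normal_in X H"
  shows "normal_in (sigma_rad X H) H" "X \<subseteq> sigma_rad X H"
proof -
  have H: "subgroup H G" by (rule normal_in_subgroup[OF X])
  note Hc = subgroup.subset[OF H]
  let ?S = "\<Union>i\<in>I. rad (\<sigma> i) X H"
  have S: "?S \<subseteq> carrier G" using rad_subset Hc by blast
  have "conj_by h s \<in> generate G ?S" if hs: "h \<in> H" "s \<in> ?S" for h s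
  proof -
    obtain i where i: "i \<in> I" "s \<in> rad (\<sigma> i) X H" using hs by blast
    have "conj_by h s \<in> rad (\<sigma> i) X H"
      using normalizesD[OF normal_in_subgroup(4)[OF rad_normal_in(1)[OF X]] hs(1) i(2)] .
    then show ?thesis using i(1) by (intro generate.incl) auto
  qed
  then have "normalizes H (sigma_rad X H)"
    unfolding sigma_rad_def by (rule normalizes_generate[OF S Hc])
  then show "normal_in (sigma_rad X H) H"
    using H sigma_rad_least[OF H rad_subset] generate_is_subgroup[OF S]
    by (simp add: normal_in_def sigma_rad_def)
  show "X \<subseteq> sigma_rad X H"
    using I_nonempty rad_normal_in(2)[OF X] rad_subset_sigma_rad by blast
qed

text \<open>The classes are disjoint, so the radicals of all classes other than
  \<open>\<sigma> i\<close> fall into the radical for its complement.\<close>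

lemma sigma_rad_components:
  assumes X: "normal_in X H" and i: "i \<in> I"
  shows "sigma_rad X H \<subseteq> rad (\<sigma> i) X H <#> rad (- \<sigma> i) X H"
proof -
  note R = rad_normal_in[OF X, of "\<sigma> i"] and R' = rad_normal_in[OF X, of "- \<sigma> i"]
  note s = normal_in_subgroup[OF R(1)] and s' = normal_in_subgroup[OF R'(1)]
  have "rad (\<sigma> k) X H \<subseteq> rad (- \<sigma> i) X H" if "k \<in> I" "k \<noteq> i" for k
    unfolding rad_def using sigma_disjoint[OF that(1) i that(2)] pi_over_mono[OF _ order_refl order_refl, of "\<sigma> k" _ _ "- \<sigma> i"]
    by blast
  then have "rad (\<sigma> k) X H \<subseteq> rad (\<sigma> i) X H <#> rad (- \<sigma> i) X H" if "k \<in> I" for k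
    using that set_mult_incl[OF s(1) s'(1)] by (cases "k = i") auto
  then show ?thesis
    by (intro sigma_rad_least normal_in_subgroup(1)[OF normal_in_set_mult[OF R(1) R'(1)]])
qed

lemma sigma_rad_pi_over:
  assumes X: "normal_in X H" and i: "i \<in> I"
  shows "pi_over (- \<sigma> i) (sigma_rad X H) (rad (\<sigma> i) X H)"
proof -
  note R = rad_normal_in[OF X, of "\<sigma> i"] and R' = rad_normal_in[OF X, of "- \<sigma> i"]
  note s = normal_in_subgroup[OF R(1)] and s' = normal_in_subgroup[OF R'(1)]
  have "pi_over (- \<sigma> i) (rad (\<sigma> i) X H <#> rad (- \<sigma> i) X H) (rad (\<sigma> i) X H)"
    by (rule pi_over_set_mult[OF s(1) s'(1) normalizes_subset[OF s(4) s'(3)] rad_pi_over R(2)])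
  then show ?thesis
    by (rule pi_over_mono[OF _ sigma_rad_components[OF X i] order_refl order_refl])
qed

text \<open>The radical \<open>?W\<close> is normal in \<open>A\<close>, so \<open>Y <#> ?W\<close>
  is \<sigma>-subnormal in \<open>H\<close> and a \<sigma> i-group over \<open>Y\<close>; the second
  fact applies.\<close>

lemma sigma_rad_mono_sn:
  assumes A: "sn A H" and X: "normal_in X A" and Y: "normal_in Y H" and XY: "X \<subseteq> Y"
  shows "sigma_rad X A \<subseteq> sigma_rad Y H"
proof (rule sigma_rad_least[OF normal_in_subgroup(1)[OF sigma_rad_normal_in(1)[OF Y]]])
  fix i assume i: "i \<in> I"
  note sA = sn_subgroup[OF A] and sY = normal_in_subgroup[OF Y]
  let ?W = "rad (\<sigma> i) X A"
  note W = rad_normal_in[OF X, of "\<sigma> i"]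
  note sW = normal_in_subgroup[OF W(1)]
  have "sn (Y <#> ?W) H"
    by (rule sn_set_mult_normal[OF sn_trans[OF normal_in_sn[OF W(1)] A] Y])
  moreover have "pi_over (\<sigma> i) (Y <#> ?W) Y"
    by (rule pi_over_set_mult[OF sY(1) sW(1) normalizes_subset[OF sY(4)] rad_pi_over XY])
      (use sW(3) sA(3) in blast)
  ultimately have "Y <#> ?W \<subseteq> rad (\<sigma> i) Y H"
    by (intro sn_subset_rad i Y set_mult_incl(1)[OF sY(1) sW(1)])
  then show "?W \<subseteq> sigma_rad Y H"
    using set_mult_incl(2)[OF sY(1) sW(1)] rad_subset_sigma_rad[OF i] by blast
qed

text \<open>Here \<open>A\<close> is an arbitrary subgroup, as inheritance by subgroups requires.
  For each class, a power of \<open>x\<close> with exponent prime to \<open>\<sigma> i\<close> lies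
  in the intersection of \<open>A\<close> with the radical of \<open>H\<close>, hence in the radical
  of \<open>A\<close>; \<open>mem_if_sigma_powers_mem\<close> combines the classes.\<close>

lemma sigma_rad_Int_subset:
  assumes A: "subgroup A G" "A \<subseteq> H" and X: "normal_in X A" and Y: "normal_in Y H" and YX: "Y \<inter> A \<subseteq> X"
  shows "sigma_rad Y H \<inter> A \<subseteq> sigma_rad X A"
proof
  fix x assume x: "x \<in> sigma_rad Y H \<inter> A"
  note S = sigma_rad_normal_in[OF X]
  show "x \<in> sigma_rad X A"
  proof (rule mem_if_sigma_powers_mem[OF partition normal_in_subgroup(1)[OF S(1)]])
    show "x \<in> carrier G" using x subgroup.mem_carrier[OF A(1)] by blast
    fix i assume i: "i \<in> I"
    obtain m where m: "pi_number (- \<sigma> i) m" "x [^] m \<in> rad (\<sigma> i) Y H"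
      using sigma_rad_pi_over[OF Y i] x by (auto elim: pi_overE)
    let ?D = "rad (\<sigma> i) Y H \<inter> A"
    have D: "normal_in ?D A"
      using normal_in_Int[OF rad_normal_in(1)[OF Y] A(1)] A(2) by (simp add: Int_absorb1)
    note sD = normal_in_subgroup[OF D] and sX = normal_in_subgroup[OF X]
    have "pi_over (\<sigma> i) ?D (Y \<inter> A)" by (rule pi_over_Int[OF rad_pi_over A(1)])
    then have "pi_over (\<sigma> i) (X <#> ?D) X"
      by (rule pi_over_set_mult[OF sX(1) sD(1) normalizes_subset[OF sX(4) sD(3)] _ YX])
    then have "X <#> ?D \<subseteq> rad (\<sigma> i) X A"
      by (intro rad_greatest normal_in_set_mult X D set_mult_incl(1)[OF sX(1) sD(1)])
    then have "?D \<subseteq> sigma_rad X A"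
      using set_mult_incl(2)[OF sX(1) sD(1)] rad_subset_sigma_rad[OF i] by blast
    moreover have "x [^] m \<in> ?D" using m(2) x subgroup_pow_mem[OF A(1)] by blast
    ultimately show "\<exists>m. pi_number (- \<sigma> i) m \<and> x [^] m \<in> sigma_rad X A" using m(1) by blast
  qed
qed

primrec sigma_series :: "'a set \<Rightarrow> nat \<Rightarrow> 'a set" where
  "sigma_series H 0 = {\<one>}"
| "sigma_series H (Suc k) = sigma_rad (sigma_series H k) H"

lemma sigma_series_normal_in: "subgroup H G \<Longrightarrow> normal_in (sigma_series H k) H"
proof (induction k)
  case 0
  then show ?case
    using subgroup.one_closed[OF 0] subgroup.mem_carrier[OF 0]
    by (simp add: normal_in_def triv_subgroup normalizes_def)
qed (simp add: sigma_rad_normal_in)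

lemma sigma_series_mono:
  assumes "subgroup H G" "k \<le> l" shows "sigma_series H k \<subseteq> sigma_series H l"
  using assms(2)
proof (induction rule: dec_induct)
  case (step l)
  then show ?case using sigma_rad_normal_in(2)[OF sigma_series_normal_in[OF assms(1), of l]] by simp
qed simp

lemma sigma_series_mono_sn:
  assumes "sn A H" shows "sigma_series A k \<subseteq> sigma_series H k"
proof (induction k)
  case (Suc k)
  then show ?case
    using sigma_rad_mono_sn[OF assms sigma_series_normal_in sigma_series_normal_in]
      sn_subgroup[OF assms] by simp
qed simp

lemma sigma_series_Int_subset:
  assumes "subgroup A G" "subgroup H G" "A \<subseteq> H"
  shows "sigma_series H k \<inter> A \<subseteq> sigma_series A k"
proof (induction k)
  case (Suc k)
  then show ?case
    using sigma_rad_Int_subset[OF assms(1,3) sigma_series_normal_in sigma_series_normal_in] assms by simp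
qed simp

section \<open>Nilpotency, solubility and length expressed by the series\<close>

lemma sigma_primary_factor_iff:
  assumes N: "normal_in N H"
  shows "sigma_primary I \<sigma> (G\<lparr>carrier := H\<rparr> Mod N) \<longleftrightarrow> (\<exists>i\<in>I. pi_over (\<sigma> i) H N)"
proof -
  let ?Q = "G\<lparr>carrier := H\<rparr> Mod N"
  note f = factor_group[OF N refl]
  have "finite H"
    by (rule finite_subset[OF subgroup.subset[OF normal_in_subgroup(2)[OF N]] fin])
  then have fQ: "finite (carrier ?Q)" using f(7) by simp
  then have "order ?Q > 0" using monoid.order_gt_0_iff_finite[OF group.is_monoid[OF f(1)]] by simp
  then show ?thesis
    unfolding sigma_primary_def pi_over_iff_order_factor[OF N fin refl] pi_number_def
    using f(1) fQ by simp
qed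

text \<open>Pulls the direct factors back to \<open>H\<close>. For each \<open>i\<close>, raising
  \<open>x\<close> to the product of the orders of the factors outside class \<open>i\<close> lands
  in the radical for \<open>i\<close>, and \<open>mem_if_sigma_powers_mem\<close> finishes.\<close>

lemma sigma_rad_if_sigma_nilpotent:
  assumes N: "normal_in N H" and nil: "sigma_nilpotent I \<sigma> (G\<lparr>carrier := H\<rparr> Mod N)"
  shows "H \<subseteq> sigma_rad N H"
proof
  note sN = normal_in_subgroup[OF N]
  define Q where "Q = G\<lparr>carrier := H\<rparr> Mod N"
  note f = factor_group[OF N Q_def]
  obtain J :: "nat set" and K :: "nat \<Rightarrow> 'a set monoid" where J: "finite J" "\<And>j. j \<in> J \<Longrightarrow> sigma_primary I \<sigma> (K j)"
    and "Q \<cong> product_group J K"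
    using nil unfolding sigma_nilpotent_def Q_def by blast
  then obtain f where iso: "f \<in> iso Q (product_group J K)" unfolding is_iso_def by auto
  have K: "group (K j)" if "j \<in> J" for j using J(2)[OF that] by (simp add: sigma_primary_def)
  have "\<exists>i\<in>I. pi_number (\<sigma> i) (order (K j))" if "j \<in> J" for j
    using J(2)[OF that] monoid.order_gt_0_iff_finite[OF group.is_monoid[OF K[OF that]]]
    by (simp add: sigma_primary_def pi_number_def)
  then obtain c where c: "\<And>j. j \<in> J \<Longrightarrow> c j \<in> I" "\<And>j. j \<in> J \<Longrightarrow> pi_number (\<sigma> (c j)) (order (K j))"
    by metis
  define \<phi> where "\<phi> j x = f (N #> x) j" for j x
  have fhom: "f (p \<otimes>\<^bsub>Q\<^esub> q) = (\<lambda>j\<in>J. f p j \<otimes>\<^bsub>K j\<^esub> f q j)" if "p \<in> carrier Q" "q \<in> carrier Q" for p q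
    using iso that by (simp add: iso_def hom_def)
  have fcar: "f q \<in> (\<Pi>\<^sub>E j\<in>J. carrier (K j))" if "q \<in> carrier Q" for q
    using iso that unfolding iso_def hom_def by auto
  have \<phi>_car: "\<phi> j x \<in> carrier (K j)" if "j \<in> J" "x \<in> H" for j x
    using fcar[OF f(2)[OF that(2)]] that(1) by (auto simp: \<phi>_def)
  have \<phi>_mult: "\<phi> j (x \<otimes> y) = \<phi> j x \<otimes>\<^bsub>K j\<^esub> \<phi> j y" if "j \<in> J" "x \<in> H" "y \<in> H" for j x y
    using fhom[OF f(2)[OF that(2)] f(2)[OF that(3)]] f(3)[OF that(2,3)] that(1) by (simp add: \<phi>_def)
  have hom: "group_hom (G\<lparr>carrier := H\<rparr>) (K j) (\<phi> j)" if "j \<in> J" for j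
    using subgroup_imp_group[OF sN(2)] K[OF that] \<phi>_car[OF that] \<phi>_mult[OF that]
    by (auto simp: group_hom_def group_hom_axioms_def hom_def)
  have \<phi>_one: "\<phi> j \<one> = \<one>\<^bsub>K j\<^esub>" if "j \<in> J" for j
    using group_hom.hom_one[OF hom[OF that]] by simp
  have \<phi>_inv: "\<phi> j (inv x) = inv\<^bsub>K j\<^esub> (\<phi> j x)" if "j \<in> J" "x \<in> H" for j x
    using group_hom.hom_inv[OF hom[OF that(1)], of x] that(2) m_inv_consistent[OF sN(2) that(2)] by simp
  have \<phi>_pow: "\<phi> j (x [^] (m::nat)) = \<phi> j x [^]\<^bsub>K j\<^esub> m" if "j \<in> J" "x \<in> H" for j x m
    using group_hom.hom_nat_pow[OF hom[OF that(1)], of x m] that(2) nat_pow_consistent[of x m H] by simp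
  have \<phi>_N: "x \<in> N \<longleftrightarrow> (\<forall>j\<in>J. \<phi> j x = \<one>\<^bsub>K j\<^esub>)" if x: "x \<in> H" for x
  proof -
    have oneH: "\<one> \<in> H" by (rule subgroup.one_closed[OF sN(2)])
    have "x \<in> N \<longleftrightarrow> N #> x = N #> \<one>"
      using f(5)[OF x] f(5)[OF oneH] subgroup.one_closed[OF sN(1)] by simp
    also have "\<dots> \<longleftrightarrow> f (N #> x) = f (N #> \<one>)"
      using iso f(2)[OF x] f(2)[OF oneH] by (auto simp: iso_def bij_betw_def inj_on_def)
    also have "\<dots> \<longleftrightarrow> (\<forall>j\<in>J. \<phi> j x = \<phi> j \<one>)"
      unfolding \<phi>_def using PiE_ext[OF fcar[OF f(2)[OF x]] fcar[OF f(2)[OF oneH]]] by auto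
    finally show ?thesis using \<phi>_one by simp
  qed
  \<comment> \<open>The preimage of the product of all factors assigned to class \<open>i\<close>;
    several factors may share a class.\<close>
  define W where "W i = {x \<in> H. \<forall>j\<in>J. c j \<noteq> i \<longrightarrow> \<phi> j x = \<one>\<^bsub>K j\<^esub>}" for i
  have W_sub: "subgroup (W i) G" for i
  proof (rule subgroupI)
    show "W i \<subseteq> carrier G" using subgroup.subset[OF sN(2)] by (auto simp: W_def)
    have "\<one> \<in> W i" using \<phi>_one subgroup.one_closed[OF sN(2)] by (simp add: W_def)
    then show "W i \<noteq> {}" by blast
    show "inv x \<in> W i" if "x \<in> W i" for x
      using that \<phi>_inv K subgroup.m_inv_closed[OF sN(2)] by (auto simp: W_def monoid.inv_one[OF group.is_monoid[OF K]])
    show "x \<otimes> y \<in> W i" if "x \<in> W i" "y \<in> W i" for x y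
      using that \<phi>_mult K subgroup.m_closed[OF sN(2)]
      by (auto simp: W_def monoid.l_one[OF group.is_monoid[OF K]] monoid.one_closed[OF group.is_monoid[OF K]])
  qed
  have W_norm: "normal_in (W i) H" for i
  proof -
    have "conj_by h x \<in> W i" if h: "h \<in> H" and x: "x \<in> W i" for h x
    proof -
      have xH: "x \<in> H" using x by (simp add: W_def)
      have "\<phi> j (conj_by h x) = \<one>\<^bsub>K j\<^esub>" if j: "j \<in> J" "c j \<noteq> i" for j
      proof -
        interpret K: group "K j" by (rule K[OF j(1)])
        have "\<phi> j (conj_by h x) = \<phi> j h \<otimes>\<^bsub>K j\<^esub> \<phi> j x \<otimes>\<^bsub>K j\<^esub> inv\<^bsub>K j\<^esub> \<phi> j h"
          using h xH subgroup.m_closed[OF sN(2) h xH] subgroup.m_inv_closed[OF sN(2) h]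
          by (simp add: conj_by_def \<phi>_mult[OF j(1)] \<phi>_inv[OF j(1)])
        moreover have "\<phi> j x = \<one>\<^bsub>K j\<^esub>" using x j by (simp add: W_def)
        ultimately show ?thesis using \<phi>_car[OF j(1) h] by simp
      qed
      then show ?thesis using subgroup_conj_mem[OF sN(2) h xH] by (simp add: W_def)
    qed
    then show ?thesis using W_sub sN(2) by (auto simp: normal_in_def normalizes_def W_def)
  qed
  have N_W: "N \<subseteq> W i" for i using \<phi>_N sN(3) by (auto simp: W_def)
  have pow_one: "\<phi> j (x [^] (\<Prod>j\<in>S. order (K j))) = \<one>\<^bsub>K j\<^esub>" if "j \<in> S" "S \<subseteq> J" "x \<in> H" for j S x
  proof -
    have j: "j \<in> J" using that by blast
    interpret K: group "K j" by (rule K[OF j])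
    have "order (K j) dvd (\<Prod>j\<in>S. order (K j))"
      using that J(1) by (intro dvd_prodI) (auto intro: finite_subset)
    then obtain d where "(\<Prod>j\<in>S. order (K j)) = order (K j) * d" by blast
    then have "\<phi> j (x [^] (\<Prod>j\<in>S. order (K j))) = (\<phi> j x [^]\<^bsub>K j\<^esub> order (K j)) [^]\<^bsub>K j\<^esub> d"
      using \<phi>_pow[OF j that(3)] \<phi>_car[OF j that(3)] by (simp add: K.nat_pow_pow)
    then show ?thesis using K.pow_order_eq_1[OF \<phi>_car[OF j that(3)]] by simp
  qed
  have "pi_over (\<sigma> i) (W i) N" if "i \<in> I" for i
    unfolding pi_over_def
  proof
    fix x assume x: "x \<in> W i"
    let ?S = "{j \<in> J. c j = i}"
    let ?m = "\<Prod>j\<in>?S. order (K j)"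
    have xH: "x \<in> H" using x by (simp add: W_def)
    have "\<phi> j (x [^] ?m) = \<one>\<^bsub>K j\<^esub>" if j: "j \<in> J" for j
    proof (cases "c j = i")
      case True
      then show ?thesis using pow_one[of j ?S x] j xH by auto
    next
      case False
      then have "x [^] ?m \<in> W i" using subgroup_pow_mem[OF W_sub x] by blast
      then show ?thesis using False j by (simp add: W_def)
    qed
    then have "x [^] ?m \<in> N" using \<phi>_N[OF subgroup_pow_mem[OF sN(2) xH]] by simp
    moreover have "pi_number (\<sigma> i) ?m" using J(1) c(2) by (intro pi_number_prod) auto
    ultimately show "\<exists>m. pi_number (\<sigma> i) m \<and> x [^] m \<in> N" by blast
  qed
  then have W_rad: "W i \<subseteq> sigma_rad N H" if "i \<in> I" for i
    using rad_greatest[OF W_norm N_W] rad_subset_sigma_rad that by blast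
  fix x assume x: "x \<in> H"
  show "x \<in> sigma_rad N H"
  proof (rule mem_if_sigma_powers_mem[OF partition normal_in_subgroup(1)[OF sigma_rad_normal_in(1)[OF N]]])
    show "x \<in> carrier G" by (rule subgroup.mem_carrier[OF sN(2) x])
    fix i assume i: "i \<in> I"
    let ?S = "{j \<in> J. c j \<noteq> i}"
    let ?m = "\<Prod>j\<in>?S. order (K j)"
    have "x [^] ?m \<in> W i"
      using pow_one[of _ ?S x] x subgroup_pow_mem[OF sN(2) x] by (auto simp: W_def)
    moreover have "pi_number (- \<sigma> i) ?m"
    proof (intro pi_number_prod)
      fix j assume "j \<in> ?S"
      then show "pi_number (- \<sigma> i) (order (K j))"
        using c[of j] sigma_disjoint[of "c j" i] i by (intro pi_number_mono[OF c(2)]) auto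
    qed (use J(1) in auto)
    ultimately show "\<exists>m. pi_number (- \<sigma> i) m \<and> x [^] m \<in> sigma_rad N H" using W_rad[OF i] by blast
  qed
qed

text \<open>The images of the radicals for \<open>\<sigma> i\<close> and for its complement satisfy
  \<open>sigma_nilpotentI\<close>; they commute because their commutators lie in both radicals,
  hence in \<open>N\<close>.\<close>

lemma sigma_nilpotent_if_sigma_rad:
  assumes N: "normal_in N H" and H: "H \<subseteq> sigma_rad N H"
  shows "sigma_nilpotent I \<sigma> (G\<lparr>carrier := H\<rparr> Mod N)"
proof -
  note sN = normal_in_subgroup[OF N]
  define Q where "Q = G\<lparr>carrier := H\<rparr> Mod N"
  note f = factor_group[OF N Q_def]
  have "finite H" by (rule finite_subset[OF subgroup.subset[OF sN(2)] fin])
  then have fQ: "finite (carrier Q)" using f(7) by simp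
  note R = rad_normal_in[OF N]
  have sub: "x \<in> H" if "x \<in> rad \<pi> N H" for \<pi> x using that rad_subset by blast
  have torsion: "\<exists>m. pi_number \<pi> m \<and> (N #> x) [^]\<^bsub>Q\<^esub> m = \<one>\<^bsub>Q\<^esub>" if x: "x \<in> rad \<pi> N H" for \<pi> x
  proof -
    obtain m where m: "pi_number \<pi> m" "x [^] m \<in> N" using rad_pi_over x by (rule pi_overE)
    then have "(N #> x) [^]\<^bsub>Q\<^esub> m = \<one>\<^bsub>Q\<^esub>"
      using f(4)[OF sub[OF x], of m] f(5)[OF subgroup_pow_mem[OF sN(2) sub[OF x]], of m] by simp
    then show ?thesis using m(1) by blast
  qed
  have closed: "\<exists>z\<in>rad \<pi> N H. (N #> x) \<otimes>\<^bsub>Q\<^esub> (N #> y) = N #> z"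
    if "x \<in> rad \<pi> N H" "y \<in> rad \<pi> N H" for \<pi> x y
    using f(3)[OF sub[OF that(1)] sub[OF that(2)]]
      subgroup.m_closed[OF normal_in_subgroup(1)[OF R(1)] that] by metis
  have commute: "(N #> x) \<otimes>\<^bsub>Q\<^esub> (N #> y) = (N #> y) \<otimes>\<^bsub>Q\<^esub> (N #> x)"
    if i: "i \<in> I" and x: "x \<in> rad (\<sigma> i) N H" and y: "y \<in> rad (- \<sigma> i) N H" for i x y
  proof -
    note s1 = normal_in_subgroup[OF R(1)[of "\<sigma> i"]] and s2 = normal_in_subgroup[OF R(1)[of "- \<sigma> i"]]
    have xH: "x \<in> H" and yH: "y \<in> H" using sub x y by auto
    note c = subgroup.mem_carrier[OF sN(2) xH] subgroup.mem_carrier[OF sN(2) yH]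
    define z where "z = conj_by x y \<otimes> inv y"
    have z1: "z \<in> rad (- \<sigma> i) N H" unfolding z_def
      by (rule subgroup.m_closed[OF s2(1) normalizesD[OF s2(4) xH y] subgroup.m_inv_closed[OF s2(1) y]])
    have "z = x \<otimes> conj_by y (inv x)" unfolding z_def using c by (simp add: conj_by_def m_assoc)
    then have z2: "z \<in> rad (\<sigma> i) N H"
      using subgroup.m_closed[OF s1(1) x normalizesD[OF s1(4) yH subgroup.m_inv_closed[OF s1(1) x]]]
      by simp
    have zH: "z \<in> H" using sub z1 by auto
    obtain k where k: "pi_number (- \<sigma> i) k" "z [^] k \<in> N" using rad_pi_over z1 by (rule pi_overE)
    obtain l where l: "pi_number (\<sigma> i) l" "z [^] l \<in> N" using rad_pi_over z2 by (rule pi_overE)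
    have "z \<in> N"
      using coprime_powers_mem[OF sN(1) subgroup.mem_carrier[OF sN(2) zH] k(2) l(2)]
        pi_number_coprime[OF k(1) l(1)] by auto
    then have "N #> z = \<one>\<^bsub>Q\<^esub>" using f(5)[OF zH] by simp
    moreover have "x \<otimes> y = z \<otimes> (y \<otimes> x)"
      unfolding z_def using c by (simp add: conj_by_def m_assoc)
    moreover have yxH: "y \<otimes> x \<in> H" by (rule subgroup.m_closed[OF sN(2) yH xH])
    ultimately have "N #> (x \<otimes> y) = N #> (y \<otimes> x)"
      using f(3)[OF zH yxH] f(2)[OF yxH] monoid.l_one[OF group.is_monoid[OF f(1)]] by simp
    then show ?thesis using f(3)[OF xH yH] f(3)[OF yH xH] by simp
  qed
  have "sigma_nilpotent I \<sigma> Q"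
  proof (rule sigma_nilpotentI[OF f(1) fQ partition, where U = "\<lambda>i. (\<lambda>x. N #> x) ` rad (\<sigma> i) N H"
        and V = "\<lambda>i. (\<lambda>x. N #> x) ` rad (- \<sigma> i) N H"])
    fix i q assume i: "i \<in> I" and "q \<in> carrier Q"
    then obtain x where x: "x \<in> H" "q = N #> x" using f(6) by blast
    then have "x \<in> rad (\<sigma> i) N H <#> rad (- \<sigma> i) N H"
      using H sigma_rad_components[OF N i] by blast
    then obtain u v where uv: "u \<in> rad (\<sigma> i) N H" "v \<in> rad (- \<sigma> i) N H" "x = u \<otimes> v"
      by (rule set_mult_memE)
    then have "q = (N #> u) \<otimes>\<^bsub>Q\<^esub> (N #> v)" using f(3) sub x(2) by simp
    then show "\<exists>u\<in>(\<lambda>x. N #> x) ` rad (\<sigma> i) N H. \<exists>v\<in>(\<lambda>x. N #> x) ` rad (- \<sigma> i) N H. q = u \<otimes>\<^bsub>Q\<^esub> v"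
      using uv by blast
  qed (use f(2) sub torsion closed commute in blast)+
  then show ?thesis by (simp add: Q_def)
qed

text \<open>At the first level where \<open>H\<close> meets the series outside \<open>K\<close>,
  some radical meets \<open>H\<close> in a normal subgroup \<open>?D\<close> not contained in
  \<open>K\<close>. As \<open>H/K\<close> is chief, \<open>K <#> ?D = H\<close>, so
  \<open>H/K\<close> is \<sigma>-primary.\<close>

lemma sigma_soluble_if_series:
  assumes A: "subgroup A G" and ser: "sigma_series A n = A"
  shows "sigma_soluble I \<sigma> (G\<lparr>carrier := A\<rparr>)"
  unfolding sigma_soluble_def
proof (intro allI impI)
  fix H K assume "chief_factor (G\<lparr>carrier := A\<rparr>) H K"
  then have H: "normal_in H A" and K: "normal_in K A" and KH: "K \<subset> H"
    and chief: "\<And>N. normal_in N A \<Longrightarrow> K \<subseteq> N \<Longrightarrow> N \<subseteq> H \<Longrightarrow> N = K \<or> N = H"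
    using normal_in_iff_normal[OF A] by (auto simp: chief_factor_def)
  note sH = normal_in_subgroup[OF H] and sK = normal_in_subgroup[OF K]
  have "H \<inter> sigma_series A n \<subseteq> K \<Longrightarrow> False" using ser KH sH(3) by blast
  moreover have "H \<inter> sigma_series A 0 \<subseteq> K" using subgroup.one_closed[OF sK(1)] by auto
  ultimately obtain k where k: "H \<inter> sigma_series A k \<subseteq> K" "\<not> H \<inter> sigma_series A (Suc k) \<subseteq> K"
    using dec_induct[of 0 n "\<lambda>k. H \<inter> sigma_series A k \<subseteq> K"] by blast
  let ?F = "sigma_series A k"
  note F = sigma_series_normal_in[OF A, of k]
  obtain x where x: "x \<in> H" "x \<in> sigma_rad ?F A" "x \<notin> K" using k(2) by auto
  have xc: "x \<in> carrier G" by (rule subgroup.mem_carrier[OF sH(1) x(1)])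
  \<comment> \<open>The contrapositive of \<open>mem_if_sigma_powers_mem\<close>; it guarantees that
    the power of \<open>x\<close> found in the radical stays outside \<open>K\<close>.\<close>
  obtain i where i: "i \<in> I" "\<And>m. pi_number (- \<sigma> i) m \<Longrightarrow> x [^] m \<notin> K"
    using mem_if_sigma_powers_mem[OF partition sK(1) xc] x(3) by blast
  obtain m where m: "pi_number (- \<sigma> i) m" "x [^] m \<in> rad (\<sigma> i) ?F A"
    using sigma_rad_pi_over[OF F i(1)] x(2) by (rule pi_overE)
  let ?D = "rad (\<sigma> i) ?F A \<inter> H"
  note R = rad_normal_in(1)[OF F, of "\<sigma> i"]
  note sR = normal_in_subgroup[OF R]
  have D: "normal_in ?D A"
    using subgroups_Inter_pair[OF sR(1) sH(1)] A sH(3) normalizes_Int[OF sR(4) sH(4)]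
    by (auto simp: normal_in_def)
  note sD = normal_in_subgroup[OF D]
  have "x [^] m \<in> ?D" using m(2) subgroup_pow_mem[OF sH(1) x(1)] by blast
  then have "K <#> ?D \<noteq> K" using set_mult_incl(2)[OF sK(1) sD(1)] i(2)[OF m(1)] by blast
  moreover have "K <#> ?D = K \<or> K <#> ?D = H"
    by (rule chief[OF normal_in_set_mult[OF K D] set_mult_incl(1)[OF sK(1) sD(1)]
          set_mult_least[OF sH(1)]]) (use KH in auto)
  ultimately have eq: "K <#> ?D = H" by blast
  have "pi_over (\<sigma> i) ?D (?F \<inter> H)" by (rule pi_over_Int[OF rad_pi_over sH(1)])
  then have "pi_over (\<sigma> i) (K <#> ?D) K"
    by (rule pi_over_set_mult[OF sK(1) sD(1) normalizes_subset[OF sK(4) sD(3)]]) (use k(1) in blast)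
  then have "pi_over (\<sigma> i) H K" using eq by simp
  moreover have "normal_in K H" using KH by (intro normal_in_mono[OF K sH(1) _ sH(3)]) auto
  ultimately show "sigma_primary I \<sigma> (G\<lparr>carrier := A\<rparr>\<lparr>carrier := H\<rparr> Mod K)"
    using sigma_primary_factor_iff i(1) by auto
qed

text \<open>A smallest normal subgroup of \<open>A\<close> strictly above a proper term forms a
  chief factor with it. That factor is \<sigma>-primary, so the next term contains the subgroup and
  is strictly larger.\<close>

lemma sigma_series_if_soluble:
  assumes A: "subgroup A G" and sol: "sigma_soluble I \<sigma> (G\<lparr>carrier := A\<rparr>)"
  shows "\<exists>n. sigma_series A n = A"
proof -
  have finA: "finite A" by (rule finite_subset[OF subgroup.subset[OF A] fin])
  note ser = sigma_series_normal_in[OF A]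
  have finS: "finite (sigma_series A k)" for k
    using normal_in_subgroup(3)[OF ser] finA by (rule finite_subset)
  have grow: "sigma_series A k \<subset> sigma_series A (Suc k)" if ne: "sigma_series A k \<noteq> A" for k
  proof -
    let ?F = "sigma_series A k"
    define P where "P D \<longleftrightarrow> normal_in D A \<and> ?F \<subset> D" for D
    have "P A" using ne normal_in_subgroup(3)[OF ser, of k] normal_in_refl[OF A] by (auto simp: P_def)
    then obtain D where D: "P D" "\<And>E. P E \<Longrightarrow> card D \<le> card E"
      using ex_has_least_nat[of P A card] by blast
    then have nD: "normal_in D A" and FD: "?F \<subset> D" by (auto simp: P_def)
    have finD: "finite D" using normal_in_subgroup(3)[OF nD] finA by (rule finite_subset)
    have min: "N = ?F \<or> N = D" if "normal_in N A" "?F \<subseteq> N" "N \<subseteq> D" for N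
    proof (cases "?F = N")
      case False
      then have "card D \<le> card N" using that by (intro D(2)) (auto simp: P_def)
      then have "N = D" using card_seteq[OF finD that(3)] by simp
      then show ?thesis ..
    qed simp
    have "chief_factor (G\<lparr>carrier := A\<rparr>) D ?F"
      using nD ser FD min normal_in_iff_normal[OF A] by (simp add: chief_factor_def)
    then have "sigma_primary I \<sigma> (G\<lparr>carrier := D\<rparr> Mod ?F)"
      using sol by (auto simp: sigma_soluble_def)
    moreover have "normal_in ?F D"
      using FD normal_in_subgroup[OF nD] by (intro normal_in_mono[OF ser]) auto
    ultimately obtain i where i: "i \<in> I" "pi_over (\<sigma> i) D ?F"
      using sigma_primary_factor_iff by blast
    then have "D \<subseteq> rad (\<sigma> i) ?F A" using FD by (intro rad_greatest nD) auto
    then have "D \<subseteq> sigma_series A (Suc k)" using rad_subset_sigma_rad[OF i(1)] by simp blast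
    with FD show ?thesis by (rule psubset_subset_trans)
  qed
  \<comment> \<open>Strict growth from a first term of order 1; at \<open>k = card A\<close> only
    the equality is possible.\<close>
  have "sigma_series A k = A \<or> k < card (sigma_series A k)" for k
  proof (induction k)
    case (Suc k)
    show ?case
    proof (cases "sigma_series A k = A")
      case True
      then show ?thesis
        using sigma_series_mono[OF A le_SucI[OF order_refl], of k] normal_in_subgroup(3)[OF ser, of "Suc k"]
        by blast
    next
      case False
      then show ?thesis using Suc psubset_card_mono[OF finS grow[OF False]] by linarith
    qed
  qed simp
  then have "sigma_series A (card A) = A"
    using card_mono[OF finA normal_in_subgroup(3)[OF ser]] by (meson leD)
  then show ?thesis ..
qed

text \<open>The series rises fastest: by induction \<open>C i\<close> lies in its
  \<open>i\<close>-th term, where monotonicity is applied to the normal subgroup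
  \<open>C (Suc i)\<close> of \<open>A\<close>.\<close>

lemma sigma_series_if_normal_chain:
  assumes A: "subgroup A G" and C: "sigma_nilpotent_normal_chain I \<sigma> (G\<lparr>carrier := A\<rparr>) k C"
  shows "sigma_series A k = A"
proof -
  have C0: "C 0 = {\<one>}" and Ck: "C k = A" and norm: "\<And>i. i \<le> k \<Longrightarrow> normal_in (C i) A"
    and step: "\<And>i. i < k \<Longrightarrow> C i \<subseteq> C (Suc i)"
      "\<And>i. i < k \<Longrightarrow> sigma_nilpotent I \<sigma> (G\<lparr>carrier := C (Suc i)\<rparr> Mod C i)"
    using C normal_in_iff_normal[OF A] by (auto simp: sigma_nilpotent_normal_chain_def)
  have "i \<le> k \<Longrightarrow> C i \<subseteq> sigma_series A i" for i
  proof (induction i)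
    case (Suc i)
    then have i: "i < k" by simp
    have n: "normal_in (C i) A" "normal_in (C (Suc i)) A" using norm i by auto
    have ni: "normal_in (C i) (C (Suc i))"
      by (rule normal_in_mono[OF n(1) normal_in_subgroup(1)[OF n(2)] step(1)[OF i] normal_in_subgroup(3)[OF n(2)]])
    have "C (Suc i) \<subseteq> sigma_rad (C i) (C (Suc i))"
      by (rule sigma_rad_if_sigma_nilpotent[OF ni step(2)[OF i]])
    also have "\<dots> \<subseteq> sigma_rad (sigma_series A i) A"
      using Suc i by (intro sigma_rad_mono_sn[OF normal_in_sn[OF n(2)] ni sigma_series_normal_in[OF A]]) auto
    finally show ?case by simp
  qed (simp add: C0)
  then have "A \<subseteq> sigma_series A k" using Ck by auto
  then show ?thesis using normal_in_subgroup(3)[OF sigma_series_normal_in[OF A]] by blast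
qed

lemma sigma_series_normal_chain:
  assumes A: "subgroup A G" and n: "sigma_series A n = A"
  shows "sigma_nilpotent_normal_chain I \<sigma> (G\<lparr>carrier := A\<rparr>) n (sigma_series A)"
proof -
  note ser = sigma_series_normal_in[OF A]
  have "sigma_nilpotent I \<sigma> (G\<lparr>carrier := sigma_series A (Suc i)\<rparr> Mod sigma_series A i)" for i
  proof (rule sigma_nilpotent_if_sigma_rad)
    note s = normal_in_subgroup[OF ser[of "Suc i"]]
    have le: "sigma_series A i \<subseteq> sigma_series A (Suc i)" by (rule sigma_series_mono[OF A]) simp
    show ni: "normal_in (sigma_series A i) (sigma_series A (Suc i))"
      by (rule normal_in_mono[OF ser s(1) le s(3)])
    \<comment> \<open>The series forms radicals in \<open>A\<close>, but \<sigma>-nilpotency of the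
      factor concerns radicals in the next term; restriction to subgroups reconciles them.\<close>
    have "sigma_rad (sigma_series A i) A \<inter> sigma_series A (Suc i)
        \<subseteq> sigma_rad (sigma_series A i) (sigma_series A (Suc i))"
      by (rule sigma_rad_Int_subset[OF s(1,3) ni ser]) blast
    then show "sigma_series A (Suc i) \<subseteq> sigma_rad (sigma_series A i) (sigma_series A (Suc i))"
      by simp
  qed
  then show ?thesis
    unfolding sigma_nilpotent_normal_chain_def
    using n normal_in_iff_normal[OF A] ser sigma_series_mono[OF A, of i "Suc i" for i]
    by (auto simp del: sigma_series.simps(2))
qed

text \<open>The \<open>LEAST\<close> in \<open>sigma_length\<close> is controlled only if some chain
  exists. Solubility provides one through the series; conversely, a series that reaches
  \<open>A\<close> gives both solubility and a chain of length \<open>n\<close>.\<close>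

lemma sigma_length_le_iff:
  assumes A: "subgroup A G"
  shows "sigma_length_le I \<sigma> (G\<lparr>carrier := A\<rparr>) n \<longleftrightarrow> sigma_series A n = A"
proof
  assume "sigma_length_le I \<sigma> (G\<lparr>carrier := A\<rparr>) n"
  then have sol: "sigma_soluble I \<sigma> (G\<lparr>carrier := A\<rparr>)"
    and len: "sigma_length I \<sigma> (G\<lparr>carrier := A\<rparr>) \<le> n" by (auto simp: sigma_length_le_def)
  obtain l where "sigma_series A l = A" using sigma_series_if_soluble[OF A sol] ..
  then have "\<exists>k C. sigma_nilpotent_normal_chain I \<sigma> (G\<lparr>carrier := A\<rparr>) k C"
    using sigma_series_normal_chain[OF A] by blast
  then have "\<exists>C. sigma_nilpotent_normal_chain I \<sigma> (G\<lparr>carrier := A\<rparr>)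
      (sigma_length I \<sigma> (G\<lparr>carrier := A\<rparr>)) C"
    unfolding sigma_length_def by (rule LeastI_ex)
  then obtain C where
    "sigma_nilpotent_normal_chain I \<sigma> (G\<lparr>carrier := A\<rparr>) (sigma_length I \<sigma> (G\<lparr>carrier := A\<rparr>)) C" ..
  then have "sigma_series A (sigma_length I \<sigma> (G\<lparr>carrier := A\<rparr>)) = A"
    by (rule sigma_series_if_normal_chain[OF A])
  then show "sigma_series A n = A"
    using sigma_series_mono[OF A len] normal_in_subgroup(3)[OF sigma_series_normal_in[OF A], of n] by blast
next
  assume n: "sigma_series A n = A"
  have "sigma_length I \<sigma> (G\<lparr>carrier := A\<rparr>) \<le> n"
    unfolding sigma_length_def using sigma_series_normal_chain[OF A n] by (intro Least_le) blast
  then show "sigma_length_le I \<sigma> (G\<lparr>carrier := A\<rparr>) n"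
    using sigma_soluble_if_series[OF A n] by (simp add: sigma_length_le_def)
qed

section \<open>Return to the stated notions and the sublattice\<close>

text \<open>The residual is normal in \<open>H\<close>, so it lies in \<open>A\<close> exactly when
  it lies in the core, which in turn says that the quotient by the core is a \<sigma>
  i-group.\<close>

lemma sn_step_iff:
  assumes A: "subgroup A G" and H: "subgroup H G" and AH: "A \<subseteq> H"
  shows "sn_step A H \<longleftrightarrow> A \<lhd> G\<lparr>carrier := H\<rparr> \<or>
    sigma_primary I \<sigma> (G\<lparr>carrier := H\<rparr> Mod normal_core (G\<lparr>carrier := H\<rparr>) A)"
proof -
  interpret H: group "G\<lparr>carrier := H\<rparr>" by (rule subgroup_imp_group[OF H])
  let ?C = "normal_core (G\<lparr>carrier := H\<rparr>) A"
  note core = H.normal_core_greatest[OF subgroup_incl[OF A H AH]]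
  have C: "normal_in ?C H" using core(1) normal_in_iff_normal[OF H] by simp
  note sC = normal_in_subgroup[OF C]
  have "residual (\<sigma> i) H \<subseteq> A \<longleftrightarrow> pi_over (\<sigma> i) H ?C" if "i \<in> I" for i
  proof
    assume "residual (\<sigma> i) H \<subseteq> A"
    then have "residual (\<sigma> i) H \<subseteq> ?C"
      using residual_normal_in[OF H] normal_in_iff_normal[OF H] by (intro core(3)) auto
    then show "pi_over (\<sigma> i) H ?C"
      by (rule pi_over_mono[OF residual_pi_over[OF fin H] order_refl _ order_refl])
  next
    assume "pi_over (\<sigma> i) H ?C"
    then show "residual (\<sigma> i) H \<subseteq> A"
      using residual_least[OF sC(1) _ subgroup.subset[OF H]] core(2) by blast
  qed
  then show ?thesis
    using A H AH normal_in_iff_normal[OF H] sigma_primary_factor_iff[OF C] by (auto simp: sn_step_def)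
qed

lemma sigma_subnormal_iff: "sigma_subnormal I \<sigma> G A \<longleftrightarrow> sn A (carrier G)"
proof
  assume "sigma_subnormal I \<sigma> G A"
  then obtain t C where C: "C 0 = A" "C t = carrier G" "\<And>i. i \<le> t \<Longrightarrow> subgroup (C i) G"
    and step: "\<And>i. i < t \<Longrightarrow> C i \<subseteq> C (Suc i) \<and>
      (C i \<lhd> G\<lparr>carrier := C (Suc i)\<rparr> \<or> sigma_primary I \<sigma>
        (G\<lparr>carrier := C (Suc i)\<rparr> Mod normal_core (G\<lparr>carrier := C (Suc i)\<rparr>) (C i)))"
    unfolding sigma_subnormal_def by blast
  have "i \<le> t \<Longrightarrow> sn A (C i)" for i
  proof (induction i)
    case 0
    then show ?case using C(1) C(3)[of 0] by (simp add: sn_refl)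
  next
    case (Suc i)
    then have "sn_step (C i) (C (Suc i))"
      using sn_step_iff[of "C i" "C (Suc i)"] C(3) step[of i] by simp
    then show ?case using Suc sn_trans sn_stepI by (meson Suc_leD)
  qed
  then show "sn A (carrier G)" using C(2) by (metis order_refl)
next
  assume sn: "sn A (carrier G)"
  then have "sn_step\<^sup>*\<^sup>* A (carrier G)" by (simp add: sn_def)
  then obtain t where "(sn_step ^^ t) A (carrier G)" by (meson rtranclp_imp_relpowp)
  then obtain C where C: "C 0 = A" "C t = carrier G" "\<And>i. i < t \<Longrightarrow> sn_step (C i) (C (Suc i))"
    unfolding relpowp_fun_conv by blast
  have sub: "subgroup (C i) G" if "i \<le> t" for i
    using that C(2) sn_step_subgroup(1)[OF C(3)] subgroup_self by (cases "i = t") auto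
  have "C i \<subseteq> C (Suc i) \<and> (C i \<lhd> G\<lparr>carrier := C (Suc i)\<rparr> \<or> sigma_primary I \<sigma>
      (G\<lparr>carrier := C (Suc i)\<rparr> Mod normal_core (G\<lparr>carrier := C (Suc i)\<rparr>) (C i)))" if "i < t" for i
    using C(3)[OF that] sn_step_iff sn_step_subgroup[OF C(3)[OF that]] by blast
  then show "sigma_subnormal I \<sigma> G A"
    unfolding sigma_subnormal_def using C(1,2) sub by blast
qed

lemma sublattice_sigma_subnormal_length_le:
  "sublattice (subgroup_lattice G)
    {A. sigma_subnormal I \<sigma> G A \<and> sigma_length_le I \<sigma> (G\<lparr>carrier := A\<rparr>) n}"
proof -
  let ?S = "{A. sigma_subnormal I \<sigma> G A \<and> sigma_length_le I \<sigma> (G\<lparr>carrier := A\<rparr>) n}"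
  have iff: "A \<in> ?S \<longleftrightarrow> sn A (carrier G) \<and> sigma_series A n = A" for A
    using sigma_subnormal_iff sigma_length_le_iff sn_subgroup(1) by blast
  have le: "sigma_series A n = A" if "subgroup A G" "A \<subseteq> sigma_series A n" for A
    using that normal_in_subgroup(3)[OF sigma_series_normal_in[OF that(1)]] by blast
  \<comment> \<open>The trivial subgroup witnesses that the set is nonempty.\<close>
  have "sigma_series {\<one>} 0 \<subseteq> sigma_series {\<one>} n" by (rule sigma_series_mono[OF triv_subgroup]) simp
  then have "{\<one>} \<in> ?S"
    unfolding iff using le[OF triv_subgroup] normal_in_sn sigma_series_normal_in[OF subgroup_self, of 0]
    by simp
  moreover have "A \<sqinter>\<^bsub>subgroup_lattice G\<^esub> B \<in> ?S \<and> A \<squnion>\<^bsub>subgroup_lattice G\<^esub> B \<in> ?S"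
    if "A \<in> ?S" "B \<in> ?S" for A B
  proof -
    have A: "sn A (carrier G)" "sigma_series A n = A" and B: "sn B (carrier G)" "sigma_series B n = B"
      using that unfolding iff by auto
    note sA = sn_subgroup[OF A(1)] and sB = sn_subgroup[OF B(1)]
    have AB: "subgroup (A \<inter> B) G" by (rule subgroups_Inter_pair[OF sA(1) sB(1)])
    have "sn (A \<inter> B) (carrier G \<inter> B)" by (rule sn_Int[OF A(1) sB(1)])
    then have "sn (A \<inter> B) (carrier G)" using B(1) sB(3) sn_trans by (simp add: Int_absorb1)
    moreover have "sigma_series (A \<inter> B) n = A \<inter> B"
      using sigma_series_Int_subset[OF AB sA(1) Int_lower1, of n] A(2) by (intro le[OF AB]) auto
    ultimately have 1: "A \<inter> B \<in> ?S" unfolding iff by simp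
    let ?J = "generate G (A \<union> B)"
    note J = generate_join[OF sA(1) sB(1)]
    \<comment> \<open>\<open>A\<close> and \<open>B\<close> are \<sigma>-subnormal in
      \<open>?J\<close> too and equal their own \<open>n\<close>-th terms, so the
      \<open>n\<close>-th term of \<open>?J\<close> contains generators of
      \<open>?J\<close>.\<close>
    have "A \<subseteq> sigma_series ?J n" "B \<subseteq> sigma_series ?J n"
      using sigma_series_mono_sn[OF sn_Int_sub[OF A(1) J(1,2) subgroup.subset[OF J(1)]], of n]
        sigma_series_mono_sn[OF sn_Int_sub[OF B(1) J(1,3) subgroup.subset[OF J(1)]], of n] A(2) B(2)
      by auto
    then have "?J \<subseteq> sigma_series ?J n"
      using normal_in_subgroup(1)[OF sigma_series_normal_in[OF J(1)]] by (intro generate_subgroup_incl) auto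
    then have "?J \<in> ?S" unfolding iff using sn_join[OF A(1) B(1)] le[OF J(1)] by simp
    with 1 show ?thesis
      by (simp only: meet_subgroup_lattice[OF sA(1) sB(1)] join_subgroup_lattice[OF sA(1) sB(1)])
  qed
  moreover have "?S \<subseteq> carrier (subgroup_lattice G)"
    using iff sn_subgroup(1) unfolding subgroup_lattice_def by force
  ultimately show ?thesis unfolding sublattice_def by blast
qed

end

theorem proposition2p5:
  fixes G :: "('a, 'b) monoid_scheme"
    and I :: "nat set" and \<sigma> :: "nat \<Rightarrow> nat set" and n :: nat
  assumes "prime_partition I \<sigma>"
    and "group G" and "finite (carrier G)"
    and "n \<ge> 1"
  shows "sublattice (subgroup_lattice G)
           {A. sigma_subnormal I \<sigma> G A \<and> sigma_length_le I \<sigma> (G\<lparr>carrier := A\<rparr>) n}"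
proof -
  interpret sigma_group G I \<sigma>
    using assms by (simp add: sigma_group_def sigma_group_axioms_def)
  show ?thesis by (rule sublattice_sigma_subnormal_length_le)
qed

end
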